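(* Let $N\ge2$, $1<p<2$, and $D>0$. Then there exists $r_*>0$ such that, for every $r\in(0,r_* )$, there exist bounded $C^\infty$ uniformly convex domains $\Omega_k\subset\mathbb R^N$ ($k\in\mathbb N$) and distinct points $x_k,y_k\in\Omega_k$ satisfying \[ \operatorname{diam}(\Omega_k)=D,\qquad |x_k-y_k|=2r, \] for which, if $u_k>0$ is the first Dirichlet $p$-eigenfunction on $\Omega_k$ and \[ X_{\Omega_k}:=|\nabla\log u_k|^{p-2}\nabla\log u_k, \] then \[ \left\langle X_{\Omega_k}(y_k)-X_{\Omega_k}(x_k),\frac{y_k-x_k}{|y_k-x_k|}\right\rangle\longrightarrow0\qquad\text{as }k\to\infty. \]
   Context: For a bounded domain $\Omega\subset\mathbb R^N$ and $1<p<\infty$, the first Dirichlet eigenvalue of the $p$-Laplacian is \[ \lambda_{1,p}(\Omega)=\inf_{u\in W_0^{1,p}(\Omega)\setminus\{0\}}\frac{\int_\Omega|\nabla u|^p\,dx}{\int_\Omega|u|^p\,dx}, \] and the first Dirichlet $p$-eigenfunction is a positive minimizer $u>0$ (unique up to a positive multiplicative constant, so $\nabla\log u$ is well defined); it solves $-\operatorname{div}(|\nabla u|^{p-2}\nabla u)=\lambda_{1,p}(\Omega)u^{p-1}$ weakly in $\Omega$, $u=0$ on $\partial\Omega$, and is $C^{1}$ in $\Omega$. The map $\xi\mapsto|\xi|^{p-2}\xi$ is understood to be $0$ at $\xi=0$. A bounded $C^\infty$ domain is uniformly convex if it is convex and the second fundamental form of its boundary is bounded below by a positive constant, i.e. $\mathrm{II}_{\partial\Omega}(\tau,\tau)\ge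 c|\tau|^2$ for some $c>0$ and all tangent vectors $\tau$ to $\partial\Omega$ (the constant may depend on the domain). *)

theory Defs
  imports "HOL-Analysis.Analysis"
begin

section \<open>Smooth functions\<close>

definition grad :: "('a::euclidean_space \<Rightarrow> real) \<Rightarrow> 'a \<Rightarrow> 'a" where
  "grad f x = (\<Sum>b\<in>Basis. frechet_derivative f (at x) b *\<^sub>R b)"

text \<open>Only meaningful for open \<open>S\<close>. Quantifying over all directions \<open>v\<close> amounts to
  continuity of all iterated partial derivatives of order at most \<open>k\<close>.\<close>

primrec Ck_on ::
  "nat \<Rightarrow> 'a::euclidean_space set \<Rightarrow> ('a \<Rightarrow> 'b::real_normed_vector) \<Rightarrow> bool" where
  "Ck_on 0 S f \<longleftrightarrow> continuous_on S f"
| "Ck_on (Suc k) S f \<longleftrightarrow> (\<forall>x\<in>S. f differentiable at x) \<and>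
     (\<forall>v. Ck_on k S (\<lambda>x. frechet_derivative f (at x) v))"

definition smooth_on :: "'a::euclidean_space set \<Rightarrow> ('a \<Rightarrow> 'b::real_normed_vector) \<Rightarrow> bool" where
  "smooth_on S f \<longleftrightarrow> (\<forall>k. Ck_on k S f)"


section \<open>Smooth uniformly convex domains\<close>

definition bounded_domain :: "'a::euclidean_space set \<Rightarrow> bool" where
  "bounded_domain \<Omega> \<longleftrightarrow> \<Omega> \<noteq> {} \<and> open \<Omega> \<and> connected \<Omega> \<and> bounded \<Omega>"

text \<open>A function \<open>\<rho>\<close> that describes \<open>\<Omega>\<close> near \<open>x\<close> as a regular sublevel set; then
  \<open>frontier \<Omega> \<inter> U = {y \<in> U. \<rho> y = 0}\<close>, and \<open>grad \<rho>\<close> points out of \<open>\<Omega>\<close> there.\<close>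

definition local_defining_function ::
  "'a::euclidean_space set \<Rightarrow> 'a \<Rightarrow> 'a set \<Rightarrow> ('a \<Rightarrow> real) \<Rightarrow> bool" where
  "local_defining_function \<Omega> x U \<rho> \<longleftrightarrow>
     open U \<and> x \<in> U \<and> smooth_on U \<rho> \<and> (\<forall>y\<in>U. grad \<rho> y \<noteq> 0) \<and>
     \<Omega> \<inter> U = {y \<in> U. \<rho> y < 0}"

definition smooth_boundary :: "'a::euclidean_space set \<Rightarrow> bool" where
  "smooth_boundary \<Omega> \<longleftrightarrow> (\<forall>x \<in> frontier \<Omega>. \<exists>U \<rho>. local_defining_function \<Omega> x U \<rho>)"

definition unit_normal :: "('a::euclidean_space \<Rightarrow> real) \<Rightarrow> 'a \<Rightarrow> 'a" where
  "unit_normal \<rho> y = grad \<rho> y /\<^sub>R norm (grad \<rho> y)"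

text \<open>\<open>II(\<sigma>, \<tau>) = \<langle>D\<^sub>\<sigma> \<nu>, \<tau>\<rangle>\<close> with \<open>\<nu>\<close> the outer unit normal, so that the sphere of radius
  \<open>R\<close> has \<open>II(\<tau>, \<tau>) = \<bar>\<tau>\<bar>\<^sup>2 / R\<close>. On tangent vectors the value does not depend on the
  local defining function.\<close>

definition second_fundamental_form ::
  "('a::euclidean_space \<Rightarrow> real) \<Rightarrow> 'a \<Rightarrow> 'a \<Rightarrow> 'a \<Rightarrow> real" where
  "second_fundamental_form \<rho> x \<sigma> \<tau> = frechet_derivative (unit_normal \<rho>) (at x) \<sigma> \<bullet> \<tau>"

definition uniformly_convex :: "'a::euclidean_space set \<Rightarrow> bool" where
  "uniformly_convex \<Omega> \<longleftrightarrow> convex \<Omega> \<and>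
     (\<exists>c>0. \<forall>x \<in> frontier \<Omega>. \<exists>U \<rho>. local_defining_function \<Omega> x U \<rho> \<and>
        (\<forall>\<tau>. \<tau> \<bullet> grad \<rho> x = 0 \<longrightarrow> second_fundamental_form \<rho> x \<tau> \<tau> \<ge> c * (norm \<tau>)\<^sup>2))"


section \<open>Sobolev spaces\<close>

definition test_function :: "'a::euclidean_space set \<Rightarrow> ('a \<Rightarrow> real) \<Rightarrow> bool" where
  "test_function \<Omega> \<phi> \<longleftrightarrow> smooth_on UNIV \<phi> \<and>
     compact (closure {x. \<phi> x \<noteq> 0}) \<and> closure {x. \<phi> x \<noteq> 0} \<subseteq> \<Omega>"

definition in_Lp ::
  "real \<Rightarrow> 'a::euclidean_space set \<Rightarrow> ('a \<Rightarrow> 'b::euclidean_space) \<Rightarrow> bool" where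
  "in_Lp p \<Omega> f \<longleftrightarrow> set_borel_measurable lebesgue \<Omega> f \<and>
     set_integrable lebesgue \<Omega> (\<lambda>x. norm (f x) powr p)"

definition Lp_pow ::
  "real \<Rightarrow> 'a::euclidean_space set \<Rightarrow> ('a \<Rightarrow> 'b::euclidean_space) \<Rightarrow> real" where
  "Lp_pow p \<Omega> f = (LINT x:\<Omega>|lebesgue. norm (f x) powr p)"

text \<open>For \<open>u\<close> and \<open>Du\<close> in \<open>L\<^sup>p(\<Omega>)\<close>, \<open>p \<ge> 1\<close>, both integrals below exist.\<close>

definition weak_gradient ::
  "'a::euclidean_space set \<Rightarrow> ('a \<Rightarrow> real) \<Rightarrow> ('a \<Rightarrow> 'a) \<Rightarrow> bool" where
  "weak_gradient \<Omega> u Du \<longleftrightarrow>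
     (\<forall>\<phi>. test_function \<Omega> \<phi> \<longrightarrow> (\<forall>b\<in>Basis.
        (LINT x:\<Omega>|lebesgue. u x * (grad \<phi> x \<bullet> b)) =
        - (LINT x:\<Omega>|lebesgue. (Du x \<bullet> b) * \<phi> x)))"

text \<open>\<open>W1p p \<Omega> u Du\<close>: \<open>u \<in> W\<^sup>1\<^sup>,\<^sup>p(\<Omega>)\<close> and \<open>Du\<close> is its weak gradient (which is unique
  only almost everywhere, hence the relation). \<open>W01p\<close> is the closure of the test
  functions in \<open>W1p\<close>.\<close>

definition W1p ::
  "real \<Rightarrow> 'a::euclidean_space set \<Rightarrow> ('a \<Rightarrow> real) \<Rightarrow> ('a \<Rightarrow> 'a) \<Rightarrow> bool" where
  "W1p p \<Omega> u Du \<longleftrightarrow> in_Lp p \<Omega> u \<and> in_Lp p \<Omega> Du \<and> weak_gradient \<Omega> u Du"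

definition W01p ::
  "real \<Rightarrow> 'a::euclidean_space set \<Rightarrow> ('a \<Rightarrow> real) \<Rightarrow> ('a \<Rightarrow> 'a) \<Rightarrow> bool" where
  "W01p p \<Omega> u Du \<longleftrightarrow> W1p p \<Omega> u Du \<and>
     (\<exists>\<phi>. (\<forall>n::nat. test_function \<Omega> (\<phi> n)) \<and>
        (\<lambda>n. Lp_pow p \<Omega> (\<lambda>x. \<phi> n x - u x)) \<longlonglongrightarrow> 0 \<and>
        (\<lambda>n. Lp_pow p \<Omega> (\<lambda>x. grad (\<phi> n) x - Du x)) \<longlonglongrightarrow> 0)"


section \<open>The first Dirichlet eigenvalue and eigenfunction of the \<open>p\<close>-Laplacian\<close>

definition first_eigenvalue :: "real \<Rightarrow> 'a::euclidean_space set \<Rightarrow> real" where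
  "first_eigenvalue p \<Omega> =
     Inf {Lp_pow p \<Omega> Du / Lp_pow p \<Omega> u | u Du.
            W01p p \<Omega> u Du \<and> \<not> (AE x in lebesgue. x \<in> \<Omega> \<longrightarrow> u x = 0)}"

text \<open>Since \<open>u\<close> is evaluated pointwise below, the \<open>C\<^sup>1\<close> representative of the positive
  minimizer is meant. The values of \<open>u\<close> outside \<open>\<Omega>\<close> play no role; the boundary
  condition is membership in \<open>W01p\<close>.\<close>

definition first_eigenfunction ::
  "real \<Rightarrow> 'a::euclidean_space set \<Rightarrow> ('a \<Rightarrow> real) \<Rightarrow> bool" where
  "first_eigenfunction p \<Omega> u \<longleftrightarrow>
     (\<forall>x\<in>\<Omega>. u x > 0) \<and> Ck_on 1 \<Omega> u \<and>
     (\<exists>Du. W01p p \<Omega> u Du \<and> Lp_pow p \<Omega> Du / Lp_pow p \<Omega> u = first_eigenvalue p \<Omega>)"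

text \<open>The map \<open>\<xi> \<mapsto> \<bar>\<xi>\<bar>\<^bsup>p-2\<^esup> \<xi>\<close>, with value \<open>0\<close> at \<open>\<xi> = 0\<close>.\<close>

definition p_power :: "real \<Rightarrow> 'a::euclidean_space \<Rightarrow> 'a" where
  "p_power p \<xi> = (norm \<xi> powr (p - 2)) *\<^sub>R \<xi>"

definition log_grad_field :: "real \<Rightarrow> ('a::euclidean_space \<Rightarrow> real) \<Rightarrow> 'a \<Rightarrow> 'a" where
  "log_grad_field p u x = p_power p (grad (\<lambda>z. ln (u z)) x)"

end

theory Submission
  imports Defs "HOL-Computational_Algebra.Polynomial"
begin

text \<open>
  Write \<open>q = p / (p - 1) > 2\<close> and \<open>\<lambda>\<close> for the first eigenvalue. The field \<open>X = X\<^sub>\<Omega>\<close> solves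
  \<open>div X = - \<lambda> - (p - 1) |X|\<^sup>q\<close>. In a slab \<open>|x \<bullet> e| < \<epsilon> len\<close> the same equation with
  \<open>(p - 1) \<epsilon>\<^bsup>-p\<^esup>\<close> instead of \<open>\<lambda>\<close> has a solution \<open>W = w(x \<bullet> e) e\<close> that blows up at the faces, namely
  \<open>W = |v'|\<^bsup>p-2\<^esup> v' / v\<^bsup>p-1\<^esup> e\<close> for the eigenfunction \<open>v\<close> of the interval.

  Take for \<open>\<Omega>\<close> a pancake of diameter \<open>D\<close> and height \<open>2 H\<close> that is contained in the slab of height \<open>2 H\<close> and
  contains a cylinder of fixed radius and only slightly smaller height. Then \<open>\<lambda>\<close> and \<open>(p - 1) \<epsilon>\<^bsup>-p\<^esup>\<close>, with
  \<open>\<epsilon>\<close> belonging to the cylinder, differ by \<open>O(H\<^bsup>2-p\<^esup>)\<close>. Testing the difference of the two equations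
  with \<open>v\<^sup>p\<close> times a cutoff function of the transverse variable leaves the Bregman remainder of
  \<open>|X|\<^sup>q\<close> at \<open>W\<close>, bounded by this difference and by the cost of the cutoff, which sees only the
  component \<open>X'\<close> of \<open>X\<close> orthogonal to \<open>e\<close>. The remainder dominates \<open>|X'|\<^sup>q\<close> and
  \<open>|W|\<^bsup>q-2\<^esup> |X'|\<^sup>2\<close>, and \<open>|W|\<^bsup>q-2\<^esup>\<close> has size \<open>\<epsilon>\<^bsup>p-2\<^esup>\<close> away from the mid-plane; since \<open>p < 2\<close>, the cost is
  absorbed and the mean of \<open>|X'|\<^sup>q\<close> over the middle of \<open>\<Omega>\<close> tends to \<open>0\<close>. Hence there are points
  \<open>x\<close> and \<open>x + 2 r e\<^sub>1\<close>, \<open>e\<^sub>1\<close> orthogonal to \<open>e\<close>, where \<open>X \<bullet> e\<^sub>1\<close> is small. By Picone's identity \<open>X\<close> does not depend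
  on the choice of the eigenfunction.
\<close>

section \<open>Functions of class \<open>C\<^sup>k\<close>\<close>

text \<open>The weight \<open>v^p\<close> is forced: its gradient is
  \<open>p v^p |w|^(q-2) w e\<close>, and as \<open>(p - 1) q = p\<close> this is what turns
  \<open>|X|^q\<close> into its first-order remainder at \<open>W\<close>. Both \<open>v^p\<close>
  times a cutoff and \<open>|\<phi>|^p\<close> are only of class C^1, whereas \<open>W01p\<close>
  speaks of smooth test functions; mollification closes this gap. The energy is compared with a
  volume of order \<epsilon>, so every error must be small relative to \<epsilon>. Near the
  mid-plane \<open>|W|^(q-2)\<close> degenerates and only a constant bounds the cost of the cutoff;
  this is tolerable because that layer can be given any small relative thickness \<sigma>. The gap
  \<open>O(H^(2-p))\<close> is the size \<open>H^(-p)\<close> of the eigenvalue times the relative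
  loss of height, of order \<open>H^2\<close>; hence the weight \<open>H^2\<close> of the quadratic
  term in the defining function and the growing exponent \<open>m\<close>. Only a mean is
  controlled, so no given point is known to be good, and the points must be named before the
  eigenfunctions. They are therefore taken as near-minimisers of the size of
  \<open>X \<bullet> e1\<close>, a quantity that uniqueness makes independent of
  \<open>u\<close>.\<close>

lemma has_derivative_cong_open:
  assumes "open S" "x \<in> S" "\<And>y. y \<in> S \<Longrightarrow> f y = g y"
  shows "(f has_derivative f') (at x) \<longleftrightarrow> (g has_derivative f') (at x)"
  using has_derivative_transform_within_open[OF _ assms(1,2), of f f' UNIV g]
    has_derivative_transform_within_open[OF _ assms(1,2), of g f' UNIV f] assms(3) by auto

lemma frechet_derivative_cong_open:
  assumes "open S" "x \<in> S" "\<And>y. y \<in> S \<Longrightarrow> f y = g y"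
  shows "frechet_derivative f (at x) = frechet_derivative g (at x)"
  using has_derivative_cong_open[OF assms] by (simp add: frechet_derivative_def)

lemma differentiable_cong_open:
  assumes "open S" "x \<in> S" "\<And>y. y \<in> S \<Longrightarrow> f y = g y"
  shows "f differentiable at x \<longleftrightarrow> g differentiable at x"
  using has_derivative_cong_open[OF assms] by (simp add: differentiable_def)

lemma Ck_on_cong:
  assumes "open S" "\<And>x. x \<in> S \<Longrightarrow> f x = g x"
  shows "Ck_on k S f \<longleftrightarrow> Ck_on k S g"
  using assms(2)
proof (induction k arbitrary: f g)
  case 0
  then show ?case using continuous_on_cong[OF refl] by (metis Ck_on.simps(1))
next
  case (Suc k)
  have 1: "frechet_derivative f (at x) v = frechet_derivative g (at x) v" if "x \<in> S" for x v
    using frechet_derivative_cong_open[OF assms(1) that Suc.prems] by simp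
  have 2: "f differentiable at x \<longleftrightarrow> g differentiable at x" if "x \<in> S" for x
    using differentiable_cong_open[OF assms(1) that Suc.prems] by simp
  show ?case unfolding Ck_on.simps(2) using Suc.IH[of "\<lambda>x. frechet_derivative f (at x) v" "\<lambda>x. frechet_derivative g (at x) v" for v, OF 1] 2 by auto
qed

text \<open>Any explicit family of derivatives may stand in for \<open>frechet_derivative\<close>:
  on an open set the two agree pointwise, hence so do all higher derivatives.\<close>

lemma Ck_on_SucI:
  assumes "open S" "\<And>x. x \<in> S \<Longrightarrow> (f has_derivative f' x) (at x)"
    and "\<And>v. Ck_on k S (\<lambda>x. f' x v)"
  shows "Ck_on (Suc k) S f"
proof -
  have *: "frechet_derivative f (at x) = f' x" if "x \<in> S" for x
    using frechet_derivative_at[OF assms(2)[OF that]] by simp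
  have "Ck_on k S (\<lambda>x. frechet_derivative f (at x) v)" for v
    using Ck_on_cong[OF assms(1), of "\<lambda>x. frechet_derivative f (at x) v" "\<lambda>x. f' x v" k] *
      assms(3) by simp
  then show ?thesis using assms(2) by (auto simp: differentiable_def)
qed

lemma Ck_on_Suc_derivative:
  assumes "Ck_on (Suc k) S f" "x \<in> S"
  shows "(f has_derivative frechet_derivative f (at x)) (at x)"
  using assms frechet_derivative_works by auto

lemma Ck_on_Suc_imp: "Ck_on (Suc k) S f \<Longrightarrow> Ck_on k S f"
proof (induction k arbitrary: f)
  case 0
  then show ?case
    by (auto intro!: continuous_at_imp_continuous_on differentiable_imp_continuous_within)
next
  case (Suc k)
  show ?case unfolding Ck_on.simps(2)[of k]
    using Suc.IH Suc.prems by (auto simp del: Ck_on.simps simp add: Ck_on.simps(2)[of "Suc k"])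
qed

lemma Ck_on_mono: "Ck_on k S f \<Longrightarrow> j \<le> k \<Longrightarrow> Ck_on j S f"
  by (induction k) (auto simp del: Ck_on.simps simp: le_Suc_eq dest: Ck_on_Suc_imp)

lemma Ck_on_imp_continuous_on: "Ck_on k S f \<Longrightarrow> continuous_on S f"
  using Ck_on_mono[of k S f 0] by simp

lemma Ck_on_subset: "Ck_on k S f \<Longrightarrow> T \<subseteq> S \<Longrightarrow> Ck_on k T f"
  by (induction k arbitrary: f) (auto intro: continuous_on_subset)

lemma Ck_on_const [simp]: "Ck_on k S (\<lambda>x. c)"
proof (induction k arbitrary: c)
  case (Suc k)
  have "frechet_derivative (\<lambda>x. c) (at x) = (\<lambda>_. 0)" for x :: 'a
    using frechet_derivative_at[OF has_derivative_const] by metis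
  then show ?case using Suc by simp
qed simp

lemma Ck_on_bounded_linear:
  assumes "bounded_linear f"
  shows "Ck_on k S f"
proof -
  have "Ck_on k UNIV f"
  proof (cases k)
    case 0
    then show ?thesis using assms by (simp add: linear_continuous_on)
  next
    case (Suc j)
    show ?thesis unfolding Suc
      by (rule Ck_on_SucI[where f'="\<lambda>x. f"]) (auto intro: bounded_linear_imp_has_derivative assms)
  qed
  then show ?thesis by (rule Ck_on_subset) simp
qed

lemma Ck_on_add:
  assumes "open S" "Ck_on k S f" "Ck_on k S g"
  shows "Ck_on k S (\<lambda>x. f x + g x)"
  using assms(2,3)
proof (induction k arbitrary: f g)
  case 0
  then show ?case by (auto intro: continuous_intros)
next
  case (Suc k)
  show ?case
  proof (rule Ck_on_SucI[OF assms(1)])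
    show "((\<lambda>x. f x + g x) has_derivative
      (\<lambda>v. frechet_derivative f (at x) v + frechet_derivative g (at x) v)) (at x)" if "x \<in> S" for x
      using Suc.prems that by (intro has_derivative_add Ck_on_Suc_derivative) auto
    show "Ck_on k S (\<lambda>x. frechet_derivative f (at x) v + frechet_derivative g (at x) v)" for v
      using Suc by auto
  qed
qed

lemma Ck_on_mult:
  fixes f g :: "'a::euclidean_space \<Rightarrow> real"
  assumes "open S" "Ck_on k S f" "Ck_on k S g"
  shows "Ck_on k S (\<lambda>x. f x * g x)"
  using assms(2,3)
proof (induction k arbitrary: f g)
  case 0
  then show ?case by (auto intro: continuous_intros)
next
  case (Suc k)
  show ?case
  proof (rule Ck_on_SucI[OF assms(1)])
    show "((\<lambda>x. f x * g x) has_derivative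
      (\<lambda>v. f x * frechet_derivative g (at x) v + frechet_derivative f (at x) v * g x)) (at x)"
      if "x \<in> S" for x
      using Suc.prems that by (intro has_derivative_mult Ck_on_Suc_derivative) auto
    show "Ck_on k S (\<lambda>x. f x * frechet_derivative g (at x) v + frechet_derivative f (at x) v * g x)" for v
      using Suc.prems by (intro Ck_on_add assms(1) Suc.IH) (auto intro: Ck_on_Suc_imp)
  qed
qed

lemma Ck_on_cmult:
  fixes f :: "'a::euclidean_space \<Rightarrow> real"
  assumes "open S" "Ck_on k S f"
  shows "Ck_on k S (\<lambda>x. c * f x)"
  using Ck_on_mult[OF assms(1) Ck_on_const[of k S c] assms(2)] .

lemma Ck_on_diff:
  fixes f g :: "'a::euclidean_space \<Rightarrow> real"
  assumes "open S" "Ck_on k S f" "Ck_on k S g"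
  shows "Ck_on k S (\<lambda>x. f x - g x)"
  using Ck_on_add[OF assms(1,2) Ck_on_cmult[OF assms(1,3), of "-1"]] by simp

lemma Ck_on_power:
  fixes f :: "'a::euclidean_space \<Rightarrow> real"
  assumes "open S" "Ck_on k S f"
  shows "Ck_on k S (\<lambda>x. f x ^ m)"
  by (induction m) (auto intro: Ck_on_mult assms)

lemma Ck_on_inner_self: "Ck_on k UNIV (\<lambda>x::'a::euclidean_space. x \<bullet> x)"
proof (cases k)
  case (Suc j)
  show ?thesis unfolding Suc
  proof (rule Ck_on_SucI)
    show "((\<lambda>x. x \<bullet> x) has_derivative (\<lambda>v. x \<bullet> v + v \<bullet> x)) (at x)" for x :: 'a
      by (auto intro!: derivative_eq_intros)
    show "Ck_on j UNIV (\<lambda>x. x \<bullet> v + v \<bullet> x)" for v :: 'a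
      by (intro Ck_on_add Ck_on_bounded_linear bounded_linear_intros) auto
  qed auto
qed (auto intro!: continuous_intros)

text \<open>The index type allows families such as \<open>P(1/s) exp(-1/s)\<close>, which are closed under
  differentiation although they do not form a sequence of successive derivatives.\<close>

lemma Ck_on_compose_family:
  fixes G :: "'i \<Rightarrow> real \<Rightarrow> real" and f :: "'a::euclidean_space \<Rightarrow> real"
  assumes G: "\<And>i s. (G i has_real_derivative G (d i) s) (at s)"
    and S: "open S" and f: "Ck_on k S f"
  shows "Ck_on k S (\<lambda>x. G i (f x))"
  using f
proof (induction k arbitrary: i)
  case 0
  have "continuous_on UNIV (G i)"
    using G by (meson DERIV_isCont continuous_at_imp_continuous_on)
  then show ?case using 0 by (auto intro: continuous_on_compose2)
next
  case (Suc k)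
  show ?case
  proof (rule Ck_on_SucI[OF S])
    show "((\<lambda>x. G i (f x)) has_derivative (\<lambda>v. frechet_derivative f (at x) v * G (d i) (f x))) (at x)"
      if "x \<in> S" for x
      using has_derivative_compose[OF Ck_on_Suc_derivative[OF Suc.prems that]
          G[THEN has_field_derivative_imp_has_derivative], of i]
      by (simp add: mult.commute[of "G (d i) (f x)"])
    show "Ck_on k S (\<lambda>x. frechet_derivative f (at x) v * G (d i) (f x))" for v
      using Suc.prems by (intro Ck_on_mult S Suc.IH) (auto intro: Ck_on_Suc_imp)
  qed
qed

section \<open>Smooth functions that are flat at the origin, and bump functions\<close>

definition flat :: "real poly \<Rightarrow> real \<Rightarrow> real" where
  "flat P s = (if s > 0 then poly P (1 / s) * exp (- (1 / s)) else 0)"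

lemma poly_div_exp_tendsto_0:
  "((\<lambda>y::real. poly P y * y ^ n / exp y) \<longlongrightarrow> 0) at_top"
proof (induction P arbitrary: n)
  case (pCons a P)
  have "((\<lambda>y::real. a * (y ^ n / exp y) + poly P y * y ^ Suc n / exp y) \<longlongrightarrow> a * 0 + 0) at_top"
    by (intro tendsto_intros pCons.IH tendsto_power_div_exp_0)
  then show ?case by (simp add: field_simps)
qed simp

text \<open>With \<open>y = 1 / s\<close> the derivative of \<open>P(y) exp(-y)\<close> in
  \<open>s\<close> is \<open>y^2 (P - P')(y) exp(-y)\<close>, again of the form \<open>flat\<close>.
  At 0 the difference quotient from the right is \<open>y P(y) exp(-y)\<close>, which tends to
  0.\<close>

lemma flat_has_derivative:
  "(flat P has_real_derivative flat ([:0, 0, 1:] * (P - pderiv P)) s) (at s)"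
proof -
  consider "s > 0" | "s < 0" | "s = 0" by linarith
  then show ?thesis
  proof cases
    case 1
    have "((\<lambda>s. poly P (1 / s) * exp (- (1 / s))) has_real_derivative
        flat ([:0, 0, 1:] * (P - pderiv P)) s) (at s)"
      using 1 by (auto intro!: derivative_eq_intros DERIV_chain2[OF poly_DERIV]
          simp: flat_def field_simps power2_eq_square)
    then show ?thesis
      by (rule has_field_derivative_transform_within_open[where S="{0<..}"])
        (use 1 in \<open>auto simp: flat_def\<close>)
  next
    case 2
    have "((\<lambda>s. 0) has_real_derivative 0) (at s)" by simp
    then have "(flat P has_real_derivative 0) (at s)"
      by (rule has_field_derivative_transform_within_open[where S="{..<0}"])
        (use 2 in \<open>auto simp: flat_def\<close>)
    then show ?thesis using 2 by (simp add: flat_def)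
  next
    case 3
    have "((\<lambda>h. flat P h / h) \<longlongrightarrow> 0) (at_right 0)"
    proof -
      have "((\<lambda>h::real. poly P (inverse h) * inverse h ^ 1 / exp (inverse h)) \<longlongrightarrow> 0) (at_right 0)"
        by (rule filterlim_compose[OF poly_div_exp_tendsto_0 filterlim_inverse_at_top_right])
      then show ?thesis
      proof (rule Lim_transform_eventually)
        show "\<forall>\<^sub>F h in at_right 0. poly P (inverse h) * inverse h ^ 1 / exp (inverse h) = flat P h / h"
          by (auto simp: eventually_at_filter flat_def exp_minus field_simps)
      qed
    qed
    moreover have "((\<lambda>h. flat P h / h) \<longlongrightarrow> 0) (at_left 0)"
      by (rule tendsto_eventually) (auto simp: eventually_at_filter flat_def)
    ultimately have "((\<lambda>h. flat P h / h) \<longlongrightarrow> 0) (at 0)"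
      by (simp add: filterlim_split_at)
    then have "(flat P has_real_derivative 0) (at 0)"
      by (simp add: DERIV_def) (simp add: flat_def)
    then show ?thesis using 3 by (simp add: flat_def)
  qed
qed

definition bump_kernel :: "real \<Rightarrow> 'a::euclidean_space \<Rightarrow> real" where
  "bump_kernel \<delta> x = flat 1 (\<delta>\<^sup>2 - x \<bullet> x)"

lemma smooth_on_bump_kernel: "smooth_on UNIV (bump_kernel \<delta>)"
  unfolding smooth_on_def bump_kernel_def
  by (intro allI Ck_on_compose_family[where G=flat and d="\<lambda>P. [:0, 0, 1:] * (P - pderiv P)"]
      flat_has_derivative Ck_on_diff Ck_on_inner_self) auto

lemma bump_kernel_nonneg: "bump_kernel \<delta> x \<ge> 0"
  by (simp add: bump_kernel_def flat_def)

lemma bump_kernel_pos_iff: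
  assumes "\<delta> > 0"
  shows "bump_kernel \<delta> x > 0 \<longleftrightarrow> norm x < \<delta>"
proof -
  have "x \<bullet> x < \<delta>\<^sup>2 \<longleftrightarrow> norm x < \<delta>"
    unfolding power2_norm_eq_inner[symmetric]
    using assms by (auto intro: power_strict_mono power_less_imp_less_base)
  then show ?thesis by (simp add: bump_kernel_def flat_def)
qed

section \<open>Gradients\<close>

lemma GDERIV_grad:
  assumes "f differentiable at x"
  shows "GDERIV f x :> grad f x"
proof -
  let ?D = "frechet_derivative f (at x)"
  have D: "(f has_derivative ?D) (at x)" using assms frechet_derivative_works by blast
  then interpret bounded_linear ?D by (rule has_derivative_bounded_linear)
  have "?D h = h \<bullet> grad f x" for h
  proof -
    have "?D h = ?D (\<Sum>b\<in>Basis. (h \<bullet> b) *\<^sub>R b)" by (simp add: euclidean_representation)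
    also have "\<dots> = (\<Sum>b\<in>Basis. (h \<bullet> b) * ?D b)" by (simp add: sum scaleR)
    also have "\<dots> = h \<bullet> grad f x"
      unfolding grad_def by (simp add: inner_sum_right mult.commute)
    finally show ?thesis .
  qed
  then have "?D = (\<lambda>h. h \<bullet> grad f x)" by auto
  then show ?thesis using D by (simp add: gderiv_def)
qed

lemma GDERIV_frechet:
  assumes "GDERIV f x :> D"
  shows "frechet_derivative f (at x) v = v \<bullet> D"
  using frechet_derivative_at[OF assms[unfolded gderiv_def]] by metis

lemma GDERIV_grad_eq:
  assumes "GDERIV f x :> D"
  shows "grad f x = D"
  unfolding grad_def GDERIV_frechet[OF assms]
  using euclidean_representation[of D] by (simp add: inner_commute[of D])

lemma GDERIV_inner_self: "GDERIV (\<lambda>x::'a::euclidean_space. x \<bullet> x) x :> 2 *\<^sub>R x"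
proof -
  have "((\<lambda>x::'a. x \<bullet> x) has_derivative (\<lambda>h. x \<bullet> h + h \<bullet> x)) (at x)"
    by (intro has_derivative_inner has_derivative_ident)
  then show ?thesis by (simp add: gderiv_def inner_commute)
qed

lemma GDERIV_inner_left: "GDERIV (\<lambda>x::'a::euclidean_space. x \<bullet> e) x :> e"
  unfolding gderiv_def by (intro has_derivative_inner_left has_derivative_ident)

lemma Ck_on_1_I:
  assumes "open S" "\<And>x. x \<in> S \<Longrightarrow> GDERIV f x :> g x" "continuous_on S g"
  shows "Ck_on 1 S f"
proof -
  have "Ck_on (Suc 0) S f"
    by (rule Ck_on_SucI[OF assms(1) assms(2)[unfolded gderiv_def]])
      (auto intro!: continuous_intros assms(3))
  then show ?thesis by simp
qed

lemma Ck_on_1_GDERIV: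
  assumes "Ck_on 1 S f" "x \<in> S"
  shows "GDERIV f x :> grad f x"
  using assms by (auto intro: GDERIV_grad)

lemma Ck_on_1_continuous_grad:
  assumes "Ck_on 1 S f"
  shows "continuous_on S (grad f)"
proof -
  have "continuous_on S (\<lambda>x. frechet_derivative f (at x) b)" for b
    using assms by simp
  then show ?thesis unfolding grad_def by (intro continuous_intros)
qed

lemma GDERIV_has_real_derivative_line:
  assumes "GDERIV f (x + t *\<^sub>R b) :> D"
  shows "((\<lambda>t. f (x + t *\<^sub>R b)) has_real_derivative (b \<bullet> D)) (at t)"
proof -
  have "((\<lambda>t. x + t *\<^sub>R b) has_derivative (\<lambda>h. h *\<^sub>R b)) (at t)"
    by (auto intro!: derivative_eq_intros)
  from has_derivative_compose[OF this assms[unfolded gderiv_def]]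
  show ?thesis by (simp add: has_field_derivative_def mult_commute_abs)
qed

text \<open>The support is described by some compact \<open>S\<close> instead of a closure, so that
  one set can serve a function, its gradient and its products. Unlike test functions, these include
  \<open>|\<phi>|^p\<close> and powers of \<open>u\<close> times a cutoff.\<close>

definition C1_compact :: "'a::euclidean_space set \<Rightarrow> ('a \<Rightarrow> real) \<Rightarrow> bool" where
  "C1_compact \<Omega> f \<longleftrightarrow> Ck_on 1 UNIV f \<and> (\<exists>S. compact S \<and> S \<subseteq> \<Omega> \<and> (\<forall>x. x \<notin> S \<longrightarrow> f x = 0))"

lemma C1_compact_GDERIV: "C1_compact \<Omega> f \<Longrightarrow> GDERIV f x :> grad f x"
  unfolding C1_compact_def using Ck_on_1_GDERIV by blast

lemma C1_compact_continuous:
  assumes "C1_compact \<Omega> f"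
  shows "continuous_on UNIV f" "continuous_on UNIV (grad f)"
  using assms unfolding C1_compact_def
  by (auto intro: Ck_on_imp_continuous_on Ck_on_1_continuous_grad simp del: Ck_on.simps)

lemma C1_compact_borel [measurable]:
  assumes "C1_compact \<Omega> f"
  shows "f \<in> borel_measurable borel" "grad f \<in> borel_measurable borel"
  using C1_compact_continuous[OF assms] by (auto intro: borel_measurable_continuous_onI)

lemma grad_eq_0_outside:
  assumes "closed S" "\<And>x. x \<notin> S \<Longrightarrow> f x = 0" "x \<notin> S"
  shows "grad f x = 0"
proof -
  have "((\<lambda>x. 0) has_derivative (\<lambda>h. h \<bullet> 0)) (at x)" by simp
  then have "(f has_derivative (\<lambda>h. h \<bullet> 0)) (at x)"
    by (rule has_derivative_transform_within_open[where s="- S"]) (use assms in auto)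
  then show ?thesis by (intro GDERIV_grad_eq) (simp add: gderiv_def)
qed

lemma C1_compact_support:
  assumes "C1_compact \<Omega> f"
  obtains S where "compact S" "S \<subseteq> \<Omega>" "\<And>x. x \<notin> S \<Longrightarrow> f x = 0" "\<And>x. x \<notin> S \<Longrightarrow> grad f x = 0"
  using assms unfolding C1_compact_def by (metis compact_imp_closed grad_eq_0_outside)

lemma C1_compact_mono: "C1_compact \<Omega> f \<Longrightarrow> \<Omega> \<subseteq> \<Omega>' \<Longrightarrow> C1_compact \<Omega>' f"
  unfolding C1_compact_def by blast

lemma test_function_imp_C1_compact:
  assumes "test_function \<Omega> \<phi>"
  shows "C1_compact \<Omega> \<phi>"
  using assms unfolding test_function_def smooth_on_def C1_compact_def
  by (metis (mono_tags, lifting) closure_subset mem_Collect_eq subsetD)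

lemma test_functionI:
  assumes "smooth_on UNIV \<phi>" "compact S" "S \<subseteq> \<Omega>" "\<And>x. x \<notin> S \<Longrightarrow> \<phi> x = 0"
  shows "test_function \<Omega> \<phi>"
proof -
  have "closure {x. \<phi> x \<noteq> 0} \<subseteq> S"
    using assms by (intro closure_minimal) (auto intro: compact_imp_closed)
  then show ?thesis unfolding test_function_def
    using assms(1-3) by (metis closed_closure compact_Int_closed inf.absorb_iff2 order_trans)
qed

lemma C1_compactI:
  assumes "compact S" "S \<subseteq> \<Omega>" "\<And>x. x \<notin> S \<Longrightarrow> f x = 0"
    and "\<And>x. GDERIV f x :> g x" "continuous_on UNIV g"
  shows "C1_compact \<Omega> f"
  unfolding C1_compact_def using assms Ck_on_1_I[of UNIV f g] by blast

text \<open>Outside \<Omega> the factor \<open>f\<close> may be arbitrary. The product is glued from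
  \<Omega>, where the product rule applies, and the complement of the support, where it is 0; these
  two open sets cover the space.\<close>

lemma C1_compact_mult_on:
  assumes \<eta>: "C1_compact \<Omega> \<eta>" and \<Omega>: "open \<Omega>" and f: "Ck_on 1 \<Omega> f"
  shows "C1_compact \<Omega> (\<lambda>x. \<eta> x * f x)"
    and "\<And>x. x \<in> \<Omega> \<Longrightarrow> grad (\<lambda>x. \<eta> x * f x) x = \<eta> x *\<^sub>R grad f x + f x *\<^sub>R grad \<eta> x"
proof -
  obtain S where S: "compact S" "S \<subseteq> \<Omega>" "\<And>x. x \<notin> S \<Longrightarrow> \<eta> x = 0" "\<And>x. x \<notin> S \<Longrightarrow> grad \<eta> x = 0"
    using C1_compact_support[OF \<eta>] by metis
  let ?g = "\<lambda>x. \<eta> x *\<^sub>R grad f x + f x *\<^sub>R grad \<eta> x"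
  have 1: "GDERIV (\<lambda>x. \<eta> x * f x) x :> ?g x" if "x \<in> \<Omega>" for x
    by (rule GDERIV_mult[OF C1_compact_GDERIV[OF \<eta>] Ck_on_1_GDERIV[OF f that]])
  then show "\<And>x. x \<in> \<Omega> \<Longrightarrow> grad (\<lambda>x. \<eta> x * f x) x = ?g x"
    by (rule GDERIV_grad_eq)
  have 2: "GDERIV (\<lambda>x. \<eta> x * f x) x :> ?g x" if "x \<notin> S" for x
  proof -
    have "((\<lambda>x. 0) has_derivative (\<lambda>h. h \<bullet> 0)) (at x)" by simp
    then have "((\<lambda>x. \<eta> x * f x) has_derivative (\<lambda>h. h \<bullet> 0)) (at x)"
      by (rule has_derivative_transform_within_open[where s="- S"])
        (use S that in \<open>auto intro: compact_imp_closed\<close>)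
    then show ?thesis using S that by (simp add: gderiv_def)
  qed
  have c1: "continuous_on \<Omega> ?g"
    using C1_compact_continuous[OF \<eta>] Ck_on_1_continuous_grad[OF f] Ck_on_imp_continuous_on[OF f]
    by (intro continuous_intros) (auto intro: continuous_on_subset)
  have c2: "continuous_on (- S) ?g"
    by (rule continuous_on_eq[of _ "\<lambda>x. 0"]) (use S in auto)
  have U: "\<Omega> \<union> - S = UNIV" using S(2) by auto
  have c: "continuous_on UNIV ?g"
    using continuous_on_open_Un[OF \<Omega> _ c1 c2] S(1) unfolding U by (simp add: compact_imp_closed open_Compl)
  show "C1_compact \<Omega> (\<lambda>x. \<eta> x * f x)"
  proof (rule C1_compactI[OF S(1,2) _ _ c])
    show "GDERIV (\<lambda>x. \<eta> x * f x) x :> ?g x" for x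
      using 1[of x] 2[of x] S(2) by blast
  qed (simp add: S(3))
qed

section \<open>Integrals of continuous functions with compact support\<close>

lemma integrable_lebesgue_compact_support:
  fixes f :: "'a::euclidean_space \<Rightarrow> 'b::euclidean_space"
  assumes "continuous_on UNIV f" "compact S" "\<And>x. x \<notin> S \<Longrightarrow> f x = 0"
  shows "integrable lebesgue f"
proof -
  have "integrable lborel (\<lambda>x. indicator S x *\<^sub>R f x)"
    by (rule borel_integrable_compact) (use assms in \<open>auto intro: continuous_on_subset\<close>)
  also have "(\<lambda>x. indicator S x *\<^sub>R f x) = f" using assms(3) by (auto simp: indicator_def)
  finally show ?thesis
    using assms(1) by (subst integrable_completion) (auto intro: borel_measurable_continuous_onI)
qed

lemma bounded_compact_support:
  fixes f :: "'a::euclidean_space \<Rightarrow> 'b::euclidean_space"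
  assumes "continuous_on UNIV f" "compact S" "\<And>x. x \<notin> S \<Longrightarrow> f x = 0"
  obtains K where "K > 0" "\<And>x. norm (f x) \<le> K"
proof -
  have "compact (f ` S)" using assms by (intro compact_continuous_image) (auto intro: continuous_on_subset)
  then obtain K where "K > 0" "\<forall>y\<in>f ` S. norm y \<le> K" by (meson bounded_pos compact_imp_bounded)
  then have "norm (f x) \<le> K" for x using assms(3) by (cases "x \<in> S") auto
  then show ?thesis using \<open>K > 0\<close> that by blast
qed

lemma integral_lebesgue_translate:
  fixes f :: "'a::euclidean_space \<Rightarrow> 'b::euclidean_space"
  assumes [measurable]: "f \<in> borel_measurable borel"
  shows "integral\<^sup>L lebesgue (\<lambda>x. f (x + a)) = integral\<^sup>L lebesgue f"
proof -
  have "integral\<^sup>L lebesgue f = integral\<^sup>L (distr lborel borel ((+) a)) f"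
    by (simp add: integral_completion lborel_distr_plus)
  also have "\<dots> = integral\<^sup>L lborel (\<lambda>x. f (a + x))" by (rule integral_distr) auto
  also have "\<dots> = integral\<^sup>L lebesgue (\<lambda>x. f (x + a))" by (simp add: integral_completion add.commute)
  finally show ?thesis by simp
qed

text \<open>Only Lipschitz continuity in the direction \<open>b\<close> and differentiability almost everywhere
  are assumed, because the comparison field below is not \<open>C\<^sup>1\<close> up to the boundary.\<close>

lemma integral_directional_derivative_eq_0:
  fixes g :: "'a::euclidean_space \<Rightarrow> real"
  assumes cont: "continuous_on UNIV g" and S: "compact S" "\<And>x. x \<notin> S \<Longrightarrow> g x = 0"
    and lip: "\<And>x t. \<bar>g (x + t *\<^sub>R b) - g x\<bar> \<le> K * \<bar>t\<bar>"
    and [measurable]: "g' \<in> borel_measurable lebesgue"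
    and deriv: "AE x in lebesgue. ((\<lambda>t. g (x + t *\<^sub>R b)) has_real_derivative g' x) (at 0)"
  shows "integral\<^sup>L lebesgue g' = 0" "integrable lebesgue g'"
proof -
  let ?h = "\<lambda>n. inverse (real (Suc n))"
  let ?d = "\<lambda>n x. (g (x + ?h n *\<^sub>R b) - g x) / ?h n"
  have gb[measurable]: "g \<in> borel_measurable borel" using cont by (rule borel_measurable_continuous_onI)
  have gl[measurable]: "g \<in> borel_measurable lebesgue" by (rule measurable_completion) simp
  have tb[measurable]: "(\<lambda>x. g (x + a)) \<in> borel_measurable lebesgue" for a
    by (rule measurable_completion) simp
  obtain R where R: "R > 0" "\<And>x. x \<in> S \<Longrightarrow> norm x \<le> R" using S(1) by (meson bounded_pos compact_imp_bounded)
  have K: "K \<ge> 0" using lip[of undefined 1] by (auto intro: order_trans[OF abs_ge_zero])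
  \<comment> \<open>All steps \<open>?h n\<close> are at most 1, so outside this ball both
    \<open>x\<close> and \<open>x + ?h n *\<^sub>R b\<close> miss \<open>S\<close> and every
    difference quotient vanishes.\<close>
  let ?B = "cball 0 (R + norm b) :: 'a set"
  have "integrable lborel (indicator ?B :: 'a \<Rightarrow> real)"
    by (intro integrable_real_indicator) (auto simp: emeasure_lborel_cball_finite[unfolded infinity_ennreal_def])
  then have "integrable lebesgue (indicator ?B :: 'a \<Rightarrow> real)"
    by (subst integrable_completion) auto
  then have w: "integrable lebesgue (\<lambda>x. K * indicator ?B x)" by simp
  have bd: "norm (?d n x) \<le> K * indicator ?B x" for n x
  proof (cases "x \<in> ?B")
    case True
    have "\<bar>g (x + ?h n *\<^sub>R b) - g x\<bar> \<le> K * ?h n" using lip[of x "?h n"] by simp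
    then have "\<bar>g (x + ?h n *\<^sub>R b) - g x\<bar> / ?h n \<le> K"
      by (subst pos_divide_le_eq) auto
    then show ?thesis using True
      by (simp only: real_norm_def abs_divide abs_of_pos[of "?h n"] indicator_simps mult_1_right) simp
  next
    case False
    have "norm (x + ?h n *\<^sub>R b) > R"
    proof -
      have "norm x \<le> norm (x + ?h n *\<^sub>R b) + norm (?h n *\<^sub>R b)"
        using norm_triangle_ineq4[of "x + ?h n *\<^sub>R b" "?h n *\<^sub>R b"] by simp
      moreover have "norm (?h n *\<^sub>R b) \<le> norm b"
        by (simp add: mult_left_le_one_le inverse_le_1_iff)
      ultimately show ?thesis using False by simp
    qed
    moreover have "norm x > R" using False norm_ge_zero[of b] unfolding mem_cball_0 by linarith
    ultimately have "g (x + ?h n *\<^sub>R b) = 0" "g x = 0" using R S(2) by (meson not_le)+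
    then show ?thesis using False by simp
  qed
  have lim: "AE x in lebesgue. (\<lambda>n. ?d n x) \<longlonglongrightarrow> g' x"
    using deriv
  proof eventually_elim
    case (elim x)
    then have "((\<lambda>t. (g (x + t *\<^sub>R b) - g x) / t) \<longlongrightarrow> g' x) (at 0)"
      by (simp add: DERIV_def)
    moreover have "filterlim ?h (at 0) sequentially"
      using LIMSEQ_inverse_real_of_nat by (rule filterlim_atI) (auto simp del: of_nat_Suc)
    ultimately show ?case by (rule filterlim_compose)
  qed
  have "(\<lambda>n. integral\<^sup>L lebesgue (?d n)) \<longlonglongrightarrow> integral\<^sup>L lebesgue g'"
    by (rule integral_dominated_convergence[OF _ _ w lim]) (use bd in auto)
  \<comment> \<open>The integral of a translate equals the integral of \<open>g\<close>, so each
    difference quotient has integral 0 before the limit.\<close>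
  moreover have "integral\<^sup>L lebesgue (?d n) = 0" for n
  proof -
    have i1: "integrable lebesgue g" by (rule integrable_lebesgue_compact_support[OF cont S])
    have "(\<lambda>x. x + a) ` S = {x + y |x y. x \<in> S \<and> y \<in> {a}}" for a by auto
    then have cS: "compact ((\<lambda>x. x + a) ` S)" for a using compact_sums[OF S(1) compact_sing] by metis
    have i2: "integrable lebesgue (\<lambda>x. g (x + a))" for a
      by (rule integrable_lebesgue_compact_support[OF _ cS[of "- a"]])
        (use S(2) in \<open>auto intro!: continuous_on_compose2[OF cont] continuous_intros simp: image_iff\<close>,
          metis add_diff_cancel)
    show ?thesis using i1 i2 integral_lebesgue_translate[OF gb, of "?h n *\<^sub>R b"]
      by (simp del: of_nat_Suc)
  qed
  ultimately show "integral\<^sup>L lebesgue g' = 0" by (simp add: LIMSEQ_const_iff)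
  show "integrable lebesgue g'"
    by (rule integrable_dominated_convergence[OF _ _ w lim]) (use bd in auto)
qed

lemma C1_compact_lipschitz:
  assumes "C1_compact \<Omega> f"
  obtains K where "K > 0" "\<And>x y. \<bar>f y - f x\<bar> \<le> K * norm (y - x)"
proof -
  obtain S where S: "compact S" "\<And>x. x \<notin> S \<Longrightarrow> grad f x = 0" using C1_compact_support[OF assms] by metis
  obtain K where K: "K > 0" "\<And>x. norm (grad f x) \<le> K"
    using bounded_compact_support[OF C1_compact_continuous(2)[OF assms] S] by metis
  have "norm (f y - f x) \<le> K * norm (y - x)" for x y
  proof (rule differentiable_bound[where S=UNIV and f'="\<lambda>x h. h \<bullet> grad f x"])
    show "(f has_derivative (\<lambda>h. h \<bullet> grad f x)) (at x within UNIV)" for x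
      using C1_compact_GDERIV[OF assms] by (simp add: gderiv_def)
    show "onorm (\<lambda>h. h \<bullet> grad f x) \<le> K" for x
    proof (rule onorm_le)
      show "norm (h \<bullet> grad f x) \<le> K * norm h" for h
        using Cauchy_Schwarz_ineq2[of h "grad f x"] K(2)[of x] K(1)
          mult_left_mono[OF K(2)[of x] norm_ge_zero[of h]] by (simp add: mult.commute)
    qed
  qed auto
  then show ?thesis using that[of K] K by simp
qed

lemma integral_grad_eq_0:
  assumes "C1_compact \<Omega> f"
  shows "(\<integral>x. grad f x \<bullet> b \<partial>lebesgue) = 0"
proof -
  obtain S where S: "compact S" "\<And>x. x \<notin> S \<Longrightarrow> f x = 0" using C1_compact_support[OF assms] by metis
  obtain K where K: "K > 0" "\<And>x y. \<bar>f y - f x\<bar> \<le> K * norm (y - x)"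
    using C1_compact_lipschitz[OF assms] by metis
  show ?thesis
  proof (rule integral_directional_derivative_eq_0(1)[OF C1_compact_continuous(1)[OF assms] S, of b "K * norm b"])
    show "\<bar>f (x + t *\<^sub>R b) - f x\<bar> \<le> K * norm b * \<bar>t\<bar>" for x t
      using K(2)[of "x + t *\<^sub>R b" x] by (simp add: ac_simps)
    show "(\<lambda>x. grad f x \<bullet> b) \<in> borel_measurable lebesgue"
      using C1_compact_borel(2)[OF assms] by (intro measurable_completion) simp
    have "((\<lambda>t. f (x + t *\<^sub>R b)) has_real_derivative (grad f x \<bullet> b)) (at 0)" for x
      using GDERIV_has_real_derivative_line[of f x 0 b "grad f x"] C1_compact_GDERIV[OF assms]
      by (simp add: inner_commute)
    then show "AE x in lebesgue. ((\<lambda>t. f (x + t *\<^sub>R b)) has_real_derivative (grad f x \<bullet> b)) (at 0)" by simp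
  qed
qed

section \<open>Mollification\<close>

text \<open>Only the kernel depends on \<open>x\<close>, so only the kernel is differentiated and
  continuity of \<open>f\<close> suffices; the compact box makes differentiation under the integral
  sign applicable.\<close>

lemma has_derivative_convolution:
  fixes f K :: "'a::euclidean_space \<Rightarrow> real"
  assumes f: "continuous_on UNIV f" and K: "\<And>x. GDERIV K x :> g x" and g: "continuous_on UNIV g"
  shows "((\<lambda>x. integral (cbox a c) (\<lambda>y. f y * K (x - y))) has_derivative
          (\<lambda>v. integral (cbox a c) (\<lambda>y. f y * (v \<bullet> g (x - y))))) (at x)"
proof -
  define F where "F x y = f y *\<^sub>R blinfun_inner_left (g (x - y))" for x y
  have cK: "continuous_on UNIV K"
    using K unfolding gderiv_def
    by (meson continuous_at_imp_continuous_on has_derivative_continuous)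
  have "((\<lambda>x. integral (cbox a c) (\<lambda>y. f y * K (x - y))) has_derivative
          blinfun_apply (integral (cbox a c) (F x))) (at x within UNIV)"
  proof (rule leibniz_rule)
    show "((\<lambda>x. f t * K (x - t)) has_derivative blinfun_apply (F x t)) (at x within UNIV)" for x t
    proof -
      have "((\<lambda>x. x - t) has_derivative (\<lambda>h. h)) (at x)" by (auto intro!: derivative_eq_intros)
      from has_derivative_compose[OF this K[unfolded gderiv_def]]
      have "((\<lambda>x. f t * K (x - t)) has_derivative (\<lambda>h. f t * (h \<bullet> g (x - t)))) (at x)"
        by (rule has_derivative_mult_right)
      then show ?thesis by (simp add: F_def scaleR_blinfun.rep_eq inner_commute)
    qed
    show "(\<lambda>y. f y * K (x - y)) integrable_on cbox a c" for x
      by (intro integrable_continuous continuous_intros continuous_on_compose2[OF cK]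
          continuous_on_compose2[OF f]) auto
    show "continuous_on (UNIV \<times> cbox a c) (\<lambda>(x, t). F x t)"
      unfolding F_def split_beta
      by (intro continuous_intros continuous_on_compose2[OF g] continuous_on_compose2[OF f]) auto
  qed auto
  moreover have "F x integrable_on cbox a c" for x
    unfolding F_def
    by (intro integrable_continuous continuous_intros continuous_on_compose2[OF g]
        continuous_on_compose2[OF f]) auto
  then have "blinfun_apply (integral (cbox a c) (F x)) =
      (\<lambda>v. integral (cbox a c) (\<lambda>y. f y * (v \<bullet> g (x - y))))"
    by (intro ext, subst blinfun_apply_integral) (auto simp: F_def scaleR_blinfun.rep_eq inner_commute)
  ultimately show ?thesis by simp
qed

text \<open>The directional derivative of a convolution is the convolution with
  \<open>v \<bullet> grad K\<close>, again a smooth kernel, so the induction runs over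
  \<open>k\<close> with \<open>K\<close> arbitrary.\<close>

lemma smooth_on_convolution:
  fixes f K :: "'a::euclidean_space \<Rightarrow> real"
  assumes f: "continuous_on UNIV f" and K: "smooth_on UNIV K"
  shows "smooth_on UNIV (\<lambda>x. integral (cbox a c) (\<lambda>y. f y * K (x - y)))"
proof -
  have "Ck_on k UNIV (\<lambda>x. integral (cbox a c) (\<lambda>y. f y * K (x - y)))" for k
    using K
  proof (induction k arbitrary: K)
    case (0 K)
    then have 1: "Ck_on 1 UNIV K" by (simp add: smooth_on_def del: Ck_on.simps)
    then have "(\<lambda>x. integral (cbox a c) (\<lambda>y. f y * K (x - y))) differentiable at x" for x
      unfolding differentiable_def
      using has_derivative_convolution[OF f Ck_on_1_GDERIV[OF 1 UNIV_I] Ck_on_1_continuous_grad[OF 1]]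
      by blast
    then show ?case
      by (auto intro!: continuous_at_imp_continuous_on differentiable_imp_continuous_within)
  next
    case (Suc k K)
    then have 1: "Ck_on 1 UNIV K" by (simp add: smooth_on_def del: Ck_on.simps)
    show ?case
    proof (rule Ck_on_SucI)
      show "((\<lambda>x. integral (cbox a c) (\<lambda>y. f y * K (x - y))) has_derivative
          (\<lambda>v. integral (cbox a c) (\<lambda>y. f y * (v \<bullet> grad K (x - y))))) (at x)" for x
        by (rule has_derivative_convolution[OF f Ck_on_1_GDERIV[OF 1 UNIV_I]
            Ck_on_1_continuous_grad[OF 1]])
      fix v
      have "Ck_on j UNIV (\<lambda>x. frechet_derivative K (at x) v)" for j
        using Suc.prems unfolding smooth_on_def by (metis Ck_on.simps(2))
      then have "smooth_on UNIV (\<lambda>x. v \<bullet> grad K x)"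
        unfolding smooth_on_def GDERIV_frechet[OF Ck_on_1_GDERIV[OF 1 UNIV_I]] by blast
      then show "Ck_on k UNIV (\<lambda>x. integral (cbox a c) (\<lambda>y. f y * (v \<bullet> grad K (x - y))))"
        by (rule Suc.IH)
    qed auto
  qed
  then show ?thesis by (simp add: smooth_on_def)
qed

text \<open>Dividing by the mass of the kernel avoids normalising \<open>bump_kernel\<close>; of the
  mass only positivity and translation invariance enter.\<close>

definition mollify :: "real \<Rightarrow> ('a::euclidean_space \<Rightarrow> real) \<Rightarrow> 'a \<Rightarrow> real" where
  "mollify \<delta> f x = (\<integral>y. f y * bump_kernel \<delta> (x - y) \<partial>lebesgue) / (\<integral>y. bump_kernel \<delta> (y::'a) \<partial>lebesgue)"

lemma bump_kernel_Ck: "Ck_on k UNIV (bump_kernel \<delta>)"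
  by (rule smooth_on_bump_kernel[unfolded smooth_on_def, rule_format])

lemma continuous_on_bump_kernel [continuous_intros]:
  assumes "continuous_on S f"
  shows "continuous_on S (\<lambda>x. bump_kernel \<delta> (f x))"
  by (rule continuous_on_compose2[OF Ck_on_imp_continuous_on[OF bump_kernel_Ck[of 0]] assms]) auto

lemma bump_kernel_eq_0: "\<delta> > 0 \<Longrightarrow> norm x \<ge> \<delta> \<Longrightarrow> bump_kernel \<delta> x = 0"
  using bump_kernel_pos_iff[of \<delta> x] bump_kernel_nonneg[of \<delta> x] by linarith

lemma integrable_bump_kernel:
  assumes "\<delta> > 0"
  shows "integrable lebesgue (\<lambda>y. bump_kernel \<delta> (x - y))"
  by (rule integrable_lebesgue_compact_support[of _ "cball x \<delta>"])
    (auto intro!: continuous_intros bump_kernel_eq_0 assms simp: dist_norm)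

lemma integral_bump_kernel_pos:
  assumes "\<delta> > 0"
  shows "(\<integral>y. bump_kernel \<delta> (y::'a::euclidean_space) \<partial>lebesgue) > 0"
proof -
  have i: "integrable lebesgue (bump_kernel \<delta> :: 'a \<Rightarrow> real)"
    by (rule integrable_lebesgue_compact_support[of _ "cball 0 \<delta>"])
      (auto intro!: continuous_intros bump_kernel_eq_0 assms)
  have "(\<integral>y. bump_kernel \<delta> (y::'a) \<partial>lebesgue) \<noteq> 0"
  proof
    assume "(\<integral>y. bump_kernel \<delta> (y::'a) \<partial>lebesgue) = 0"
    then have "AE y in lebesgue. bump_kernel \<delta> (y::'a) = 0"
      using integral_nonneg_eq_0_iff_AE[OF i] by (simp add: bump_kernel_nonneg)
    then have "AE y in lebesgue. y \<notin> (ball 0 \<delta> :: 'a set)"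
      by eventually_elim (metis bump_kernel_pos_iff assms less_irrefl mem_ball_0)
    then have "emeasure lebesgue (ball 0 \<delta> :: 'a set) = 0"
      by (subst (asm) AE_iff_null_sets[symmetric]) auto
    then show False using content_ball_pos[OF assms, of "0::'a"] by (simp add: measure_def)
  qed
  moreover have "(\<integral>y. bump_kernel \<delta> (y::'a) \<partial>lebesgue) \<ge> 0"
    by (rule Bochner_Integration.integral_nonneg) (rule bump_kernel_nonneg)
  ultimately show ?thesis by linarith
qed

lemma integral_bump_kernel_shift:
  fixes x :: "'a::euclidean_space"
  shows "(\<integral>y. bump_kernel \<delta> (x - y) \<partial>lebesgue) = (\<integral>y. bump_kernel \<delta> (y::'a) \<partial>lebesgue)"
proof -
  have "(\<integral>y. bump_kernel \<delta> (x - y) \<partial>lebesgue) = (\<integral>y. bump_kernel \<delta> (y + (- x)) \<partial>lebesgue)"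
    by (intro arg_cong[where f="integral\<^sup>L lebesgue"] ext)
      (simp add: bump_kernel_def inner_diff inner_commute algebra_simps)
  also have "\<dots> = (\<integral>y. bump_kernel \<delta> (y::'a) \<partial>lebesgue)"
    by (rule integral_lebesgue_translate)
      (auto intro!: borel_measurable_continuous_onI continuous_intros)
  finally show ?thesis .
qed

locale compactly_supported =
  fixes f :: "'a::euclidean_space \<Rightarrow> real" and S
  assumes cont: "continuous_on UNIV f" and S: "compact S" "\<And>x. x \<notin> S \<Longrightarrow> f x = 0"
begin

lemma integrable_mult_kernel:
  assumes "continuous_on UNIV k"
  shows "integrable lebesgue (\<lambda>y. f y * k y)"
  by (rule integrable_lebesgue_compact_support[OF _ S(1)])
    (auto intro!: continuous_intros cont assms simp: S(2))

text \<open>One box serves for all \<open>k\<close>, hence for all kernels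
  \<open>bump_kernel \<delta> (x - y)\<close> at once, so that the Lebesgue integral can be replaced
  by a box integral before differentiating in \<open>x\<close>.\<close>

lemma mollify_eq_integral:
  obtains a c where
    "\<And>k. continuous_on UNIV k \<Longrightarrow> (\<integral>y. f y * k y \<partial>lebesgue) = integral (cbox a c) (\<lambda>y. f y * k y)"
proof -
  obtain a c where ac: "S \<subseteq> cbox a c" using S(1) bounded_subset_cbox_symmetric compact_imp_bounded by metis
  have "(\<integral>y. f y * k y \<partial>lebesgue) = integral (cbox a c) (\<lambda>y. f y * k y)" if "continuous_on UNIV k" for k
  proof -
    have "((\<lambda>y. f y * k y) has_integral (\<integral>y. f y * k y \<partial>lebesgue)) UNIV"
      by (rule has_integral_integral_lebesgue[OF integrable_mult_kernel[OF that]])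
    moreover have "(\<lambda>y. f y * k y) = (\<lambda>y. if y \<in> cbox a c then f y * k y else 0)"
      using ac S(2) by (auto simp: fun_eq_iff)
    ultimately have "((\<lambda>y. f y * k y) has_integral (\<integral>y. f y * k y \<partial>lebesgue)) (cbox a c)"
      using has_integral_restrict_UNIV by metis
    then show ?thesis by (simp add: integral_unique)
  qed
  then show ?thesis using that by blast
qed

lemma smooth_on_mollify: "smooth_on UNIV (mollify \<delta> f)"
proof -
  obtain a c where ac:
    "\<And>k. continuous_on UNIV k \<Longrightarrow> (\<integral>y. f y * k y \<partial>lebesgue) = integral (cbox a c) (\<lambda>y. f y * k y)"
    using mollify_eq_integral by blast
  have "mollify \<delta> f = (\<lambda>x. inverse (\<integral>y. bump_kernel \<delta> (y::'a) \<partial>lebesgue) *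
      integral (cbox a c) (\<lambda>y. f y * bump_kernel \<delta> (x - y)))"
    unfolding mollify_def fun_eq_iff
    by (subst ac) (auto intro!: continuous_intros simp: field_simps)
  then show ?thesis
    using smooth_on_convolution[OF cont smooth_on_bump_kernel]
    by (auto simp: smooth_on_def intro!: Ck_on_cmult)
qed

lemma mollify_eq_0:
  assumes "\<delta> > 0" "\<And>y. y \<in> S \<Longrightarrow> dist y x \<ge> \<delta>"
  shows "mollify \<delta> f x = 0"
proof -
  have "f y * bump_kernel \<delta> (x - y) = 0" for y
    using S(2)[of y] assms(2)[of y] bump_kernel_eq_0[OF assms(1), of "x - y"]
    by (cases "y \<in> S") (auto simp: dist_norm norm_minus_commute)
  then have "(\<lambda>y. f y * bump_kernel \<delta> (x - y)) = (\<lambda>y. 0)" by auto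
  then show ?thesis by (simp add: mollify_def)
qed

lemma mollify_close:
  assumes "\<delta> > 0" "\<And>y. dist y x < \<delta> \<Longrightarrow> \<bar>f y - f x\<bar> \<le> e"
  shows "\<bar>mollify \<delta> f x - f x\<bar> \<le> e"
proof -
  let ?I = "\<integral>y. bump_kernel \<delta> (y::'a) \<partial>lebesgue"
  have I: "?I > 0" by (rule integral_bump_kernel_pos[OF assms(1)])
  have ik: "integrable lebesgue (\<lambda>y. c * bump_kernel \<delta> (x - y))" for c
    using integrable_bump_kernel[OF assms(1), of x] by simp
  have i1: "integrable lebesgue (\<lambda>y. f y * bump_kernel \<delta> (x - y))"
    by (intro integrable_mult_kernel continuous_intros)
  have "(mollify \<delta> f x - f x) * ?I = (\<integral>y. f y * bump_kernel \<delta> (x - y) \<partial>lebesgue) - (\<integral>y. f x * bump_kernel \<delta> (x - y) \<partial>lebesgue)"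
    using I by (simp add: mollify_def field_simps integral_bump_kernel_shift)
  also have "\<dots> = (\<integral>y. (f y - f x) * bump_kernel \<delta> (x - y) \<partial>lebesgue)"
    by (subst Bochner_Integration.integral_diff[OF i1 ik, symmetric]) (simp add: algebra_simps)
  also have "\<bar>\<dots>\<bar> \<le> (\<integral>y. e * bump_kernel \<delta> (x - y) \<partial>lebesgue)"
  proof (rule order_trans[OF integral_abs_bound integral_mono])
    show "integrable lebesgue (\<lambda>y. \<bar>(f y - f x) * bump_kernel \<delta> (x - y)\<bar>)"
      using Bochner_Integration.integrable_diff[OF i1 ik[of "f x"]]
      by (intro integrable_abs) (simp add: algebra_simps)
    show "\<bar>(f y - f x) * bump_kernel \<delta> (x - y)\<bar> \<le> e * bump_kernel \<delta> (x - y)" for y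
    proof (cases "dist y x < \<delta>")
      case True
      then show ?thesis using assms(2)[OF True] bump_kernel_nonneg[of \<delta> "x - y"]
        by (simp add: abs_mult mult_right_mono)
    next
      case False
      then show ?thesis using bump_kernel_eq_0[OF assms(1), of "x - y"]
        by (simp add: dist_norm norm_minus_commute)
    qed
  qed (rule ik)
  also have "\<dots> = e * ?I" by (simp add: integral_bump_kernel_shift)
  finally show ?thesis using I by (simp add: abs_mult)
qed

lemma mollify_uniform_limit:
  assumes "\<And>n. r n > 0" "r \<longlonglongrightarrow> 0" "e > 0"
  shows "\<forall>\<^sub>F n in sequentially. \<forall>x. \<bar>mollify (r n) f x - f x\<bar> \<le> e"
proof -
  have "uniformly_continuous_on UNIV f"
  proof -
    obtain T where T: "compact T" "(\<Union>x\<in>S. cball x 1) \<subseteq> T"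
      using compact_minkowski_sum_cball[OF S(1)] by auto
    have "uniformly_continuous_on T f"
      by (rule compact_uniformly_continuous[OF _ T(1)]) (auto intro: continuous_on_subset[OF cont])
    show ?thesis unfolding uniformly_continuous_on_def
    proof (intro allI impI)
      fix e :: real assume "e > 0"
      then obtain d where d: "d > 0" "\<forall>x\<in>T. \<forall>y\<in>T. dist y x < d \<longrightarrow> dist (f y) (f x) < e"
        using \<open>uniformly_continuous_on T f\<close>[unfolded uniformly_continuous_on_def, rule_format, of e]
        by auto
      \<comment> \<open>Two points at distance less than 1 either both lie in the enlarged set
        \<open>T\<close>, or both lie outside \<open>S\<close>, where \<open>f\<close> is 0.\<close>
      have "dist (f y) (f x) < e" if "dist y x < min d 1" for x y
      proof (cases "x \<in> S \<or> y \<in> S")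
        case True
        moreover have "w \<in> T" if "z \<in> S" "dist z w \<le> 1" for z w
          by (rule subsetD[OF T(2)]) (use that in auto)
        ultimately have "x \<in> T \<and> y \<in> T"
          using that by (metis dist_commute dist_self less_imp_le min_less_iff_conj zero_le_one)
        then show ?thesis using d that by auto
      next
        case False
        then show ?thesis using S(2) \<open>e > 0\<close> by simp
      qed
      then show "\<exists>d>0. \<forall>x\<in>UNIV. \<forall>y\<in>UNIV. dist y x < d \<longrightarrow> dist (f y) (f x) < e"
        using d(1) by (intro exI[of _ "min d 1"]) auto
    qed
  qed
  from this[unfolded uniformly_continuous_on_def, rule_format, OF assms(3)]
  obtain d where d: "d > 0" "\<forall>x y. dist y x < d \<longrightarrow> dist (f y) (f x) < e"
    by auto
  have "\<forall>\<^sub>F n in sequentially. r n < d" using order_tendstoD(2)[OF assms(2) d(1)] .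
  then show ?thesis
  proof eventually_elim
    case (elim n)
    show ?case
    proof (intro allI mollify_close assms(1))
      show "\<bar>f y - f x\<bar> \<le> e" if "dist y x < r n" for x y
        using d(2)[rule_format, of y x] elim that by (simp add: dist_real_def)
    qed
  qed
qed

end

text \<open>Integration by parts moves the derivative from the kernel to \<open>f\<close>.\<close>

lemma grad_mollify:
  assumes f: "C1_compact \<Omega> f" and "\<delta> > 0"
  shows "grad (mollify \<delta> f) x \<bullet> b = mollify \<delta> (\<lambda>y. grad f y \<bullet> b) x"
proof -
  obtain S where S: "compact S" "\<And>x. x \<notin> S \<Longrightarrow> f x = 0" "\<And>x. x \<notin> S \<Longrightarrow> grad f x = 0"
    using C1_compact_support[OF f] by metis
  interpret m: compactly_supported f S
    using C1_compact_continuous[OF f] S by unfold_locales auto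
  obtain a c where ac:
    "\<And>k. continuous_on UNIV k \<Longrightarrow> (\<integral>y. f y * k y \<partial>lebesgue) = integral (cbox a c) (\<lambda>y. f y * k y)"
    using m.mollify_eq_integral by blast
  let ?K = "bump_kernel \<delta> :: 'a \<Rightarrow> real"
  let ?I = "\<integral>y. ?K y \<partial>lebesgue"
  have K1: "Ck_on 1 UNIV ?K" by (rule bump_kernel_Ck)
  note gK = Ck_on_1_GDERIV[OF K1 UNIV_I] and cgK = Ck_on_1_continuous_grad[OF K1]
  have m: "mollify \<delta> f = (\<lambda>x. inverse ?I * integral (cbox a c) (\<lambda>y. f y * ?K (x - y)))"
    unfolding mollify_def fun_eq_iff
    by (subst ac) (auto intro!: continuous_intros simp: field_simps)
  have cb: "continuous_on UNIV (\<lambda>y. b \<bullet> grad ?K (x - y))" for b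
    by (intro continuous_intros continuous_on_compose2[OF cgK]) auto
  have "(mollify \<delta> f has_derivative
      (\<lambda>v. inverse ?I * integral (cbox a c) (\<lambda>y. f y * (v \<bullet> grad ?K (x - y))))) (at x)"
    unfolding m by (intro has_derivative_mult_right has_derivative_convolution m.cont gK cgK)
  moreover have "Ck_on 1 UNIV (mollify \<delta> f)"
    using m.smooth_on_mollify[of \<delta>] unfolding smooth_on_def by blast
  then have "(mollify \<delta> f has_derivative (\<lambda>h. h \<bullet> grad (mollify \<delta> f) x)) (at x)"
    unfolding gderiv_def[symmetric] by (rule Ck_on_1_GDERIV[OF _ UNIV_I])
  ultimately have "(\<lambda>h. h \<bullet> grad (mollify \<delta> f) x) =
      (\<lambda>v. inverse ?I * integral (cbox a c) (\<lambda>y. f y * (v \<bullet> grad ?K (x - y))))"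
    by (rule has_derivative_unique[rotated])
  then have "b \<bullet> grad (mollify \<delta> f) x = inverse ?I * integral (cbox a c) (\<lambda>y. f y * (b \<bullet> grad ?K (x - y)))"
    by (rule fun_cong)
  also have "\<dots> = inverse ?I * (\<integral>y. f y * (b \<bullet> grad ?K (x - y)) \<partial>lebesgue)"
    by (subst ac[OF cb]) simp
  also have "(\<integral>y. f y * (b \<bullet> grad ?K (x - y)) \<partial>lebesgue) = (\<integral>y. (grad f y \<bullet> b) * ?K (x - y) \<partial>lebesgue)"
  proof -
    have kx: "GDERIV (\<lambda>y. ?K (x - y)) y :> - grad ?K (x - y)" for y
    proof -
      have "((\<lambda>y. x - y) has_derivative (\<lambda>h. - h)) (at y)" by (auto intro!: derivative_eq_intros)
      from has_derivative_compose[OF this gK[unfolded gderiv_def]]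
      show ?thesis by (simp add: gderiv_def)
    qed
    have k1: "Ck_on 1 UNIV (\<lambda>y. ?K (x - y))"
      by (rule Ck_on_1_I[OF _ kx]) (auto intro!: continuous_intros continuous_on_compose2[OF cgK])
    have f': "C1_compact UNIV f" using f C1_compact_mono by blast
    have 0: "(\<integral>y. grad (\<lambda>y. f y * ?K (x - y)) y \<bullet> b \<partial>lebesgue) = 0"
      by (rule integral_grad_eq_0[OF C1_compact_mult_on(1)[OF f' _ k1]]) simp
    have "grad (\<lambda>y. f y * ?K (x - y)) y \<bullet> b = (grad f y \<bullet> b) * ?K (x - y) - f y * (b \<bullet> grad ?K (x - y))" for y
      using C1_compact_mult_on(2)[OF f' _ k1, of y] GDERIV_grad_eq[OF kx]
      by (simp add: inner_diff_left inner_diff_right inner_commute mult.commute)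
    with 0 have "(\<integral>y. (grad f y \<bullet> b) * ?K (x - y) - f y * (b \<bullet> grad ?K (x - y)) \<partial>lebesgue) = 0" by simp
    moreover have "integrable lebesgue (\<lambda>y. (grad f y \<bullet> b) * ?K (x - y))"
      by (rule integrable_lebesgue_compact_support[OF _ S(1)])
        (auto intro!: continuous_intros C1_compact_continuous[OF f] simp: S(3))
    ultimately show ?thesis
      using m.integrable_mult_kernel[OF cb] by simp
  qed
  finally show ?thesis
    unfolding mollify_def[of _ "\<lambda>y. grad f y \<bullet> b"] by (simp add: inner_commute field_simps)
qed

lemma compact_neighbourhood_support:
  fixes S :: "'a::euclidean_space set"
  assumes "compact S" "open \<Omega>" "S \<subseteq> \<Omega>"
  obtains T r where "compact T" "T \<subseteq> \<Omega>" "S \<subseteq> T" "r > 0" "\<And>x y. y \<in> S \<Longrightarrow> dist y x < r \<Longrightarrow> x \<in> T"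
proof -
  obtain r where r: "r > 0" "(\<Union>x\<in>S. cball x r) \<subseteq> \<Omega>"
    by (rule compact_subset_open_imp_cball_epsilon_subset[OF assms])
  show ?thesis
  proof (rule that[of "\<Union>x\<in>S. cball x r" r])
    show "compact (\<Union>x\<in>S. cball x r)" by (rule compact_minkowski_sum_cball[OF assms(1)])
  qed (use r in \<open>auto intro: less_imp_le\<close>)
qed

text \<open>Both approximations are mollifications with the same kernels, so one construction serves
  continuous functions and, together with the gradients, \<open>C\<^sup>1\<close> functions.\<close>

lemma mollify_test_functions:
  fixes S :: "'a::euclidean_space set"
  assumes \<Omega>: "open \<Omega>" and S: "compact S" "S \<subseteq> \<Omega>"
  obtains r T where "compact T" "T \<subseteq> \<Omega>" "S \<subseteq> T" "\<And>n::nat. r n > 0" "r \<longlonglongrightarrow> 0"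
    "\<And>f n. continuous_on UNIV f \<Longrightarrow> (\<And>x. x \<notin> S \<Longrightarrow> f x = 0) \<Longrightarrow> test_function \<Omega> (mollify (r n) f)"
    "\<And>f n x. continuous_on UNIV f \<Longrightarrow> (\<And>x. x \<notin> S \<Longrightarrow> f x = 0) \<Longrightarrow> x \<notin> T \<Longrightarrow> mollify (r n) f x = 0"
proof -
  obtain T d where T: "compact T" "T \<subseteq> \<Omega>" "S \<subseteq> T" and d: "d > 0" "\<And>x y. y \<in> S \<Longrightarrow> dist y x < d \<Longrightarrow> x \<in> T"
    using compact_neighbourhood_support[OF S(1) \<Omega> S(2)] by metis
  define r where "r n = d * inverse (real (Suc n))" for n
  have r: "r n > 0" "r n \<le> d" for n
    using d(1) by (auto simp: r_def field_simps)
  have "r \<longlonglongrightarrow> d * 0" unfolding r_def by (intro tendsto_intros LIMSEQ_inverse_real_of_nat)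
  then have r0: "r \<longlonglongrightarrow> 0" by simp
  have 0: "mollify (r n) f x = 0" if "continuous_on UNIV f" "\<And>x. x \<notin> S \<Longrightarrow> f x = 0" "x \<notin> T" for f n x
  proof -
    interpret m: compactly_supported f S using that S by unfold_locales auto
    show ?thesis using d(2) r[of n] that(3) by (intro m.mollify_eq_0) force+
  qed
  have 1: "test_function \<Omega> (mollify (r n) f)"
    if "continuous_on UNIV f" "\<And>x. x \<notin> S \<Longrightarrow> f x = 0" for f n
  proof -
    interpret m: compactly_supported f S using that S by unfold_locales auto
    show ?thesis using 0[OF that] by (intro test_functionI[OF m.smooth_on_mollify T(1,2)])
  qed
  show ?thesis
  proof (rule that[of T r])
    show "test_function \<Omega> (mollify (r n) f)"
      if "continuous_on UNIV f" "\<And>x. x \<notin> S \<Longrightarrow> f x = 0" for f n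
      using that by (rule 1)
    show "mollify (r n) f x = 0"
      if "continuous_on UNIV f" "\<And>x. x \<notin> S \<Longrightarrow> f x = 0" "x \<notin> T" for f n x
      using that by (rule 0)
  qed (fact T r r0)+
qed

lemma C0_compact_approx_test_functions:
  assumes \<Omega>: "open \<Omega>" and f: "continuous_on UNIV f" "compact S" "S \<subseteq> \<Omega>" "\<And>x. x \<notin> S \<Longrightarrow> f x = 0"
  obtains \<phi> T where "compact T" "T \<subseteq> \<Omega>" "S \<subseteq> T" "\<And>n::nat. test_function \<Omega> (\<phi> n)"
    "\<And>n x. x \<notin> T \<Longrightarrow> \<phi> n x = 0"
    "\<And>e. e > 0 \<Longrightarrow> \<forall>\<^sub>F n in sequentially. \<forall>x. \<bar>\<phi> n x - f x\<bar> \<le> e"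
proof -
  interpret m: compactly_supported f S using f by unfold_locales auto
  obtain r T where T: "compact T" "T \<subseteq> \<Omega>" "S \<subseteq> T" and r: "\<And>n::nat. r n > 0" "r \<longlonglongrightarrow> 0"
    and t0: "\<And>f n. continuous_on UNIV f \<Longrightarrow> (\<And>x. x \<notin> S \<Longrightarrow> f x = 0) \<Longrightarrow> test_function \<Omega> (mollify (r n) f)"
    "\<And>f n x. continuous_on UNIV f \<Longrightarrow> (\<And>x. x \<notin> S \<Longrightarrow> f x = 0) \<Longrightarrow> x \<notin> T \<Longrightarrow> mollify (r n) f x = 0"
    by (rule mollify_test_functions[OF \<Omega> f(2,3)]) blast
  note t = t0(1)[OF f(1,4)] t0(2)[OF f(1,4)]
  show ?thesis by (rule that[OF T t m.mollify_uniform_limit[OF r]])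
qed

lemma C1_compact_approx_test_functions:
  assumes \<Omega>: "open \<Omega>" and f: "C1_compact \<Omega> f"
  obtains \<phi> T where "compact T" "T \<subseteq> \<Omega>" "\<And>n::nat. test_function \<Omega> (\<phi> n)"
    "\<And>x. x \<notin> T \<Longrightarrow> f x = 0 \<and> grad f x = 0"
    "\<And>n x. x \<notin> T \<Longrightarrow> \<phi> n x = 0 \<and> grad (\<phi> n) x = 0"
    "\<And>e. e > 0 \<Longrightarrow> \<forall>\<^sub>F n in sequentially. \<forall>x. \<bar>\<phi> n x - f x\<bar> \<le> e \<and> norm (grad (\<phi> n) x - grad f x) \<le> e"
proof -
  obtain S where S: "compact S" "S \<subseteq> \<Omega>" "\<And>x. x \<notin> S \<Longrightarrow> f x = 0" "\<And>x. x \<notin> S \<Longrightarrow> grad f x = 0"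
    using C1_compact_support[OF f] by metis
  note c = C1_compact_continuous[OF f]
  interpret m: compactly_supported f S using c S by unfold_locales auto
  obtain r T where T: "compact T" "T \<subseteq> \<Omega>" "S \<subseteq> T" and r: "\<And>n::nat. r n > 0" "r \<longlonglongrightarrow> 0"
    and t0: "\<And>f n. continuous_on UNIV f \<Longrightarrow> (\<And>x. x \<notin> S \<Longrightarrow> f x = 0) \<Longrightarrow> test_function \<Omega> (mollify (r n) f)"
    "\<And>f n x. continuous_on UNIV f \<Longrightarrow> (\<And>x. x \<notin> S \<Longrightarrow> f x = 0) \<Longrightarrow> x \<notin> T \<Longrightarrow> mollify (r n) f x = 0"
    by (rule mollify_test_functions[OF \<Omega> S(1,2)]) blast
  note t = t0(1)[OF c(1) S(3)] t0(2)[OF c(1) S(3)]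
  have close: "\<forall>\<^sub>F n in sequentially. \<forall>x. \<bar>mollify (r n) f x - f x\<bar> \<le> e \<and> norm (grad (mollify (r n) f) x - grad f x) \<le> e"
    if "e > 0" for e
  proof -
    let ?e = "e / real DIM('a)"
    have e: "?e > 0" using that by simp
    have "\<forall>\<^sub>F n in sequentially. \<forall>x. \<bar>mollify (r n) (\<lambda>y. grad f y \<bullet> b) x - grad f x \<bullet> b\<bar> \<le> ?e" for b
    proof -
      interpret gf: compactly_supported "\<lambda>y. grad f y \<bullet> b" S
        using S by unfold_locales (auto intro!: continuous_intros c)
      show ?thesis by (rule gf.mollify_uniform_limit[OF r e])
    qed
    then have "\<forall>\<^sub>F n in sequentially. \<forall>b\<in>Basis. \<forall>x. \<bar>mollify (r n) (\<lambda>y. grad f y \<bullet> b) x - grad f x \<bullet> b\<bar> \<le> ?e"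
      by (intro eventually_ball_finite) auto
    with m.mollify_uniform_limit[OF r that] show ?thesis
    proof eventually_elim
      case (elim n)
      have "norm (grad (mollify (r n) f) x - grad f x) \<le> e" for x
      proof -
        have "norm (grad (mollify (r n) f) x - grad f x) \<le>
            (\<Sum>b\<in>Basis. \<bar>(grad (mollify (r n) f) x - grad f x) \<bullet> b\<bar>)" by (rule norm_le_l1)
        also have "\<dots> \<le> (\<Sum>b\<in>(Basis::'a set). ?e)"
          using elim(2) by (intro sum_mono) (simp add: inner_diff_left grad_mollify[OF f r(1)])
        finally show ?thesis by simp
      qed
      then show ?case using elim(1) by blast
    qed
  qed
  show ?thesis
  proof (rule that[OF T(1,2) t(1) _ _ close])
    show "f x = 0 \<and> grad f x = 0" if "x \<notin> T" for x using S T(3) that by blast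
    show "mollify (r n) f x = 0 \<and> grad (mollify (r n) f) x = 0" if "x \<notin> T" for n x
      using t(2) that T(1) grad_eq_0_outside[of T "mollify (r n) f"] by (auto intro: compact_imp_closed)
  qed
qed

section \<open>Inequalities for powers\<close>

text \<open>Convexity of the power: Young's inequality with weights \<open>1 / s\<close> and
  \<open>1 - 1 / s\<close>, multiplied out. The cases in which a base vanishes are separated because
  of the convention \<open>0 powr s = 0\<close>.\<close>

lemma powr_tangent_le:
  fixes x y s :: real
  assumes "s \<ge> 1" "x \<ge> 0" "y \<ge> 0"
  shows "y powr s + s * y powr (s - 1) * (x - y) \<le> x powr s"
proof (cases "x = 0 \<or> y = 0")
  case True
  then show ?thesis
  proof
    assume "x = 0"
    have "y powr (s - 1) * y = y powr s" using assms by (cases "y = 0") (auto simp: powr_mult_base' powr_diff)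
    then have "y powr s + s * y powr (s - 1) * (x - y) = (1 - s) * y powr s"
      using \<open>x = 0\<close> by (simp add: algebra_simps)
    also have "\<dots> \<le> 0" using assms by (simp add: mult_le_0_iff)
    finally show ?thesis using \<open>x = 0\<close> by simp
  qed simp
next
  case False
  then have pos: "x > 0" "y > 0" using assms by auto
  have "(x powr s) powr (1 / s) * (y powr s) powr (1 - 1 / s) \<le> 1 / s * x powr s + (1 - 1 / s) * y powr s"
    by (rule Youngs_inequality_0) (use assms pos in auto)
  then have "x * y powr (s - 1) \<le> 1 / s * x powr s + (1 - 1 / s) * y powr s"
    using assms pos by (simp add: powr_powr algebra_simps)
  then have "s * (x * y powr (s - 1)) \<le> s * (1 / s * x powr s + (1 - 1 / s) * y powr s)"
    using assms by (intro mult_left_mono) auto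
  also have "\<dots> = x powr s + (s - 1) * y powr s" using assms by (simp add: field_simps)
  finally have "s * (x * y powr (s - 1)) \<le> x powr s + (s - 1) * y powr s" .
  moreover have "y powr (s - 1) * y = y powr s" using pos by (simp add: powr_diff)
  ultimately show ?thesis by (simp add: algebra_simps)
qed

text \<open>Concavity of the power. At \<open>y = 0\<close> it would fail, because
  \<open>0 powr (s - 1)\<close> is 0 instead of infinite; whence \<open>y > 0\<close>.\<close>

lemma powr_tangent_ge:
  fixes x y s :: real
  assumes "0 < s" "s \<le> 1" "x \<ge> 0" "y > 0"
  shows "x powr s \<le> y powr s + s * y powr (s - 1) * (x - y)"
proof -
  have e: "y powr (s - 1) * y = y powr s" using assms by (simp add: powr_diff)
  show ?thesis
  proof (cases "x = 0")
    case True
    have "y powr s + s * y powr (s - 1) * (x - y) = (1 - s) * y powr s"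
      using True e by (simp add: algebra_simps)
    also have "\<dots> \<ge> 0" using assms by simp
    finally show ?thesis using True assms by simp
  next
    case False
    have "x powr s * y powr (1 - s) \<le> s * x + (1 - s) * y"
      by (rule Youngs_inequality_0) (use assms False in auto)
    then have "x powr s * y powr (1 - s) * y powr (s - 1) \<le> (s * x + (1 - s) * y) * y powr (s - 1)"
      by (intro mult_right_mono) auto
    moreover have "y powr (1 - s) * y powr (s - 1) = 1" using assms by (simp add: powr_add[symmetric])
    ultimately show ?thesis using e by (simp add: algebra_simps)
  qed
qed

lemma powr_add_ge:
  fixes a b s :: real
  assumes "s \<ge> 1" "a \<ge> 0" "b \<ge> 0"
  shows "a powr s + b powr s \<le> (a + b) powr s"
proof -
  have e: "c powr s = c powr (s - 1) * c" if "c \<ge> 0" for c :: real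
    using that by (cases "c = 0") (auto simp: powr_diff)
  have "a powr (s - 1) * a + b powr (s - 1) * b \<le> (a + b) powr (s - 1) * a + (a + b) powr (s - 1) * b"
    using assms by (intro add_mono mult_right_mono powr_mono2) auto
  then show ?thesis using assms by (simp add: e algebra_simps)
qed

text \<open>Reduces powers of norms to powers of a quadratic expression, to which scalar tangent
  inequalities with exponent \<open>s / 2\<close> apply.\<close>

lemma norm_powr_eq: "norm a powr s = (a \<bullet> a) powr (s / 2)"
proof (cases "a = 0")
  case False
  have "a \<bullet> a = norm a powr 2" using False by (simp add: dot_square_norm)
  then have "(a \<bullet> a) powr (s / 2) = norm a powr (2 * (s / 2))" by (simp only: powr_powr)
  then show ?thesis by simp
qed simp

section \<open>The homogeneous map \<open>p_power\<close> and first-order expansions\<close>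

lemma p_power_0 [simp]: "p_power p 0 = 0"
  by (simp add: p_power_def)

lemma norm_p_power: "norm (p_power p \<xi>) = norm \<xi> powr (p - 1)"
proof (cases "\<xi> = 0")
  case False
  then have "norm \<xi> powr (p - 1) = norm \<xi> powr (p - 2) * norm \<xi> powr 1"
    by (subst powr_add[symmetric]) simp
  then show ?thesis using False by (simp add: p_power_def)
qed simp

lemma p_power_inner_self: "p_power p \<xi> \<bullet> \<xi> = norm \<xi> powr p"
proof (cases "\<xi> = 0")
  case False
  then have "norm \<xi> powr p = norm \<xi> powr (p - 2) * norm \<xi> powr 2"
    by (subst powr_add[symmetric]) simp
  then show ?thesis using False by (simp add: p_power_def dot_square_norm)
qed simp

lemma norm_p_power_conjugate: "p > 1 \<Longrightarrow> norm (p_power p \<xi>) powr (p / (p - 1)) = norm \<xi> powr p"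
  by (simp add: norm_p_power powr_powr)

lemma p_power_scale: "c > 0 \<Longrightarrow> p_power p (c *\<^sub>R \<xi>) = c powr (p - 1) *\<^sub>R p_power p \<xi>"
proof -
  assume c: "c > 0"
  then have "c powr (p - 2) * c = c powr (p - 1)" by (simp add: powr_diff power2_eq_square)
  then show ?thesis using c by (simp add: p_power_def powr_mult)
qed

lemma isCont_p_power:
  assumes "p > 1"
  shows "isCont (p_power p) (x::'a::euclidean_space)"
proof (cases "x = 0")
  case False
  then show ?thesis unfolding p_power_def
    by (intro continuous_intros) auto
next
  case True
  have "((\<lambda>\<xi>. norm (p_power p \<xi>)) \<longlongrightarrow> norm (0::'a) powr (p - 1)) (at 0)"
    unfolding norm_p_power
    by (intro tendsto_powr' tendsto_const) (use assms in \<open>auto intro: tendsto_norm_zero tendsto_ident_at\<close>)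
  then have "(p_power p \<longlongrightarrow> 0) (at (0::'a))" by (simp add: tendsto_norm_zero_iff)
  then show ?thesis using True by (simp add: isCont_def)
qed

lemma continuous_on_p_power [continuous_intros]:
  fixes f :: "'b::topological_space \<Rightarrow> 'a::euclidean_space"
  assumes "p > 1" "continuous_on S f"
  shows "continuous_on S (\<lambda>x. p_power p (f x))"
  by (rule continuous_on_compose2[OF _ assms(2), of UNIV])
    (auto intro: continuous_at_imp_continuous_on isCont_p_power assms)

lemma borel_measurable_p_power [measurable]:
  "p > 1 \<Longrightarrow> p_power p \<in> borel_measurable (borel :: 'a::euclidean_space measure)"
  by (intro borel_measurable_continuous_onI continuous_on_p_power continuous_on_id)

text \<open>If \<open>h\<close> is no longer than \<open>a\<close>, the tangent of the concave
  function \<open>s powr (p / 2)\<close> at \<open>a \<bullet> a\<close> leaves a remainder of order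
  \<open>|a|^(p-2) |h|^2\<close>, at most \<open>|h|^p\<close> since \<open>p \<le> 2\<close>.
  Otherwise the left side and the linear term are themselves at most constants times
  \<open>|h|^p\<close>. Thus the error is superlinear in \<open>h\<close>, uniformly in
  \<open>a\<close>.\<close>

lemma norm_add_powr_le:
  fixes a h :: "'a::euclidean_space"
  assumes "1 < p" "p \<le> 2"
  shows "norm (a + h) powr p \<le> norm a powr p + p * (p_power p a \<bullet> h) + (2 powr p + p) * norm h powr p"
proof (cases "norm a \<ge> norm h \<and> a \<noteq> 0")
  case True
  have "norm (a + h) powr p = ((a + h) \<bullet> (a + h)) powr (p / 2)" by (rule norm_powr_eq)
  also have "\<dots> \<le> (a \<bullet> a) powr (p / 2) + p / 2 * (a \<bullet> a) powr (p / 2 - 1) * ((a + h) \<bullet> (a + h) - a \<bullet> a)"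
    using assms True by (intro powr_tangent_ge) auto
  also have "(a \<bullet> a) powr (p / 2 - 1) = norm a powr (p - 2)"
    using norm_powr_eq[of a "p - 2"] by (simp add: diff_divide_distrib)
  also have "(a + h) \<bullet> (a + h) - a \<bullet> a = 2 * (a \<bullet> h) + h \<bullet> h" by (simp add: inner_add inner_commute)
  also have "p / 2 * norm a powr (p - 2) * (2 * (a \<bullet> h) + h \<bullet> h)
      = p * (p_power p a \<bullet> h) + p / 2 * (norm a powr (p - 2) * (h \<bullet> h))"
    by (simp add: p_power_def algebra_simps)
  also have "norm a powr (p - 2) * (h \<bullet> h) \<le> norm h powr p"
  proof (cases "h = 0")
    case False
    have "norm a powr (p - 2) * (h \<bullet> h) \<le> norm h powr (p - 2) * (h \<bullet> h)"
      using assms True False by (intro mult_right_mono powr_mono2') auto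
    also have "\<dots> = p_power p h \<bullet> h" by (simp add: p_power_def)
    finally show ?thesis by (simp add: p_power_inner_self)
  qed simp
  finally have "norm (a + h) powr p \<le> norm a powr p + (p * (p_power p a \<bullet> h) + p / 2 * norm h powr p)"
    using assms by (simp add: norm_powr_eq[symmetric])
  moreover have "p / 2 * norm h powr p \<le> (2 powr p + p) * norm h powr p"
    using assms by (intro mult_right_mono) auto
  ultimately show ?thesis by linarith
next
  case False
  then have le: "norm a \<le> norm h" by auto
  have "norm (a + h) \<le> 2 * norm h" using norm_triangle_ineq[of a h] le by linarith
  then have "norm (a + h) powr p \<le> (2 * norm h) powr p" using assms by (intro powr_mono2) auto
  also have "\<dots> = 2 powr p * norm h powr p" by (simp add: powr_mult)
  finally have 1: "norm (a + h) powr p \<le> 2 powr p * norm h powr p" .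
  have "- (p_power p a \<bullet> h) \<le> norm (p_power p a) * norm h"
    using Cauchy_Schwarz_ineq2[of "p_power p a" h] by linarith
  also have "\<dots> \<le> norm h powr (p - 1) * norm h"
    unfolding norm_p_power using assms le by (intro mult_right_mono powr_mono2) auto
  also have "\<dots> = norm h powr p" by (cases "h = 0") (auto simp: powr_diff)
  finally have "p * (- (p_power p a \<bullet> h)) \<le> p * norm h powr p" using assms by (intro mult_left_mono) auto
  moreover have "norm a powr p \<ge> 0" by simp
  ultimately show ?thesis using 1 unfolding distrib_right mult_minus_right by linarith
qed

lemma abs_add_powr_ge:
  fixes u s p :: real
  assumes "p \<ge> 1" "u > 0"
  shows "u powr p + p * u powr (p - 1) * s \<le> \<bar>u + s\<bar> powr p"
proof -
  have "u powr p + p * u powr (p - 1) * (\<bar>u + s\<bar> - u) \<le> \<bar>u + s\<bar> powr p"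
    using assms by (intro powr_tangent_le) auto
  moreover have "p * u powr (p - 1) * s \<le> p * u powr (p - 1) * (\<bar>u + s\<bar> - u)"
    using assms by (intro mult_left_mono) auto
  ultimately show ?thesis by linarith
qed

text \<open>Takes the place of differentiating an energy at its minimum: a one-sided bound with
  superlinear error, read for small \<open>t\<close> of either sign, already determines the linear
  coefficient.\<close>

lemma linear_le_powr_imp_0:
  fixes A C p :: real
  assumes "p > 1" "\<And>t. 0 \<le> A * t + C * \<bar>t\<bar> powr p"
  shows "A = 0"
proof -
  have nonneg: "B \<ge> 0" if B: "\<And>t. t > 0 \<Longrightarrow> 0 \<le> B * t + C * t powr p" for B
  proof -
    have "((\<lambda>t. B + C * t powr (p - 1)) \<longlongrightarrow> B + C * 0 powr (p - 1)) (at_right 0)"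
      by (intro tendsto_intros tendsto_powr')
        (use assms(1) in \<open>auto simp: eventually_at_filter\<close>)
    moreover have "\<forall>\<^sub>F t in at_right 0. 0 \<le> B + C * t powr (p - 1)"
    proof -
      have "0 \<le> B + C * t powr (p - 1)" if "t > 0" for t
      proof -
        have "t powr p = t powr (p - 1) * t" using that by (simp add: powr_diff)
        then have "0 \<le> (B + C * t powr (p - 1)) * t" using B[OF that] by (simp add: algebra_simps)
        then show ?thesis using that by (simp add: zero_le_mult_iff)
      qed
      then show ?thesis by (auto simp: eventually_at_filter)
    qed
    ultimately have "0 \<le> B + C * 0 powr (p - 1)" by (intro tendsto_lowerbound) auto
    then show ?thesis by simp
  qed
  have "A \<ge> 0"
  proof (rule nonneg)
    fix t :: real assume "t > 0"
    then show "0 \<le> A * t + C * t powr p" using assms(2)[of t] by simp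
  qed
  moreover have "- A \<ge> 0"
  proof (rule nonneg)
    fix t :: real assume "t > 0"
    then show "0 \<le> - A * t + C * t powr p" using assms(2)[of "- t"] by simp
  qed
  ultimately show ?thesis by simp
qed

section \<open>Young's inequality and the Bregman remainder\<close>

lemma Young_remainder_nonneg:
  fixes W \<xi> :: "'a::euclidean_space"
  assumes "p > 1"
  shows "p * (W \<bullet> \<xi>) \<le> norm \<xi> powr p + (p - 1) * norm W powr (p / (p - 1))"
proof -
  have "W \<bullet> \<xi> \<le> norm W * norm \<xi>" by (rule norm_cauchy_schwarz)
  also have "\<dots> = norm \<xi> * norm W" by simp
  also have "\<dots> \<le> norm \<xi> powr p / p + norm W powr (p / (p - 1)) / (p / (p - 1))"
    by (rule Youngs_inequality) (use assms in \<open>auto simp: field_simps\<close>)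
  finally have "p * (W \<bullet> \<xi>) \<le> p * (norm \<xi> powr p / p + norm W powr (p / (p - 1)) / (p / (p - 1)))"
    using assms by (intro mult_left_mono) auto
  also have "\<dots> = norm \<xi> powr p + (p - 1) * norm W powr (p / (p - 1))"
    using assms by (simp add: field_simps)
  finally show ?thesis .
qed

text \<open>At equality \<xi> minimises the nonnegative Young remainder, so its first variation
  vanishes in every direction \<open>h\<close>; this variation is a multiple of
  \<open>(p_power p \<xi> - W) \<bullet> h\<close>.\<close>

lemma Young_remainder_eq_0:
  fixes W \<xi> :: "'a::euclidean_space"
  assumes p: "1 < p" "p \<le> 2" and eq: "norm \<xi> powr p + (p - 1) * norm W powr (p / (p - 1)) = p * (W \<bullet> \<xi>)"
  shows "W = p_power p \<xi>"
proof -
  have "(p_power p \<xi> - W) \<bullet> h = 0" for h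
  proof -
    have "p * ((p_power p \<xi> - W) \<bullet> h) = 0"
    proof (rule linear_le_powr_imp_0[OF p(1)])
      fix t :: real
      have "p * (W \<bullet> (\<xi> + t *\<^sub>R h)) \<le> norm (\<xi> + t *\<^sub>R h) powr p + (p - 1) * norm W powr (p / (p - 1))"
        by (rule Young_remainder_nonneg[OF p(1)])
      also have "norm (\<xi> + t *\<^sub>R h) powr p \<le> norm \<xi> powr p + p * (p_power p \<xi> \<bullet> (t *\<^sub>R h)) +
          (2 powr p + p) * norm (t *\<^sub>R h) powr p" by (rule norm_add_powr_le[OF p])
      finally have "p * (W \<bullet> \<xi>) + p * (W \<bullet> h) * t \<le> norm \<xi> powr p + p * (p_power p \<xi> \<bullet> h) * t +
          (2 powr p + p) * (\<bar>t\<bar> powr p * norm h powr p) + (p - 1) * norm W powr (p / (p - 1))"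
        by (simp only: inner_add_right inner_scaleR_right norm_scaleR powr_mult distrib_left mult.assoc mult.commute[of t])
      then show "0 \<le> p * ((p_power p \<xi> - W) \<bullet> h) * t + ((2 powr p + p) * norm h powr p) * \<bar>t\<bar> powr p"
        unfolding inner_diff_left right_diff_distrib left_diff_distrib using eq
        by (simp only: left_diff_distrib mult.assoc mult.commute[of "norm h powr p"])
    qed
    then show ?thesis using p by simp
  qed
  then have "(p_power p \<xi> - W) \<bullet> (p_power p \<xi> - W) = 0" .
  then show ?thesis by simp
qed

text \<open>\<open>B\<close> is the Bregman remainder of \<open>|X|\<^sup>q\<close> at the field \<open>w e\<close>. The first bound is effective where
  \<open>w\<close> is small, the second where it is large.\<close>

lemma Bregman_lower_bounds:
  fixes X e :: "'a::euclidean_space" and w q :: real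
  assumes q: "q \<ge> 2" and e: "norm e = 1"
  defines "B \<equiv> norm X powr q - \<bar>w\<bar> powr q - q * (\<bar>w\<bar> powr (q - 2) * w) * (X \<bullet> e - w)"
  shows "norm (X - (X \<bullet> e) *\<^sub>R e) powr q \<le> B"
    and "q / 2 * \<bar>w\<bar> powr (q - 2) * (norm (X - (X \<bullet> e) *\<^sub>R e))\<^sup>2 \<le> B"
proof -
  let ?Y = "X - (X \<bullet> e) *\<^sub>R e" and ?z = "X \<bullet> e"
  have ee: "e \<bullet> e = 1" using e by (simp add: dot_square_norm)
  have pyth: "X \<bullet> X = ?z\<^sup>2 + (norm ?Y)\<^sup>2"
    unfolding power2_norm_eq_inner
    by (simp add: inner_diff_left inner_diff_right ee inner_commute[of e X] power2_eq_square)
  have sq: "\<bar>v\<bar> powr s = (v\<^sup>2) powr (s / 2)" for v s :: real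
    using norm_powr_eq[of v s] by (simp add: power2_eq_square)
  \<comment> \<open>Tangent of the convex power \<open>q / 2\<close> at \<open>w^2\<close>,
    evaluated at \<open>?z^2 + c\<close>, with the square of \<open>?z - w\<close> dropped. Taking
    for \<open>c\<close> the squared norm of \<open>?Y\<close> gives the second bound;
    \<open>c = 0\<close> together with superadditivity gives the first.\<close>
  have tan: "\<bar>w\<bar> powr q + q / 2 * \<bar>w\<bar> powr (q - 2) * (2 * w * (?z - w) + c) \<le> (?z\<^sup>2 + c) powr (q / 2)"
    if "c \<ge> 0" for c
  proof -
    have "(w\<^sup>2) powr (q / 2) + q / 2 * (w\<^sup>2) powr (q / 2 - 1) * ((?z\<^sup>2 + c) - w\<^sup>2) \<le> (?z\<^sup>2 + c) powr (q / 2)"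
      using q that by (intro powr_tangent_le) auto
    moreover have "(w\<^sup>2) powr (q / 2 - 1) = \<bar>w\<bar> powr (q - 2)" using sq[of w "q - 2"] by (simp add: diff_divide_distrib)
    moreover have "2 * w * (?z - w) + c \<le> (?z\<^sup>2 + c) - w\<^sup>2"
      using zero_le_power2[of "?z - w"] by (simp add: power2_eq_square algebra_simps)
    then have "q / 2 * \<bar>w\<bar> powr (q - 2) * (2 * w * (?z - w) + c) \<le> q / 2 * \<bar>w\<bar> powr (q - 2) * ((?z\<^sup>2 + c) - w\<^sup>2)"
      using q by (intro mult_left_mono) auto
    ultimately show ?thesis by (simp add: sq[of w q])
  qed
  have nX: "norm X powr q = (?z\<^sup>2 + (norm ?Y)\<^sup>2) powr (q / 2)"
    using norm_powr_eq[of X q] pyth by simp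
  show "q / 2 * \<bar>w\<bar> powr (q - 2) * (norm ?Y)\<^sup>2 \<le> B"
    using tan[of "(norm ?Y)\<^sup>2"] unfolding B_def nX by (simp add: algebra_simps)
  have "(?z\<^sup>2) powr (q / 2) + ((norm ?Y)\<^sup>2) powr (q / 2) \<le> norm X powr q"
    unfolding nX using q by (intro powr_add_ge) auto
  moreover have "((norm ?Y)\<^sup>2) powr (q / 2) = norm ?Y powr q" using sq[of "norm ?Y" q] by simp
  ultimately show "norm ?Y powr q \<le> B"
    using tan[of 0] unfolding B_def by (simp add: algebra_simps)
qed

lemma DERIV_abs_powr:
  fixes s x :: real
  assumes "s > 1"
  shows "((\<lambda>x. \<bar>x\<bar> powr s) has_real_derivative s * p_power s x) (at x)"
proof -
  consider "x > 0" | "x < 0" | "x = 0" by linarith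
  then show ?thesis
  proof cases
    case 1
    have "((\<lambda>x. x powr s) has_real_derivative s * p_power s x) (at x)"
      using 1 by (auto intro!: derivative_eq_intros simp: p_power_def powr_diff power2_eq_square)
    then show ?thesis
      by (rule has_field_derivative_transform_within_open[where S="{0<..}"]) (use 1 in auto)
  next
    case 2
    have "((\<lambda>x. (- x) powr s) has_real_derivative s * p_power s x) (at x)"
      using 2 by (auto intro!: derivative_eq_intros simp: p_power_def powr_diff power2_eq_square)
    then show ?thesis
      by (rule has_field_derivative_transform_within_open[where S="{..<0}"]) (use 2 in auto)
  next
    case 3
    have "((\<lambda>h::real. norm h powr (s - 1)) \<longlongrightarrow> 0 powr (s - 1)) (at 0)"
      by (intro tendsto_powr' tendsto_const) (use assms tendsto_rabs_zero[OF tendsto_ident_at] in auto)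
    moreover have "norm h powr (s - 1) = norm (\<bar>h\<bar> powr s / h)" for h :: real
      by (cases "h = 0") (auto simp: powr_diff)
    ultimately have "((\<lambda>h. norm (\<bar>h\<bar> powr s / h)) \<longlongrightarrow> 0) (at (0::real))" by simp
    then have "((\<lambda>h. \<bar>h\<bar> powr s / h) \<longlongrightarrow> 0) (at (0::real))" by (rule tendsto_norm_zero_cancel)
    then show ?thesis using 3 assms by (simp add: DERIV_def)
  qed
qed

lemma DERIV_0_I:
  fixes f :: "real \<Rightarrow> real"
  assumes "f a = 0" "\<And>e. e > 0 \<Longrightarrow> \<exists>d>0. \<forall>s. \<bar>s - a\<bar> < d \<longrightarrow> \<bar>f s\<bar> \<le> e * \<bar>s - a\<bar>"
  shows "(f has_real_derivative 0) (at a)"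
  unfolding DERIV_def
proof (rule LIM_I)
  fix r :: real assume "r > 0"
  then obtain d where d: "d > 0" "\<forall>s. \<bar>s - a\<bar> < d \<longrightarrow> \<bar>f s\<bar> \<le> r / 2 * \<bar>s - a\<bar>"
    using assms(2)[of "r / 2"] by auto
  have "\<bar>(f (a + h) - f a) / h\<bar> < r" if "h \<noteq> 0" "\<bar>h\<bar> < d" for h
  proof -
    have "\<bar>f (a + h)\<bar> \<le> r / 2 * \<bar>h\<bar>" using d(2)[rule_format, of "a + h"] that by simp
    then have "\<bar>f (a + h)\<bar> / \<bar>h\<bar> \<le> r / 2" using that by (simp add: field_simps)
    then have "\<bar>f (a + h)\<bar> / \<bar>h\<bar> < r" using \<open>r > 0\<close> by linarith
    then show ?thesis using assms(1) by simp
  qed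
  then show "\<exists>s>0. \<forall>x. x \<noteq> 0 \<and> norm (x - 0) < s \<longrightarrow> norm ((f (a + x) - f a) / x - 0) < r"
    using d(1) by (intro exI[of _ d]) auto
qed

section \<open>The one-dimensional comparison problem\<close>

locale comparison_ode =
  fixes p q :: real
  assumes p: "1 < p" "p < 2" and q_def: "q = p / (p - 1)"
begin

lemma q_gt_2: "q > 2"
  using p by (simp add: q_def field_simps)

lemma pq: "(p - 1) * q = p" "(p - 1) * (q - 1) = 1" "p / q = p - 1" "p + q = p * q"
  using p by (auto simp: q_def field_simps)

text \<open>Separation of variables in the equation for \<open>w\<close>: \<open>G y\<close> is the
  reciprocal of the speed \<open>- w'\<close> at the level \<open>w = - y\<close>, so its primitive
  measures the time needed to reach that level.\<close>

definition G :: "real \<Rightarrow> real" where "G y = 1 / ((p - 1) * (1 + \<bar>y\<bar> powr q))"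

lemma G_pos: "G y > 0"
  using p by (auto simp: G_def intro!: divide_pos_pos mult_pos_pos add_pos_nonneg)

lemma continuous_G: "isCont G y"
proof -
  have "isCont (\<lambda>y::real. \<bar>y\<bar> powr q) y"
    using DERIV_abs_powr[of q y] q_gt_2 DERIV_isCont by fastforce
  moreover have "1 + \<bar>y\<bar> powr q \<noteq> 0" using powr_ge_zero[of "\<bar>y\<bar>" q] by linarith
  ultimately show ?thesis using p unfolding G_def
    by (intro isCont_divide isCont_mult isCont_add continuous_const) auto
qed

text \<open>The solution \<open>w\<close> of \<open>w' = - (p - 1) (1 + |w|\<^sup>q)\<close>, \<open>w(0) = 0\<close>, is \<open>-T\<^sup>-\<^sup>1\<close>; it blows up at \<open>len\<close>.\<close>

definition T :: "real \<Rightarrow> real" where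
  "T = (SOME T. T 0 = 0 \<and> (\<forall>y. (T has_real_derivative G y) (at y)))"

lemma T_spec: "T 0 = 0" "(T has_real_derivative G y) (at y)"
proof -
  obtain F where F: "\<And>y. (F has_vector_derivative G y) (at y)"
    using einterval_antiderivative[of "-\<infinity>" "\<infinity>" G] continuous_G by auto
  have "\<exists>T. T 0 = 0 \<and> (\<forall>y. (T has_real_derivative G y) (at y))"
    by (rule exI[of _ "\<lambda>y. F y - F 0"])
      (auto intro!: derivative_eq_intros F[folded has_real_derivative_iff_has_vector_derivative])
  from someI_ex[OF this] show "T 0 = 0" "(T has_real_derivative G y) (at y)"
    unfolding T_def by auto
qed

lemma T_strict_mono: "x < y \<Longrightarrow> T x < T y"
  by (rule DERIV_pos_imp_increasing) (use T_spec(2) G_pos in blast)+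

lemma T_less_iff [simp]: "T x < T y \<longleftrightarrow> x < y"
  using T_strict_mono by (metis less_asym' linorder_neqE)

lemma T_le_iff [simp]: "T x \<le> T y \<longleftrightarrow> x \<le> y"
  by (simp flip: not_less)

lemma T_eq_iff [simp]: "T x = T y \<longleftrightarrow> x = y"
  by (metis T_strict_mono less_irrefl linorder_neqE)

lemma T_minus: "T (- y) = - T y"
proof -
  have "((\<lambda>y. T y + T (- y)) has_real_derivative G y + G (- y) * (- 1)) (at y)" for y
    by (intro DERIV_add T_spec(2) DERIV_chain2[OF T_spec(2)]) (auto intro!: derivative_eq_intros)
  then have "((\<lambda>y. T y + T (- y)) has_real_derivative 0) (at y)" for y by (simp add: G_def)
  then have "T y + T (- y) = T 0 + T (- 0)" by (rule DERIV_isconst_all[rule_format])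
  then show ?thesis by (simp add: T_spec)
qed

text \<open>Since \<open>q > 2\<close>, \<open>G\<close> is dominated by a multiple of the
  derivative of \<open>arctan\<close>; what is at stake is the finiteness of the blow-up time, so
  the constant is crude.\<close>

lemma T_bounded: "T y \<le> 2 / (p - 1) * pi"
proof (cases "y \<ge> 0")
  case True
  have le: "G y \<le> 2 / (p - 1) * inverse (1 + y\<^sup>2)" for y
  proof -
    have "y\<^sup>2 \<le> 1 + 2 * \<bar>y\<bar> powr q"
    proof (cases "\<bar>y\<bar> \<le> 1")
      case True
      then have "y\<^sup>2 \<le> 1" by (simp add: abs_square_le_1)
      moreover have "\<bar>y\<bar> powr q \<ge> 0" by simp
      ultimately show ?thesis by linarith
    next
      case False
      then have "\<bar>y\<bar> powr 2 \<le> \<bar>y\<bar> powr q" using q_gt_2 by (intro powr_mono) auto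
      then have "y\<^sup>2 \<le> \<bar>y\<bar> powr q" using False by simp
      moreover have "\<bar>y\<bar> powr q \<ge> 0" by simp
      ultimately show ?thesis by linarith
    qed
    then have "1 + y\<^sup>2 \<le> 2 * (1 + \<bar>y\<bar> powr q)" by simp
    moreover have "1 + y\<^sup>2 > 0" "1 + \<bar>y\<bar> powr q > 0" by (auto intro: add_pos_nonneg)
    ultimately have "inverse (1 + \<bar>y\<bar> powr q) \<le> 2 * inverse (1 + y\<^sup>2)"
      by (simp add: field_simps)
    then have "1 / (p - 1) * inverse (1 + \<bar>y\<bar> powr q) \<le> 1 / (p - 1) * (2 * inverse (1 + y\<^sup>2))"
      using p by (intro mult_left_mono) auto
    then show ?thesis by (simp add: G_def field_simps)
  qed
  have "T 0 - 2 / (p - 1) * arctan 0 \<ge> T y - 2 / (p - 1) * arctan y"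
  proof (rule DERIV_nonpos_imp_nonincreasing[OF True])
    fix x
    have "((\<lambda>y. T y - 2 / (p - 1) * arctan y) has_real_derivative G x - 2 / (p - 1) * inverse (1 + x\<^sup>2)) (at x)"
      by (intro DERIV_diff T_spec(2) DERIV_cmult DERIV_arctan)
    then show "\<exists>z. ((\<lambda>y. T y - 2 / (p - 1) * arctan y) has_real_derivative z) (at x) \<and> z \<le> 0"
      using le[of x] by fastforce
  qed
  then have "T y \<le> 2 / (p - 1) * arctan y" by (simp add: T_spec)
  also have "\<dots> \<le> 2 / (p - 1) * pi"
  proof (rule mult_left_mono)
    show "arctan y \<le> pi" using arctan_ubound[of y] pi_gt_zero by linarith
  qed (use p in auto)
  finally show ?thesis .
next
  case False
  then have "T y \<le> T 0" by simp
  also have "\<dots> \<le> 2 / (p - 1) * pi" using p by (simp add: T_spec)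
  finally show ?thesis .
qed

text \<open>The half-length of the interval whose first Dirichlet eigenvalue is
  \<open>p - 1\<close>, usually written \<open>pi_p / 2\<close>; rescaling by \<epsilon> divides
  this eigenvalue by \<open>\<epsilon>^p\<close>.\<close>

definition len :: real where "len = Sup (range T)"

lemma T_less_len: "T y < len"
proof -
  have "bdd_above (range T)" using T_bounded by (intro bdd_aboveI2[of _ T]) (rule T_bounded)
  then have "T (y + 1) \<le> len" unfolding len_def by (intro cSup_upper) auto
  moreover have "T y < T (y + 1)" by simp
  ultimately show ?thesis by linarith
qed

lemma len_pos: "len > 0"
  using T_less_len[of 0] by (simp add: T_spec)

lemma T_approx_len: "s < len \<Longrightarrow> \<exists>y. s < T y"
  unfolding len_def using less_cSupD[of "range T" s] by auto

lemma T_surj: "\<bar>s\<bar> < len \<Longrightarrow> \<exists>y. T y = s"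
proof -
  assume s: "\<bar>s\<bar> < len"
  then have "s < len" "- s < len" by auto
  then obtain a b where a: "s < T a" and b: "- s < T b" using T_approx_len by blast
  then have b': "T (- b) < s" by (simp add: T_minus)
  then have "- b \<le> a" using a by (metis T_le_iff less_imp_le order_trans)
  moreover have "isCont T x" for x using T_spec(2) DERIV_isCont by blast
  ultimately show ?thesis using IVT[of T "- b" s a] a b' by (auto intro: less_imp_le)
qed

text \<open>Outside \<open>(-len, len)\<close> the value of \<open>inv T\<close> is arbitrary, hence
  the hypothesis \<open>|s| < len\<close> in the facts about \<open>w s\<close>.\<close>

definition w :: "real \<Rightarrow> real" where "w s = - (inv T s)"

lemma T_w: "\<bar>s\<bar> < len \<Longrightarrow> T (w s) = - s"
  unfolding w_def T_minus using T_surj by (simp add: f_inv_into_f image_iff) (metis f_inv_into_f rangeI)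

lemma inv_T [simp]: "inv T (T y) = y"
  by (rule inv_f_f) (auto intro: injI)

lemma w_T: "w (T y) = - y"
  by (simp add: w_def)

lemma w_0 [simp]: "w 0 = 0"
  using w_T[of 0] by (simp add: T_spec)

lemma w_less_iff: "\<bar>s\<bar> < len \<Longrightarrow> \<bar>t\<bar> < len \<Longrightarrow> w s < w t \<longleftrightarrow> t < s"
  using T_less_iff[of "w s" "w t"] by (simp add: T_w del: T_less_iff)

lemma w_minus: "\<bar>s\<bar> < len \<Longrightarrow> w (- s) = - w s"
  using T_eq_iff[of "w (- s)" "- w s"] by (simp add: T_w T_minus del: T_eq_iff)

lemma abs_w_mono: "\<bar>s\<bar> \<le> \<bar>t\<bar> \<Longrightarrow> \<bar>t\<bar> < len \<Longrightarrow> \<bar>w s\<bar> \<le> \<bar>w t\<bar>"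
proof -
  have e: "\<bar>w s\<bar> = - w \<bar>s\<bar>" if "\<bar>s\<bar> < len" for s
  proof -
    have "w \<bar>s\<bar> \<le> 0" using w_less_iff[of 0 "\<bar>s\<bar>"] that by (simp add: not_less[symmetric]) 
    moreover have "\<bar>w s\<bar> = \<bar>w \<bar>s\<bar>\<bar>" using w_minus[OF that] by (cases "s \<ge> 0") auto
    ultimately show ?thesis by linarith
  qed
  assume *: "\<bar>s\<bar> \<le> \<bar>t\<bar>" "\<bar>t\<bar> < len"
  then have "w \<bar>t\<bar> \<le> w \<bar>s\<bar>" using w_less_iff[of "\<bar>s\<bar>" "\<bar>t\<bar>"] by (simp add: not_less[symmetric])
  then show ?thesis using e[of s] e[of t] * by simp
qed

lemma w_nonzero: "\<bar>s\<bar> < len \<Longrightarrow> s \<noteq> 0 \<Longrightarrow> w s \<noteq> 0"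
  using T_w[of s] T_spec(1) by auto

lemma DERIV_w:
  assumes s: "\<bar>s\<bar> < len"
  shows "(w has_real_derivative - ((p - 1) * (1 + \<bar>w s\<bar> powr q))) (at s)"
proof -
  obtain y where y: "T y = s" using T_surj[OF s] by blast
  have c: "isCont (inv T) (T y)"
    by (rule isCont_inverse_function[where d=1]) (use T_spec(2) DERIV_isCont in auto)
  have "(inv T has_real_derivative inverse (G y)) (at s)"
  proof (rule DERIV_inverse_function[where f=T and a="- len" and b=len])
    show "T (inv T z) = z" if "- len < z" "z < len" for z
      using T_w[of z] that by (simp add: w_def T_minus)
    show "(T has_real_derivative G y) (at (inv T s))" using T_spec(2) y by auto
  qed (use s c y G_pos[of y] in auto)
  moreover have "w s = - y" using w_T[of y] y by simp
  ultimately have "((\<lambda>s. - inv T s) has_real_derivative - ((p - 1) * (1 + \<bar>w s\<bar> powr q))) (at s)"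
    by (auto intro!: derivative_eq_intros simp: G_def)
  then show ?thesis unfolding w_def[abs_def, symmetric] .
qed

text \<open>\<open>V = v\<^sup>p\<close> for the first eigenfunction \<open>v\<close> of the one-dimensional \<open>p\<close>-Laplacian on
  \<open>(-len, len)\<close>, and \<open>w = |v'|\<^bsup>p-2\<^esup> v' / v\<^bsup>p-1\<^esup>\<close>.\<close>

definition V :: "real \<Rightarrow> real" where
  "V s = (if \<bar>s\<bar> < len then 1 / (1 + \<bar>w s\<bar> powr q) else 0)"

text \<open>Zero outside the interval through the factor \<open>V\<close>, whatever \<open>w\<close>
  is there, so that this one formula is the derivative of \<open>V\<close> on the whole
  line.\<close>

definition V' :: "real \<Rightarrow> real" where
  "V' s = p * V s * p_power q (w s)"

lemma V_nonneg: "V s \<ge> 0"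
  by (auto simp: V_def)

lemma V_le_1: "V s \<le> 1"
  by (auto simp: V_def divide_le_eq_1 add_pos_nonneg)

text \<open>With \<open>V = v^p\<close> and \<open>|w|^q V = |v'|^p\<close> this is the conservation
  law \<open>v^p + |v'|^p = 1\<close> of the one-dimensional problem.\<close>

lemma V_mult: "\<bar>s\<bar> < len \<Longrightarrow> \<bar>w s\<bar> powr q * V s = 1 - V s"
proof -
  assume "\<bar>s\<bar> < len"
  moreover have "1 + \<bar>w s\<bar> powr q > 0" by (auto intro: add_pos_nonneg)
  ultimately show ?thesis by (simp add: V_def field_simps)
qed

lemma w_large_near_end:
  assumes "Y > 0"
  obtains d where "d > 0" "d \<le> len" "\<And>s. len - d < \<bar>s\<bar> \<Longrightarrow> \<bar>s\<bar> < len \<Longrightarrow> \<bar>w s\<bar> \<ge> Y"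
proof
  show "len - T Y > 0" using T_less_len[of Y] by simp
  show "len - T Y \<le> len" using assms T_le_iff[of 0 Y] T_spec(1) by simp
  fix s assume s: "len - (len - T Y) < \<bar>s\<bar>" "\<bar>s\<bar> < len"
  have "\<bar>w (T Y)\<bar> \<le> \<bar>w s\<bar>" using s assms T_le_iff[of 0 Y] T_spec(1) by (intro abs_w_mono) (auto simp del: T_le_iff)
  then show "\<bar>w s\<bar> \<ge> Y" using assms by (simp add: w_T)
qed

text \<open>From the level \<open>y = |w s|\<close> a time of at least \<open>y * G z\<close>, with
  some \<open>z\<close> between \<open>y\<close> and \<open>2 * y\<close>, is left before the
  blow-up, and \<open>(p - 1) * G z\<close> is comparable with \<open>V s\<close> up to the factor
  \<open>2 powr q\<close>. As \<open>Y\<close> may be taken large, \<open>V\<close> is of smaller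
  order than the distance to the end.\<close>

lemma V_le_dist:
  assumes "\<bar>s\<bar> < len" "\<bar>w s\<bar> \<ge> Y" "Y > 0"
  shows "V s \<le> (p - 1) * 2 powr q / Y * (len - \<bar>s\<bar>)"
proof -
  define y where "y = \<bar>w s\<bar>"
  have y: "y \<ge> Y" "y > 0" using assms by (auto simp: y_def)
  have Ty: "T y = \<bar>s\<bar>"
  proof -
    have "T y = \<bar>T (w s)\<bar>"
    proof (cases "w s \<ge> 0")
      case True
      then have "T (w s) \<ge> 0" using T_le_iff[of 0 "w s"] T_spec(1) by simp
      then show ?thesis using True by (simp add: y_def)
    next
      case False
      then have "T (w s) \<le> 0" using T_le_iff[of "w s" 0] T_spec(1) by simp
      then show ?thesis using False by (simp add: y_def T_minus)
    qed
    then show ?thesis using T_w[OF assms(1)] by simp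
  qed
  obtain z where z: "y < z" "z < 2 * y" "T (2 * y) - T y = (2 * y - y) * G z"
    using MVT2[of y "2 * y" T G] y T_spec(2) by auto
  have "\<bar>z\<bar> powr q \<le> (2 * y) powr q" using z y q_gt_2 by (intro powr_mono2) auto
  then have "1 + \<bar>z\<bar> powr q \<le> 2 powr q * (1 + y powr q)"
    using y q_gt_2 ge_one_powr_ge_zero[of 2 q] by (simp add: powr_mult algebra_simps)
  moreover have "1 + \<bar>z\<bar> powr q > 0" "1 + y powr q > 0" by (auto intro: add_pos_nonneg)
  ultimately have "1 / (1 + y powr q) \<le> 2 powr q * (1 / (1 + \<bar>z\<bar> powr q))"
    by (simp add: field_simps)
  also have "1 / (1 + y powr q) = V s" using assms(1) by (simp add: V_def y_def)
  also have "1 / (1 + \<bar>z\<bar> powr q) = (p - 1) * G z" using p by (simp add: G_def)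
  finally have 1: "V s \<le> (p - 1) * 2 powr q * G z" by (simp add: ac_simps)
  have "y * G z = T (2 * y) - T y" using z(3) by simp
  also have "\<dots> \<le> len - \<bar>s\<bar>" using T_less_len[of "2 * y"] Ty by simp
  finally have "Y * G z \<le> len - \<bar>s\<bar>" using mult_right_mono[OF y(1), of "G z"] G_pos[of z] by linarith
  then have "G z \<le> (len - \<bar>s\<bar>) / Y" using assms(3) by (simp add: field_simps)
  then have "(p - 1) * 2 powr q * G z \<le> (p - 1) * 2 powr q * ((len - \<bar>s\<bar>) / Y)"
    using p by (intro mult_left_mono) auto
  then show ?thesis using 1 by simp
qed

text \<open>The case in doubt is an end point, where \<open>w\<close> blows up; near it
  \<open>V\<close> is bounded by \<open>e\<close> times the distance for every \<open>e > 0\<close>,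
  so it joins the zero function differentiably.\<close>

lemma DERIV_V: "(V has_real_derivative V' s) (at s)"
proof -
  consider "\<bar>s\<bar> < len" | "\<bar>s\<bar> > len" | "\<bar>s\<bar> = len" by linarith
  then show ?thesis
  proof cases
    case 1
    have pos: "1 + \<bar>w s\<bar> powr q > 0" by (auto intro: add_pos_nonneg)
    have "((\<lambda>s. \<bar>w s\<bar> powr q) has_real_derivative
        (q * p_power q (w s)) * (- ((p - 1) * (1 + \<bar>w s\<bar> powr q)))) (at s)"
      by (rule DERIV_chain2[OF DERIV_abs_powr DERIV_w[OF 1]]) (use q_gt_2 in simp)
    from DERIV_divide[OF DERIV_const[of 1] DERIV_add[OF DERIV_const[of 1] this]]
    have "((\<lambda>s. 1 / (1 + \<bar>w s\<bar> powr q)) has_real_derivative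
        - ((q * p_power q (w s)) * (- ((p - 1) * (1 + \<bar>w s\<bar> powr q)))) / (1 + \<bar>w s\<bar> powr q)\<^sup>2) (at s)"
      using pos by (simp add: power2_eq_square)
    also have "- ((q * p_power q (w s)) * (- ((p - 1) * (1 + \<bar>w s\<bar> powr q)))) / (1 + \<bar>w s\<bar> powr q)\<^sup>2
        = ((p - 1) * q) * p_power q (w s) * (1 / (1 + \<bar>w s\<bar> powr q))"
      using pos by (simp add: power2_eq_square)
    also have "\<dots> = V' s" using 1 by (simp add: V'_def V_def pq)
    finally show ?thesis
      by (rule has_field_derivative_transform_within_open[where S="{- len<..<len}"])
        (use 1 in \<open>auto simp: V_def\<close>)
  next
    case 2
    have "((\<lambda>s. 0) has_real_derivative 0) (at s)" by simp
    then have "(V has_real_derivative 0) (at s)"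
      by (rule has_field_derivative_transform_within_open[where S="- cball 0 len"])
        (use 2 in \<open>auto simp: V_def\<close>)
    then show ?thesis using 2 by (simp add: V'_def V_def)
  next
    case 3
    have "(V has_real_derivative 0) (at s)"
    proof (rule DERIV_0_I)
      show "V s = 0" using 3 by (simp add: V_def)
      fix e :: real assume "e > 0"
      define Y where "Y = (p - 1) * 2 powr q / e"
      have Y: "Y > 0" using \<open>e > 0\<close> p by (simp add: Y_def)
      obtain d where d: "d > 0" "d \<le> len" "\<And>s. len - d < \<bar>s\<bar> \<Longrightarrow> \<bar>s\<bar> < len \<Longrightarrow> \<bar>w s\<bar> \<ge> Y"
        using w_large_near_end[OF Y] by blast
      have "\<bar>V t\<bar> \<le> e * \<bar>t - s\<bar>" if "\<bar>t - s\<bar> < d" for t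
      proof (cases "\<bar>t\<bar> < len")
        case True
        then have "\<bar>w t\<bar> \<ge> Y" using that 3 by (intro d(3)) auto
        then have "V t \<le> (p - 1) * 2 powr q / Y * (len - \<bar>t\<bar>)" by (rule V_le_dist[OF True _ Y])
        also have "(p - 1) * 2 powr q / Y = e" using p \<open>e > 0\<close> by (simp add: Y_def)
        also have "e * (len - \<bar>t\<bar>) \<le> e * \<bar>t - s\<bar>" using 3 \<open>e > 0\<close> by (intro mult_left_mono) auto
        finally show ?thesis using V_nonneg[of t] by simp
      qed (use \<open>e > 0\<close> in \<open>simp add: V_def\<close>)
      then show "\<exists>d>0. \<forall>t. \<bar>t - s\<bar> < d \<longrightarrow> \<bar>V t\<bar> \<le> e * \<bar>t - s\<bar>" using d(1) by blast
    qed
    then show ?thesis using 3 by (simp add: V'_def V_def)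
  qed
qed

lemma V_decay: "\<bar>s\<bar> < len \<Longrightarrow> \<bar>w s\<bar> \<ge> Y \<Longrightarrow> Y \<ge> 1 \<Longrightarrow> V s * \<bar>w s\<bar> powr (q - 1) \<le> 1 / Y"
proof -
  assume s: "\<bar>s\<bar> < len" and Y: "\<bar>w s\<bar> \<ge> Y" "Y \<ge> 1"
  have "Y * (V s * \<bar>w s\<bar> powr (q - 1)) \<le> \<bar>w s\<bar> * (V s * \<bar>w s\<bar> powr (q - 1))"
    using Y V_nonneg by (intro mult_right_mono) auto
  also have "\<dots> = \<bar>w s\<bar> powr q * V s" using Y by (simp add: powr_diff)
  also have "\<dots> \<le> 1" using V_mult[OF s] V_nonneg[of s] by simp
  finally show ?thesis using Y by (simp add: field_simps)
qed

text \<open>Common to \<open>V'\<close> and \<open>F\<close>: near the ends both are bounded by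
  \<open>C / |w|\<close>, and \<open>|w|\<close> eventually exceeds every \<open>Y\<close>.\<close>

lemma continuous_at_end:
  fixes f :: "real \<Rightarrow> real"
  assumes "\<bar>s\<bar> = len" "\<And>t. \<bar>t\<bar> \<ge> len \<Longrightarrow> f t = 0"
    "\<And>t Y. \<bar>t\<bar> < len \<Longrightarrow> \<bar>w t\<bar> \<ge> Y \<Longrightarrow> Y \<ge> 1 \<Longrightarrow> \<bar>f t\<bar> \<le> C / Y"
  shows "isCont f s"
  unfolding isCont_def LIM_eq
proof (intro allI impI)
  fix e :: real assume e: "e > 0"
  define Y where "Y = max 1 (2 * \<bar>C\<bar> / e)"
  have Y: "Y \<ge> 1" "Y > 0" by (auto simp: Y_def)
  obtain d where d: "d > 0" "d \<le> len" "\<And>s. len - d < \<bar>s\<bar> \<Longrightarrow> \<bar>s\<bar> < len \<Longrightarrow> \<bar>w s\<bar> \<ge> Y"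
    using w_large_near_end[OF Y(2)] by blast
  have "\<bar>f t\<bar> < e" if "\<bar>t - s\<bar> < d" for t
  proof (cases "\<bar>t\<bar> < len")
    case True
    then have "\<bar>w t\<bar> \<ge> Y" using that assms(1) by (intro d(3)) auto
    then have "\<bar>f t\<bar> \<le> C / Y" using assms(3) True Y by blast
    also have "C / Y \<le> \<bar>C\<bar> / Y" using Y by (intro divide_right_mono) auto
    also have "\<bar>C\<bar> / Y \<le> e / 2"
    proof -
      have "2 * \<bar>C\<bar> / e \<le> Y" by (simp add: Y_def)
      then have "2 * \<bar>C\<bar> \<le> Y * e" using e by (simp add: pos_divide_le_eq)
      then show ?thesis using Y by (simp add: field_simps)
    qed
    finally show ?thesis using e by linarith
  qed (use assms(2) e in simp)
  then show "\<exists>d>0. \<forall>x. x \<noteq> s \<and> norm (x - s) < d \<longrightarrow> norm (f x - f s) < e"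
    using d(1) assms(1,2) by auto
qed

lemma isCont_V: "isCont V s"
  using DERIV_V DERIV_isCont by blast

lemma continuous_on_V [continuous_intros]:
  "continuous_on S f \<Longrightarrow> continuous_on S (\<lambda>x. V (f x))"
  by (rule continuous_on_compose2[of UNIV V]) (auto intro: continuous_at_imp_continuous_on isCont_V)

lemma isCont_w: "\<bar>s\<bar> < len \<Longrightarrow> isCont w s"
  using DERIV_w DERIV_isCont by blast

lemma isCont_V': "isCont V' s"
proof -
  consider "\<bar>s\<bar> < len" | "\<bar>s\<bar> > len" | "\<bar>s\<bar> = len" by linarith
  then show ?thesis
  proof cases
    case 1
    have "isCont (\<lambda>s. p_power q (w s)) s"
      by (rule isCont_o2[OF isCont_w[OF 1] isCont_p_power]) (use q_gt_2 in simp)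
    then show ?thesis unfolding V'_def by (intro continuous_intros isCont_V)
  next
    case 2
    have "isCont (\<lambda>s. 0::real) s" by simp
    moreover have "\<forall>\<^sub>F x in nhds s. V' x = 0"
      by (rule eventually_mono[OF eventually_nhds_in_open[of "- cball 0 len" s]])
        (use 2 in \<open>auto simp: V'_def V_def\<close>)
    ultimately show ?thesis using isCont_cong[of V' "\<lambda>s. 0" s] by simp
  next
    case 3
    then show ?thesis
    proof (rule continuous_at_end[where C=p])
      show "V' t = 0" if "\<bar>t\<bar> \<ge> len" for t using that by (simp add: V'_def V_def)
      show "\<bar>V' t\<bar> \<le> p / Y" if "\<bar>t\<bar> < len" "\<bar>w t\<bar> \<ge> Y" "Y \<ge> 1" for t Y
      proof -
        have "\<bar>V' t\<bar> = p * (V t * \<bar>w t\<bar> powr (q - 1))"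
          using p V_nonneg[of t] norm_p_power[of q "w t"] by (simp add: V'_def abs_mult)
        also have "\<dots> \<le> p * (1 / Y)" using V_decay[OF that] p by (intro mult_left_mono) auto
        finally show ?thesis by simp
      qed
    qed
  qed
qed

lemma continuous_on_V' [continuous_intros]:
  "continuous_on S f \<Longrightarrow> continuous_on S (\<lambda>x. V' (f x))"
  by (rule continuous_on_compose2[of UNIV V']) (auto intro: continuous_at_imp_continuous_on isCont_V')

text \<open>In terms of \<open>v\<close> this is \<open>|v'|^(p-2) v' v\<close>, the flux of the
  equation tested with \<open>v\<close>. Its derivative stays bounded up to the ends although
  \<open>w\<close> does not.\<close>

definition F :: "real \<Rightarrow> real" where "F s = w s * V s"

lemma DERIV_F: "\<bar>s\<bar> < len \<Longrightarrow> (F has_real_derivative 1 - p * V s) (at s)"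
proof -
  assume s: "\<bar>s\<bar> < len"
  have "(F has_real_derivative - ((p - 1) * (1 + \<bar>w s\<bar> powr q)) * V s + V' s * w s) (at s)"
    unfolding F_def[abs_def] by (intro DERIV_mult DERIV_w DERIV_V s)
  also have "- ((p - 1) * (1 + \<bar>w s\<bar> powr q)) * V s = - (p - 1)"
  proof -
    have "(1 + \<bar>w s\<bar> powr q) * V s = 1" using V_mult[OF s] by (simp add: algebra_simps)
    then show ?thesis by (metis mult.assoc mult.right_neutral mult_minus_left)
  qed
  also have "V' s * w s = p * (\<bar>w s\<bar> powr q * V s)"
    using p_power_inner_self[of q "w s"] by (simp add: V'_def)
  also have "\<dots> = p - p * V s" by (simp only: V_mult[OF s] right_diff_distrib mult_1_right)
  finally show ?thesis by simp
qed

lemma F_eq_0: "\<bar>s\<bar> \<ge> len \<Longrightarrow> F s = 0"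
  by (simp add: F_def V_def)

lemma DERIV_F_outside: "\<bar>s\<bar> > len \<Longrightarrow> (F has_real_derivative 0) (at s)"
proof -
  assume s: "\<bar>s\<bar> > len"
  have "((\<lambda>s. 0) has_real_derivative 0) (at s)" by simp
  then show ?thesis
    by (rule has_field_derivative_transform_within_open[where S="- cball 0 len"])
      (use s in \<open>auto simp: F_eq_0\<close>)
qed

lemma isCont_F: "isCont F s"
proof -
  consider "\<bar>s\<bar> < len" | "\<bar>s\<bar> > len" | "\<bar>s\<bar> = len" by linarith
  then show ?thesis
  proof cases
    case 3
    then show ?thesis
    proof (rule continuous_at_end[where C=1])
      show "\<bar>F t\<bar> \<le> 1 / Y" if "\<bar>t\<bar> < len" "\<bar>w t\<bar> \<ge> Y" "Y \<ge> 1" for t Y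
      proof -
        have "\<bar>w t\<bar> powr 1 \<le> \<bar>w t\<bar> powr (q - 1)" using that q_gt_2 by (intro powr_mono) auto
        then have "V t * \<bar>w t\<bar> \<le> V t * \<bar>w t\<bar> powr (q - 1)"
          using that V_nonneg[of t] by (intro mult_left_mono) auto
        then show ?thesis using V_decay[OF that] V_nonneg[of t] by (simp add: F_def abs_mult mult.commute)
      qed
    qed (rule F_eq_0)
  qed (use DERIV_F DERIV_F_outside DERIV_isCont in blast)+
qed

text \<open>The derivative \<open>1 - p * V\<close> tends to 1 at the ends from inside and is 0
  outside, so \<open>F\<close> has corners there. A Lipschitz bound survives: clamping the arguments
  to \<open>[-len, len]\<close> reduces it to the mean value theorem inside.\<close>

lemma F_lipschitz: "\<bar>F s - F t\<bar> \<le> (1 + p) * \<bar>s - t\<bar>"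
proof -
  have inside: "\<bar>F b - F a\<bar> \<le> (1 + p) * (b - a)" if ab: "- len \<le> a" "a < b" "b \<le> len" for a b
  proof -
    obtain z where z: "a < z" "z < b" "F b - F a = (b - a) * (1 - p * V z)"
      using mvt[OF ab(2), of F "\<lambda>x h. h * (1 - p * V x)"] ab isCont_F DERIV_F
      by (auto simp: has_field_derivative_def mult_commute_abs continuous_at_imp_continuous_on)
    have "\<bar>1 - p * V z\<bar> \<le> 1 + p"
    proof -
      have "0 \<le> p * V z" "p * V z \<le> p" using V_nonneg[of z] V_le_1[of z] p by auto
      then show ?thesis by linarith
    qed
    then have "(b - a) * \<bar>1 - p * V z\<bar> \<le> (b - a) * (1 + p)" using ab by (intro mult_left_mono) auto
    then show ?thesis using z(3) ab by (simp add: abs_mult mult.commute)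
  qed
  define c where "c x = max (- len) (min len x)" for x
  have Fc: "F x = F (c x)" for x
    using len_pos by (cases "\<bar>x\<bar> \<le> len") (auto simp: c_def F_eq_0 min_def max_def)
  have cb: "- len \<le> c x" "c x \<le> len" for x using len_pos by (auto simp: c_def)
  have c1: "\<bar>c x - c y\<bar> \<le> \<bar>x - y\<bar>" for x y by (auto simp: c_def)
  have "\<bar>F (c s) - F (c t)\<bar> \<le> (1 + p) * \<bar>c s - c t\<bar>"
  proof (cases "c s" "c t" rule: linorder_cases)
    case less
    then show ?thesis using inside[of "c s" "c t"] cb by (simp add: abs_minus_commute)
  next
    case greater
    then show ?thesis using inside[of "c t" "c s"] cb by simp
  qed auto
  also have "\<dots> \<le> (1 + p) * \<bar>s - t\<bar>" using c1 p by (intro mult_left_mono) auto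
  finally show ?thesis using Fc by simp
qed

end

section \<open>The fundamental lemma of the calculus of variations\<close>

lemma continuous_on_mult_compact_support:
  fixes \<eta> :: "'a::euclidean_space \<Rightarrow> real" and f :: "'a \<Rightarrow> 'b::euclidean_space"
  assumes "continuous_on UNIV \<eta>" "compact S" "S \<subseteq> \<Omega>" "\<And>x. x \<notin> S \<Longrightarrow> \<eta> x = 0"
    and "open \<Omega>" "continuous_on \<Omega> f"
  shows "continuous_on UNIV (\<lambda>x. \<eta> x *\<^sub>R f x)"
proof -
  have c1: "continuous_on \<Omega> (\<lambda>x. \<eta> x *\<^sub>R f x)"
    using assms by (intro continuous_intros) (auto intro: continuous_on_subset)
  have c2: "continuous_on (- S) (\<lambda>x. \<eta> x *\<^sub>R f x)"
    by (rule continuous_on_eq[of _ "\<lambda>x. 0"]) (use assms in auto)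
  have "\<Omega> \<union> - S = UNIV" using assms(3) by auto
  then show ?thesis
    using continuous_on_open_Un[OF assms(5) _ c1 c2] assms(2) by (simp add: compact_imp_closed open_Compl)
qed

lemma integrable_lebesgue_indicator_compact:
  "compact K \<Longrightarrow> integrable lebesgue (\<lambda>x. c * indicator K x :: real)"
  using fmeasurableD2[OF lmeasurable_compact, of K] fmeasurableD[OF lmeasurable_compact, of K]
  by (intro integrable_mult_right integrable_real_indicator) (auto simp: less_top)

text \<open>The indicator of \<open>K\<close> is the pointwise limit of hat functions of the
  distance to \<open>K\<close>, and each hat is a uniform limit of test functions; both limits pass
  through the integral by domination with \<open>h\<close> on a compact set.\<close>

lemma integral_eq_0_compact:
  fixes h :: "'a::euclidean_space \<Rightarrow> real"
  assumes \<Omega>: "open \<Omega>" and [measurable]: "h \<in> borel_measurable lebesgue"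
    and int: "\<And>K. compact K \<Longrightarrow> K \<subseteq> \<Omega> \<Longrightarrow> integrable lebesgue (\<lambda>x. indicator K x * h x)"
    and zero: "\<And>\<phi>. test_function \<Omega> \<phi> \<Longrightarrow> (\<integral>x. h x * \<phi> x \<partial>lebesgue) = 0"
    and K: "compact K" "K \<subseteq> \<Omega>" "K \<noteq> {}"
  shows "(\<integral>x. indicator K x * h x \<partial>lebesgue) = 0"
proof -
  obtain T r where T: "compact T" "T \<subseteq> \<Omega>" "K \<subseteq> T" "r > 0" "\<And>x y. y \<in> K \<Longrightarrow> dist y x < r \<Longrightarrow> x \<in> T"
    using compact_neighbourhood_support[OF K(1) \<Omega> K(2)] by metis
  \<comment> \<open>The slope is at least \<open>1 / r\<close>, so the hat vanishes off the
    \<open>r\<close>-neighbourhood of \<open>K\<close>, which lies in \<open>T\<close>.\<close>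
  define f where "f n x = max 0 (1 - real (Suc n) / r * infdist x K)" for n x
  have fc: "continuous_on UNIV (f n)" for n unfolding f_def by (intro continuous_intros)
  have f01: "0 \<le> f n x" "f n x \<le> 1" for n x
    using T(4) infdist_nonneg[of x K] by (auto simp: f_def)
  have f0: "f n x = 0" if "x \<notin> T" for n x
  proof -
    obtain y where y: "y \<in> K" "infdist x K = dist x y"
      using infdist_attains_inf[OF compact_imp_closed[OF K(1)] K(3)] by metis
    have "r \<le> infdist x K" using T(5)[OF y(1), of x] that y(2) by (force simp: dist_commute)
    then have "1 * 1 \<le> real (Suc n) * (infdist x K / r)" using T(4) by (intro mult_mono) auto
    then show ?thesis by (simp add: f_def)
  qed
  have "(\<integral>x. h x * f n x \<partial>lebesgue) = 0" for n
  proof -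
    obtain \<phi> T' where T': "compact T'" "T' \<subseteq> \<Omega>" "T \<subseteq> T'" and \<phi>: "\<And>n::nat. test_function \<Omega> (\<phi> n)"
      "\<And>n x. x \<notin> T' \<Longrightarrow> \<phi> n x = 0"
      and close: "\<And>e. e > 0 \<Longrightarrow> \<forall>\<^sub>F m in sequentially. \<forall>x. \<bar>\<phi> m x - f n x\<bar> \<le> e"
      by (rule C0_compact_approx_test_functions[OF \<Omega> fc T(1,2) f0]) blast+
    have b\<phi>[measurable]: "\<phi> m \<in> borel_measurable lebesgue" for m
      using C1_compact_borel(1)[OF test_function_imp_C1_compact[OF \<phi>(1)]] by (intro measurable_completion) simp
    have bf[measurable]: "f n \<in> borel_measurable lebesgue"
      using fc by (intro measurable_completion) (simp add: borel_measurable_continuous_onI)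
    have w: "integrable lebesgue (\<lambda>x. 2 * norm (indicator T' x * h x))" using int[OF T'(1,2)] by simp
    from close[of 1] obtain N where N: "\<And>m x. m \<ge> N \<Longrightarrow> \<bar>\<phi> m x - f n x\<bar> \<le> 1"
      by (auto simp: eventually_sequentially)
    have "(\<lambda>m. \<integral>x. h x * \<phi> (m + N) x \<partial>lebesgue) \<longlonglongrightarrow> (\<integral>x. h x * f n x \<partial>lebesgue)"
    proof (rule integral_dominated_convergence[OF _ _ w])
      have "(\<lambda>m. \<phi> m x) \<longlonglongrightarrow> f n x" for x
      proof (rule LIMSEQ_I)
        fix e :: real assume "e > 0"
        then obtain N where N: "\<forall>m\<ge>N. \<forall>x. \<bar>\<phi> m x - f n x\<bar> \<le> e / 2"
          using close[of "e / 2"] by (auto simp: eventually_sequentially)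
        have "norm (\<phi> m x - f n x) < e" if "m \<ge> N" for m
          using N[rule_format, OF that, of x] \<open>e > 0\<close> by simp
        then show "\<exists>no. \<forall>m\<ge>no. norm (\<phi> m x - f n x) < e" by blast
      qed
      then show "AE x in lebesgue. (\<lambda>m. h x * \<phi> (m + N) x) \<longlonglongrightarrow> h x * f n x"
        by (intro AE_I2 tendsto_mult tendsto_const LIMSEQ_ignore_initial_segment)
      have "\<bar>\<phi> (m + N) x\<bar> \<le> 2 * indicator T' x" for m x
        using N[of "m + N" x] f01[of n x] \<phi>(2)[of x "m + N"] by (cases "x \<in> T'") auto
      then have "\<bar>h x\<bar> * \<bar>\<phi> (m + N) x\<bar> \<le> \<bar>h x\<bar> * (2 * indicator T' x)" for m x
        by (intro mult_left_mono) auto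
      then show "AE x in lebesgue. norm (h x * \<phi> (m + N) x) \<le> 2 * norm (indicator T' x * h x)" for m
        by (simp add: abs_mult mult_ac)
    qed auto
    then show ?thesis using zero[OF \<phi>(1)] by (simp add: LIMSEQ_const_iff)
  qed
  moreover have "(\<lambda>n. \<integral>x. h x * f n x \<partial>lebesgue) \<longlonglongrightarrow> (\<integral>x. indicator K x * h x \<partial>lebesgue)"
  proof (rule integral_dominated_convergence)
    show "integrable lebesgue (\<lambda>x. norm (indicator T x * h x))" using int[OF T(1,2)] by simp
    show [measurable]: "(\<lambda>x. h x * f n x) \<in> borel_measurable lebesgue" for n
      by (intro borel_measurable_times assms(2) measurable_completion) (simp add: borel_measurable_continuous_onI fc)
    show "(\<lambda>x. indicator K x * h x) \<in> borel_measurable lebesgue"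
      using int[OF K(1,2)] by blast
    show "AE x in lebesgue. norm (h x * f n x) \<le> norm (indicator T x * h x)" for n
      using f01 f0 by (intro AE_I2) (auto simp: indicator_def abs_mult mult_left_le)
    have "(\<lambda>n. f n x) \<longlonglongrightarrow> indicator K x" for x
    proof (cases "x \<in> K")
      case False
      define d where "d = infdist x K / r"
      have "infdist x K \<noteq> 0" using in_closed_iff_infdist_zero[OF compact_imp_closed[OF K(1)] K(3)] False by simp
      then have "d > 0" using infdist_nonneg[of x K] T(4) by (simp add: d_def)
      then obtain N where N: "1 < real N * d" using reals_Archimedean3 by blast
      have "f n x = 0" if "n \<ge> N" for n
      proof -
        have "real N * d \<le> real (Suc n) * d" using that \<open>d > 0\<close> by (intro mult_right_mono) auto
        then show ?thesis using N by (simp add: f_def d_def)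
      qed
      then show ?thesis using False by (intro tendsto_eventually) (auto simp: eventually_sequentially)
    qed (simp add: f_def)
    then show "AE x in lebesgue. (\<lambda>n. h x * f n x) \<longlonglongrightarrow> indicator K x * h x"
      by (subst mult.commute) (intro AE_I2 tendsto_mult tendsto_const)
  qed
  ultimately show ?thesis by (simp add: LIMSEQ_const_iff)
qed

text \<open>Inner regularity by closed sets, which are exhausted by their compact intersections with
  balls.\<close>

lemma null_set_if_compact_subsets_null:
  fixes P :: "'a::euclidean_space set"
  assumes P: "P \<in> sets lebesgue" and null: "\<And>K. compact K \<Longrightarrow> K \<subseteq> P \<Longrightarrow> emeasure lebesgue K = 0"
  shows "P \<in> null_sets lebesgue"
proof -
  have "emeasure lebesgue P \<le> ennreal e" if "e > 0" for e
  proof -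
    obtain T where T: "closed T" "T \<subseteq> P" "P - T \<in> lmeasurable" "emeasure lebesgue (P - T) < ennreal e"
      using sets_lebesgue_inner_closed[OF P \<open>e > 0\<close>] by blast
    have "T = (\<Union>n::nat. T \<inter> cball 0 (real n))"
      using real_arch_simple by (auto simp: mem_cball_0)
    moreover have "(\<Union>n::nat. T \<inter> cball 0 (real n)) \<in> null_sets lebesgue"
    proof (rule null_sets_UN)
      fix n :: nat
      have c: "compact (T \<inter> cball 0 (real n))" using T(1) by (simp add: closed_Int_compact)
      show "T \<inter> cball 0 (real n) \<in> null_sets lebesgue"
        by (intro null_setsI null c fmeasurableD lmeasurable_compact) (use T in auto)
    qed
    ultimately have 0: "emeasure lebesgue T = 0" and m: "T \<in> sets lebesgue" by auto
    have "emeasure lebesgue P = emeasure lebesgue (T \<union> (P - T))" using T(2) by (simp add: Un_absorb1)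
    also have "\<dots> \<le> emeasure lebesgue T + emeasure lebesgue (P - T)"
      using m T(3) by (intro emeasure_subadditive) auto
    finally show ?thesis using 0 T(4) by simp
  qed
  then have "emeasure lebesgue P \<le> 0 + ennreal e" if "e > 0" for e using that by simp
  then have "emeasure lebesgue P \<le> 0" by (rule ennreal_le_epsilon)
  then show ?thesis using P by (auto intro: null_setsI)
qed

text \<open>Test functions determine the integrals over compact sets; on a compact subset of the set
  where \<open>c * h\<close> is positive the integral vanishes, so that subset is null. The signs
  \<open>c = 1\<close> and \<open>c = -1\<close> are treated alike.\<close>

lemma fundamental_lemma_calculus_of_variations:
  fixes h :: "'a::euclidean_space \<Rightarrow> real"
  assumes \<Omega>: "open \<Omega>" and h: "h \<in> borel_measurable lebesgue"
    and int: "\<And>K. compact K \<Longrightarrow> K \<subseteq> \<Omega> \<Longrightarrow> integrable lebesgue (\<lambda>x. indicator K x * h x)"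
    and zero: "\<And>\<phi>. test_function \<Omega> \<phi> \<Longrightarrow> (\<integral>x. h x * \<phi> x \<partial>lebesgue) = 0"
  shows "AE x in lebesgue. x \<in> \<Omega> \<longrightarrow> h x = 0"
proof -
  have half: "AE x in lebesgue. x \<in> \<Omega> \<longrightarrow> \<not> c * h x > 0" if c: "\<bar>c\<bar> = 1" for c
  proof -
    note [measurable] = h
    let ?P = "{x. x \<in> \<Omega> \<and> c * h x > 0}"
    have \<Omega>s[measurable]: "\<Omega> \<in> sets lebesgue" using \<Omega> by (simp add: borel_open)
    have P: "?P \<in> sets lebesgue"
    proof -
      have "{x \<in> space lebesgue. x \<in> \<Omega> \<and> c * h x > 0} \<in> sets lebesgue" by measurable
      then show ?thesis by simp
    qed
    have "?P \<in> null_sets lebesgue"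
    proof (rule null_set_if_compact_subsets_null[OF P])
      fix K assume K: "compact K" "K \<subseteq> ?P"
      then have K': "K \<subseteq> \<Omega>" by auto
      have Ks: "K \<in> sets lebesgue" using K(1) fmeasurableD lmeasurable_compact by blast
      have i: "integrable lebesgue (\<lambda>x. c * (indicator K x * h x))"
        by (intro integrable_mult_right int K K')
      have "(\<integral>x. c * (indicator K x * h x) \<partial>lebesgue) = 0"
        using integral_eq_0_compact[OF \<Omega> h int zero K(1) K'] by (cases "K = {}") simp_all
      moreover have "0 \<le> c * (indicator K x * h x)" for x
        using K(2) by (auto simp: indicator_def intro: less_imp_le)
      ultimately have "AE x in lebesgue. c * (indicator K x * h x) = 0"
        using integral_nonneg_eq_0_iff_AE[OF i] by simp
      then have "AE x in lebesgue. x \<notin> K"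
        by eventually_elim (use K(2) in \<open>auto simp: indicator_def split: if_splits\<close>)
      then show "emeasure lebesgue K = 0" using AE_iff_null_sets[OF Ks] by auto
    qed
    then have "AE x in lebesgue. x \<notin> ?P" by (rule AE_not_in)
    then show ?thesis by eventually_elim auto
  qed
  from half[of 1, simplified] half[of "- 1", simplified] show ?thesis by eventually_elim force
qed

section \<open>Functions in \<open>L\<^sup>p\<close>\<close>

text \<open>Multiplication by the indicator replaces the junk values of \<open>f\<close> outside \<open>\<Omega>\<close> by \<open>0\<close>, so that
  all integrals become integrals over the whole space.\<close>

abbreviation cut :: "'a::euclidean_space set \<Rightarrow> ('a \<Rightarrow> 'b::euclidean_space) \<Rightarrow> 'a \<Rightarrow> 'b" where
  "cut \<Omega> f x \<equiv> indicator \<Omega> x *\<^sub>R f x"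

lemma norm_cut_powr: "norm (cut \<Omega> f x) powr p = indicator \<Omega> x *\<^sub>R (norm (f x) powr p)"
  by (simp add: indicator_def)

lemma Lp_pow_cut: "Lp_pow p \<Omega> f = (\<integral>x. norm (cut \<Omega> f x) powr p \<partial>lebesgue)"
  unfolding Lp_pow_def set_lebesgue_integral_def norm_cut_powr ..

lemma in_Lp_cut:
  "in_Lp p \<Omega> f \<longleftrightarrow> cut \<Omega> f \<in> borel_measurable lebesgue \<and> integrable lebesgue (\<lambda>x. norm (cut \<Omega> f x) powr p)"
  unfolding in_Lp_def set_borel_measurable_def set_integrable_def norm_cut_powr ..

lemma Lp_pow_nonneg: "Lp_pow p \<Omega> f \<ge> 0"
  unfolding Lp_pow_cut by (rule Bochner_Integration.integral_nonneg) simp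

lemma norm_add_powr_le_const:
  fixes a b :: "'a::real_normed_vector"
  assumes "p \<ge> 0"
  shows "norm (a + b) powr p \<le> 2 powr p * (norm a powr p + norm b powr p)"
proof -
  have "norm (a + b) powr p \<le> (2 * max (norm a) (norm b)) powr p"
    using norm_triangle_ineq[of a b] assms by (intro powr_mono2) auto
  also have "\<dots> = 2 powr p * max (norm a) (norm b) powr p" by (simp add: powr_mult)
  also have "\<dots> \<le> 2 powr p * (norm a powr p + norm b powr p)"
    by (intro mult_left_mono) (auto simp: max_def)
  finally show ?thesis .
qed

lemma in_Lp_add:
  assumes "p \<ge> 0" "in_Lp p \<Omega> f" "in_Lp p \<Omega> g"
  shows "in_Lp p \<Omega> (\<lambda>x. f x + g x)"
proof -
  have [measurable]: "cut \<Omega> f \<in> borel_measurable lebesgue" "cut \<Omega> g \<in> borel_measurable lebesgue"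
    and i: "integrable lebesgue (\<lambda>x. 2 powr p * (norm (cut \<Omega> f x) powr p + norm (cut \<Omega> g x) powr p))"
    using assms unfolding in_Lp_cut by auto
  have e: "cut \<Omega> (\<lambda>x. f x + g x) = (\<lambda>x. cut \<Omega> f x + cut \<Omega> g x)" by (simp add: scaleR_add_right)
  have m: "cut \<Omega> (\<lambda>x. f x + g x) \<in> borel_measurable lebesgue" unfolding e by simp
  show ?thesis unfolding in_Lp_cut
  proof (intro conjI m Bochner_Integration.integrable_bound[OF i])
    show "(\<lambda>x. norm (cut \<Omega> (\<lambda>x. f x + g x) x) powr p) \<in> borel_measurable lebesgue" using m by measurable
    show "AE x in lebesgue. norm (norm (cut \<Omega> (\<lambda>x. f x + g x) x) powr p) \<le>
        norm (2 powr p * (norm (cut \<Omega> f x) powr p + norm (cut \<Omega> g x) powr p))"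
      unfolding fun_cong[OF e] real_norm_def abs_of_nonneg[OF powr_ge_zero]
      by (intro AE_I2 order_trans[OF norm_add_powr_le_const[OF assms(1)] abs_ge_self])
  qed
qed

lemma in_Lp_continuous_compact:
  fixes f :: "'a::euclidean_space \<Rightarrow> 'b::euclidean_space"
  assumes "continuous_on UNIV f" "compact S" "S \<subseteq> \<Omega>" "\<And>x. x \<notin> S \<Longrightarrow> f x = 0" "p > 0"
  shows "in_Lp p \<Omega> f" "cut \<Omega> f = f"
proof -
  show c: "cut \<Omega> f = f" using assms by (auto simp: indicator_def fun_eq_iff)
  have "continuous_on UNIV (\<lambda>x. norm (f x) powr p)"
    using assms(1,5) by (intro continuous_on_powr') (auto intro!: continuous_intros)
  then have "integrable lebesgue (\<lambda>x. norm (f x) powr p)"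
    by (rule integrable_lebesgue_compact_support[OF _ assms(2)]) (simp add: assms(4))
  moreover have "f \<in> borel_measurable lebesgue"
    by (rule borel_measurable_integrable[OF integrable_lebesgue_compact_support[OF assms(1,2,4)]])
  ultimately show "in_Lp p \<Omega> f" unfolding in_Lp_cut fun_cong[OF c] c by simp
qed

lemma integrable_Lp_mult_bounded:
  fixes f :: "'a::euclidean_space \<Rightarrow> 'b::euclidean_space" and g :: "'a \<Rightarrow> real"
  assumes p: "p \<ge> 1" and f: "f \<in> borel_measurable lebesgue" "integrable lebesgue (\<lambda>x. norm (f x) powr p)"
    and S: "compact S" and g: "g \<in> borel_measurable lebesgue"
    and le: "\<And>x. \<bar>g x\<bar> \<le> C * (1 + norm (f x) powr p) * indicator S x"
  shows "integrable lebesgue g"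
proof -
  have "\<bar>g x\<bar> \<le> \<bar>C\<bar> * indicator S x + \<bar>C\<bar> * norm (f x) powr p" for x
  proof -
    have "C * (1 + norm (f x) powr p) \<le> \<bar>C\<bar> * (1 + norm (f x) powr p)" by (intro mult_right_mono) auto
    then show ?thesis using le[of x] by (cases "x \<in> S") (auto simp: algebra_simps)
  qed
  moreover have "integrable lebesgue (\<lambda>x. \<bar>C\<bar> * indicator S x + \<bar>C\<bar> * norm (f x) powr p)"
    using f(2) S by (intro Bochner_Integration.integrable_add integrable_lebesgue_indicator_compact) auto
  ultimately show ?thesis using g
    by (intro Bochner_Integration.integrable_bound[where g=g]) (auto intro!: AE_I2 order_trans[OF _ abs_ge_self])
qed

lemma powr_le_1_add_powr: "0 \<le> x \<Longrightarrow> 0 < s \<Longrightarrow> s \<le> p \<Longrightarrow> x powr s \<le> 1 + x powr p" for x :: real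
proof (cases "x \<le> 1")
  case True
  assume "0 \<le> x" "0 < s"
  then have "x powr s \<le> 1" using True by (intro powr_le1) auto
  then show ?thesis by (simp add: add_increasing2)
next
  case False
  assume "s \<le> p"
  then have "x powr s \<le> x powr p" using False by (intro powr_mono) auto
  then show ?thesis by simp
qed

text \<open>A substitute for Minkowski's inequality in limits: the factor of \<open>|a|^p\<close> is
  as close to 1 as desired, while the constant before the small term \<open>|h|^p\<close> may be
  large. The linear term is absorbed by comparing \<open>p |h|\<close> with
  \<open>d |a|\<close>.\<close>

lemma norm_powr_diff_le:
  fixes a h :: "'a::euclidean_space"
  assumes p: "1 < p" "p \<le> 2" and d: "d > 0"
  obtains C where "C \<ge> 0"
    "\<And>a h :: 'a. norm (a + h) powr p \<le> (1 + d) * norm a powr p + C * norm h powr p"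
proof
  define c where "c = p * (p / d) powr (p - 1)"
  show "c + 2 powr p + p \<ge> 0" using p d by (simp add: c_def)
  fix a h :: 'a
  have "p * (p_power p a \<bullet> h) \<le> p * (norm a powr (p - 1) * norm h)"
    using p norm_cauchy_schwarz[of "p_power p a" h] by (simp add: norm_p_power)
  also have "\<dots> \<le> d * norm a powr p + c * norm h powr p"
  proof (cases "p * norm h \<le> d * norm a")
    case True
    have "norm a powr (p - 1) * (p * norm h) \<le> norm a powr (p - 1) * (d * norm a)"
      using True by (intro mult_left_mono) auto
    also have "\<dots> = d * norm a powr p" by (cases "a = 0") (auto simp: powr_diff)
    finally have "p * (norm a powr (p - 1) * norm h) \<le> d * norm a powr p" by (simp add: ac_simps)
    moreover have "c * norm h powr p \<ge> 0" using p by (simp add: c_def)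
    ultimately show ?thesis by linarith
  next
    case False
    then have "norm a \<le> p / d * norm h" using d by (simp add: field_simps)
    then have "norm a powr (p - 1) \<le> (p / d * norm h) powr (p - 1)" using p by (intro powr_mono2) auto
    then have "p * (norm a powr (p - 1) * norm h) \<le> p * ((p / d * norm h) powr (p - 1) * norm h)"
      using p by (intro mult_left_mono mult_right_mono) auto
    also have "\<dots> = c * (norm h powr (p - 1) * norm h)" using p d by (subst powr_mult) (auto simp: c_def)
    also have "norm h powr (p - 1) * norm h = norm h powr p" by (cases "h = 0") (auto simp: powr_diff)
    finally show ?thesis using d by (simp add: add_increasing)
  qed
  finally show "norm (a + h) powr p \<le> (1 + d) * norm a powr p + (c + 2 powr p + p) * norm h powr p"
    using norm_add_powr_le[OF p, of a h] by (simp add: algebra_simps)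
qed

lemma Lp_pow_tendsto:
  fixes f :: "'a::euclidean_space \<Rightarrow> 'b::euclidean_space"
  assumes p: "1 < p" "p \<le> 2" and f: "in_Lp p \<Omega> f" and g: "\<And>n. in_Lp p \<Omega> (g n)"
    and lim: "(\<lambda>n. Lp_pow p \<Omega> (\<lambda>x. g n x - f x)) \<longlonglongrightarrow> 0"
  shows "(\<lambda>n. Lp_pow p \<Omega> (g n)) \<longlonglongrightarrow> Lp_pow p \<Omega> f"
proof -
  have le: "\<exists>C\<ge>0. \<forall>f g. in_Lp p \<Omega> f \<longrightarrow> in_Lp p \<Omega> g \<longrightarrow>
      Lp_pow p \<Omega> g \<le> (1 + d) * Lp_pow p \<Omega> f + C * Lp_pow p \<Omega> (\<lambda>x. g x - f x :: 'b)"
    if d: "d > 0" for d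
  proof -
    obtain C where C: "C \<ge> 0" "\<And>a h :: 'b. norm (a + h) powr p \<le> (1 + d) * norm a powr p + C * norm h powr p"
      using norm_powr_diff_le[OF p d] by metis
    have "Lp_pow p \<Omega> g \<le> (1 + d) * Lp_pow p \<Omega> f + C * Lp_pow p \<Omega> (\<lambda>x. g x - f x)"
      if fg: "in_Lp p \<Omega> f" "in_Lp p \<Omega> g" for f g :: "'a \<Rightarrow> 'b"
    proof -
      have "in_Lp p \<Omega> (\<lambda>x. - f x)" using fg(1) by (simp add: in_Lp_cut)
      then have "in_Lp p \<Omega> (\<lambda>x. g x - f x)" using in_Lp_add[of p \<Omega> g "\<lambda>x. - f x"] fg(2) p by simp
      then have i: "integrable lebesgue (\<lambda>x. norm (cut \<Omega> (\<lambda>x. g x - f x) x) powr p)"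
        "integrable lebesgue (\<lambda>x. norm (cut \<Omega> f x) powr p)" "integrable lebesgue (\<lambda>x. norm (cut \<Omega> g x) powr p)"
        using fg by (auto simp: in_Lp_cut)
      have "Lp_pow p \<Omega> g \<le> (\<integral>x. (1 + d) * norm (cut \<Omega> f x) powr p + C * norm (cut \<Omega> (\<lambda>x. g x - f x) x) powr p \<partial>lebesgue)"
        unfolding Lp_pow_cut
      proof (rule integral_mono)
        show "norm (cut \<Omega> g x) powr p \<le> (1 + d) * norm (cut \<Omega> f x) powr p + C * norm (cut \<Omega> (\<lambda>x. g x - f x) x) powr p" for x
          using C(2)[of "cut \<Omega> f x" "cut \<Omega> (\<lambda>x. g x - f x) x"] by (simp add: scaleR_diff_right)
      qed (use i in auto)
      then show ?thesis unfolding Lp_pow_cut using i by simp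
    qed
    then show ?thesis using C(1) by blast
  qed
  let ?I = "Lp_pow p \<Omega> f"
  show ?thesis
  proof (rule LIMSEQ_I)
    fix e :: real assume e: "e > 0"
    have I: "?I \<ge> 0" by (rule Lp_pow_nonneg)
    \<comment> \<open>In the reverse direction the factor \<open>d\<close> multiplies the integral
      belonging to \<open>g n\<close>, for which only the a priori bound \<open>2 * ?I + 1\<close>
      is available.\<close>
    define d where "d = min 1 (e / (4 * (2 * ?I + 1)))"
    have d: "d > 0" "d \<le> 1" using e I by (auto simp: d_def)
    have "d \<le> e / (4 * (2 * ?I + 1))" by (simp add: d_def)
    then have d2: "d * (2 * ?I + 1) \<le> e / 4" using I by (simp add: field_simps)
    obtain C where C: "C \<ge> 0" "\<forall>f g. in_Lp p \<Omega> f \<longrightarrow> in_Lp p \<Omega> g \<longrightarrow>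
      Lp_pow p \<Omega> g \<le> (1 + d) * Lp_pow p \<Omega> f + C * Lp_pow p \<Omega> (\<lambda>x. g x - f x :: 'b)" using le[OF d(1)] by blast
    have "(\<lambda>n. C * Lp_pow p \<Omega> (\<lambda>x. g n x - f x)) \<longlonglongrightarrow> C * 0" by (intro tendsto_intros lim)
    then have "\<forall>\<^sub>F n in sequentially. C * Lp_pow p \<Omega> (\<lambda>x. g n x - f x) < min 1 (e / 4)"
      using e by (intro order_tendstoD) auto
    then obtain N where N: "\<And>n. n \<ge> N \<Longrightarrow> C * Lp_pow p \<Omega> (\<lambda>x. g n x - f x) < min 1 (e / 4)"
      by (auto simp: eventually_sequentially)
    have "norm (Lp_pow p \<Omega> (g n) - ?I) < e" if "n \<ge> N" for n
    proof -
      let ?J = "Lp_pow p \<Omega> (g n)" and ?E = "C * Lp_pow p \<Omega> (\<lambda>x. g n x - f x)"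
      have sym: "Lp_pow p \<Omega> (\<lambda>x. f x - g n x) = Lp_pow p \<Omega> (\<lambda>x. g n x - f x)"
        unfolding Lp_pow_def by (simp add: norm_minus_commute)
      have 1: "?J \<le> (1 + d) * ?I + ?E" using C(2) f g by blast
      have 2: "?I \<le> (1 + d) * ?J + ?E" using C(2) f g sym by metis
      have "d * ?I \<le> ?I" using d I by (simp add: mult_left_le_one_le)
      then have "?J \<le> 2 * ?I + 1" using 1 N[OF that] by (simp add: algebra_simps)
      then have "d * ?J \<le> d * (2 * ?I + 1)" using d by (intro mult_left_mono) auto
      moreover have "d * ?I \<le> d * (2 * ?I + 1)" using d I by (intro mult_left_mono) auto
      ultimately have "d * ?J \<le> e / 4" "d * ?I \<le> e / 4" using d2 by linarith+
      then show ?thesis using 1 2 N[OF that] e by (simp add: algebra_simps abs_less_iff)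
    qed
    then show "\<exists>no. \<forall>n\<ge>no. norm (Lp_pow p \<Omega> (g n) - ?I) < e" by blast
  qed
qed

text \<open>The majorant \<open>1 + |f|^p\<close> covers \<open>u\<close> and \<open>Du\<close> as
  well as \<open>u powr (p - 1)\<close> and \<open>p_power p Du\<close>, so the pairings in the weak
  equation are integrable by this one criterion.\<close>

lemma integrable_inner_compact_support:
  fixes f :: "'a::euclidean_space \<Rightarrow> 'c::euclidean_space" and h g :: "'a \<Rightarrow> 'b::euclidean_space"
  assumes p: "p \<ge> 1" and f: "f \<in> borel_measurable lebesgue" "integrable lebesgue (\<lambda>x. norm (f x) powr p)"
    and h: "h \<in> borel_measurable lebesgue" "\<And>x. norm (h x) \<le> 1 + norm (f x) powr p"
    and g: "continuous_on UNIV g" "compact S" "\<And>x. x \<notin> S \<Longrightarrow> g x = 0"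
  shows "integrable lebesgue (\<lambda>x. h x \<bullet> g x)"
proof -
  obtain K where K: "K > 0" "\<And>x. norm (g x) \<le> K" using bounded_compact_support[OF g] by metis
  have [measurable]: "g \<in> borel_measurable lebesgue"
    using g(1) by (intro measurable_completion) (simp add: borel_measurable_continuous_onI)
  note [measurable] = h(1)
  show ?thesis
  proof (rule integrable_Lp_mult_bounded[OF p f g(2)])
    fix x
    show "\<bar>h x \<bullet> g x\<bar> \<le> K * (1 + norm (f x) powr p) * indicator S x"
    proof (cases "x \<in> S")
      case True
      have "\<bar>h x \<bullet> g x\<bar> \<le> norm (h x) * norm (g x)" by (rule Cauchy_Schwarz_ineq2)
      also have "\<dots> \<le> (1 + norm (f x) powr p) * K" using h(2) K by (intro mult_mono) auto
      finally show ?thesis using True by (simp add: mult.commute)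
    qed (simp add: g(3))
  qed measurable
qed

lemma integral_inner_uniform_limit:
  fixes f :: "'a::euclidean_space \<Rightarrow> 'c::euclidean_space" and h :: "'a \<Rightarrow> 'b::euclidean_space"
  assumes p: "p \<ge> 1" and f: "f \<in> borel_measurable lebesgue" "integrable lebesgue (\<lambda>x. norm (f x) powr p)"
    and h: "h \<in> borel_measurable lebesgue" "\<And>x. norm (h x) \<le> 1 + norm (f x) powr p"
    and T: "compact T" and g: "continuous_on UNIV g" "\<And>x. x \<notin> T \<Longrightarrow> g x = 0"
    and k: "\<And>n::nat. continuous_on UNIV (k n)" "\<And>n x. x \<notin> T \<Longrightarrow> k n x = 0"
    and lim: "\<And>e. e > 0 \<Longrightarrow> \<forall>\<^sub>F n in sequentially. \<forall>x. norm (k n x - g x) \<le> e"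
  shows "(\<lambda>n. \<integral>x. h x \<bullet> k n x \<partial>lebesgue) \<longlonglongrightarrow> (\<integral>x. h x \<bullet> g x \<partial>lebesgue)"
proof (rule LIMSEQ_I)
  fix e :: real assume e: "e > 0"
  note [measurable] = h(1)
  have [measurable]: "T \<in> sets lebesgue" using T fmeasurableD lmeasurable_compact by blast
  have iT: "integrable lebesgue (\<lambda>x. norm (h x) * indicator T x)"
    by (rule integrable_Lp_mult_bounded[OF p f T, where C=1]) (use h(2) in \<open>auto simp: indicator_def\<close>)
  define M where "M = (\<integral>x. norm (h x) * indicator T x \<partial>lebesgue)"
  have M: "M \<ge> 0" unfolding M_def by (rule Bochner_Integration.integral_nonneg) simp
  define d where "d = e / (2 * (M + 1))"
  have d: "d > 0" "d * M < e" using e M by (auto simp: d_def field_simps intro: add_nonneg_pos)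
  obtain N where N: "\<And>n x. n \<ge> N \<Longrightarrow> norm (k n x - g x) \<le> d"
    using lim[OF d(1)] by (auto simp: eventually_sequentially)
  have "norm ((\<integral>x. h x \<bullet> k n x \<partial>lebesgue) - (\<integral>x. h x \<bullet> g x \<partial>lebesgue)) < e" if "n \<ge> N" for n
  proof -
    have i: "integrable lebesgue (\<lambda>x. h x \<bullet> k n x)" "integrable lebesgue (\<lambda>x. h x \<bullet> g x)"
      by (rule integrable_inner_compact_support[OF p f h _ T]; use g k in blast)+
    have "(\<integral>x. h x \<bullet> k n x \<partial>lebesgue) - (\<integral>x. h x \<bullet> g x \<partial>lebesgue) = (\<integral>x. h x \<bullet> k n x - h x \<bullet> g x \<partial>lebesgue)"
      using i by simp
    also have "norm \<dots> \<le> (\<integral>x. d * (norm (h x) * indicator T x) \<partial>lebesgue)"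
    proof (rule Bochner_Integration.integral_norm_bound_integral)
      show "norm (h x \<bullet> k n x - h x \<bullet> g x) \<le> d * (norm (h x) * indicator T x)" for x
      proof (cases "x \<in> T")
        case True
        have "\<bar>h x \<bullet> (k n x - g x)\<bar> \<le> norm (h x) * norm (k n x - g x)" by (rule Cauchy_Schwarz_ineq2)
        also have "\<dots> \<le> norm (h x) * d" using N[OF that] by (intro mult_left_mono) auto
        finally show ?thesis using True by (simp add: inner_diff_right mult.commute)
      qed (simp add: g k)
    qed (use i iT in auto)
    also have "\<dots> = d * M" unfolding M_def by simp
    finally show ?thesis using d(2) by simp
  qed
  then show "\<exists>N. \<forall>n\<ge>N. norm ((\<integral>x. h x \<bullet> k n x \<partial>lebesgue) - (\<integral>x. h x \<bullet> g x \<partial>lebesgue)) < e" by blast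
qed

section \<open>Perturbation of functions in \<open>W01p\<close> by test functions\<close>

lemma test_function_add:
  assumes "test_function \<Omega> \<phi>" "test_function \<Omega> \<psi>"
  shows "test_function \<Omega> (\<lambda>x. \<phi> x + t * \<psi> x)"
proof -
  obtain S T where S: "compact S" "S \<subseteq> \<Omega>" "\<And>x. x \<notin> S \<Longrightarrow> \<phi> x = 0"
    and T: "compact T" "T \<subseteq> \<Omega>" "\<And>x. x \<notin> T \<Longrightarrow> \<psi> x = 0"
    using assms[THEN test_function_imp_C1_compact] C1_compact_support by metis
  have "smooth_on UNIV (\<lambda>x. \<phi> x + t * \<psi> x)"
    using assms by (auto simp: test_function_def smooth_on_def intro!: Ck_on_add Ck_on_cmult)
  then show ?thesis
    by (rule test_functionI[where S="S \<union> T"]) (use S T in auto)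
qed

lemma test_function_Lp:
  assumes \<phi>: "test_function \<Omega> \<phi>" and p: "p > 0"
  shows "in_Lp p \<Omega> \<phi>" "in_Lp p \<Omega> (grad \<phi>)" "cut \<Omega> \<phi> = \<phi>" "cut \<Omega> (grad \<phi>) = grad \<phi>"
proof -
  note c = test_function_imp_C1_compact[OF \<phi>]
  obtain S where S: "compact S" "S \<subseteq> \<Omega>" "\<And>x. x \<notin> S \<Longrightarrow> \<phi> x = 0" "\<And>x. x \<notin> S \<Longrightarrow> grad \<phi> x = 0"
    using C1_compact_support[OF c] by metis
  show "in_Lp p \<Omega> \<phi>" "cut \<Omega> \<phi> = \<phi>"
    by (rule in_Lp_continuous_compact[OF C1_compact_continuous(1)[OF c] S(1,2,3) p]; simp)+
  show "in_Lp p \<Omega> (grad \<phi>)" "cut \<Omega> (grad \<phi>) = grad \<phi>"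
    by (rule in_Lp_continuous_compact[OF C1_compact_continuous(2)[OF c] S(1,2,4) p]; simp)+
qed

lemma grad_add_cmult:
  assumes "C1_compact \<Omega> \<phi>" "C1_compact \<Omega> \<psi>"
  shows "grad (\<lambda>x. \<phi> x + t * \<psi> x) x = grad \<phi> x + t *\<^sub>R grad \<psi> x"
  by (rule GDERIV_grad_eq, rule GDERIV_subst[OF GDERIV_add[OF C1_compact_GDERIV[OF assms(1)]
        GDERIV_mult[OF GDERIV_const C1_compact_GDERIV[OF assms(2)]]]]) simp

lemma first_eigenvalue_le:
  assumes "W01p p \<Omega> v Dv"
  shows "first_eigenvalue p \<Omega> * Lp_pow p \<Omega> v \<le> Lp_pow p \<Omega> Dv"
proof (cases "Lp_pow p \<Omega> v = 0")
  case False
  then have pos: "Lp_pow p \<Omega> v > 0" using Lp_pow_nonneg[of p \<Omega> v] by simp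
  have "\<not> (AE x in lebesgue. x \<in> \<Omega> \<longrightarrow> v x = 0)"
  proof
    assume "AE x in lebesgue. x \<in> \<Omega> \<longrightarrow> v x = 0"
    then have "AE x in lebesgue. norm (cut \<Omega> v x) powr p = 0"
      by eventually_elim (auto simp: indicator_def)
    then have "Lp_pow p \<Omega> v = 0" unfolding Lp_pow_cut by (rule integral_eq_zero_AE)
    then show False using False by simp
  qed
  then have "first_eigenvalue p \<Omega> \<le> Lp_pow p \<Omega> Dv / Lp_pow p \<Omega> v"
    unfolding first_eigenvalue_def using assms
    by (intro cInf_lower) (auto intro!: bdd_belowI[of _ 0] divide_nonneg_nonneg Lp_pow_nonneg)
  then show ?thesis using pos by (simp add: field_simps)
qed (simp add: Lp_pow_nonneg)

text \<open>Adding \<open>t * \<phi>\<close> to the approximating test functions as well leaves all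
  differences unchanged; what has to be checked is that \<open>grad \<phi>\<close> is the weak
  gradient of \<phi>, by integration by parts.\<close>

lemma W01p_add_test_function:
  assumes p: "p > 1" and W: "W01p p \<Omega> u Du" and \<phi>: "test_function \<Omega> \<phi>"
  shows "W01p p \<Omega> (\<lambda>x. u x + t * \<phi> x) (\<lambda>x. Du x + t *\<^sub>R grad \<phi> x)"
proof -
  have W1: "in_Lp p \<Omega> u" "in_Lp p \<Omega> Du" "weak_gradient \<Omega> u Du"
    using W by (auto simp: W01p_def W1p_def)
  note c = test_function_imp_C1_compact[OF \<phi>]
  have z: "test_function \<Omega> (\<lambda>x. 0)"
    by (rule test_functionI[of _ "{}"]) (auto simp: smooth_on_def)
  have t: "test_function \<Omega> (\<lambda>x. t * \<phi> x)" using test_function_add[OF z \<phi>] by simp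
  have gt: "grad (\<lambda>x. t * \<phi> x) = (\<lambda>x. t *\<^sub>R grad \<phi> x)"
    using grad_add_cmult[OF test_function_imp_C1_compact[OF z] c]
      GDERIV_grad_eq[OF GDERIV_const] by (auto simp: fun_eq_iff)
  have L1: "in_Lp p \<Omega> (\<lambda>x. u x + t * \<phi> x)" "in_Lp p \<Omega> (\<lambda>x. Du x + t *\<^sub>R grad \<phi> x)"
    using p W1 test_function_Lp[OF t, of p] unfolding gt by (auto intro: in_Lp_add)
  have "weak_gradient \<Omega> (\<lambda>x. u x + t * \<phi> x) (\<lambda>x. Du x + t *\<^sub>R grad \<phi> x)"
    unfolding weak_gradient_def
  proof (intro allI impI ballI)
    fix \<psi> and b :: 'a assume \<psi>: "test_function \<Omega> \<psi>" and b: "b \<in> Basis"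
    note c' = test_function_imp_C1_compact[OF \<psi>]
    obtain S where S: "compact S" "S \<subseteq> \<Omega>" "\<And>x. x \<notin> S \<Longrightarrow> \<psi> x = 0" "\<And>x. x \<notin> S \<Longrightarrow> grad \<psi> x = 0"
      using C1_compact_support[OF c'] by metis
    have p1: "p \<ge> 1" using p by simp
    have fu: "cut \<Omega> u \<in> borel_measurable lebesgue" "integrable lebesgue (\<lambda>x. norm (cut \<Omega> u x) powr p)"
      and fD: "cut \<Omega> Du \<in> borel_measurable lebesgue" "integrable lebesgue (\<lambda>x. norm (cut \<Omega> Du x) powr p)"
      using W1 by (auto simp: in_Lp_cut)
    have le1: "norm y \<le> 1 + norm y powr p" for y :: "'b::real_normed_vector"
      using powr_le_1_add_powr[of "norm y" 1 p] p by simp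
    have iu: "integrable lebesgue (\<lambda>x. cut \<Omega> u x \<bullet> (grad \<psi> x \<bullet> b))"
      by (rule integrable_inner_compact_support[OF p1 fu fu(1) le1 _ S(1)])
        (auto intro!: continuous_intros C1_compact_continuous[OF c'] simp: S)
    have iD: "integrable lebesgue (\<lambda>x. cut \<Omega> Du x \<bullet> (\<psi> x *\<^sub>R b))"
      by (rule integrable_inner_compact_support[OF p1 fD fD(1) le1 _ S(1)])
        (auto intro!: continuous_intros C1_compact_continuous[OF c'] simp: S)
    have i\<phi>: "integrable lebesgue (\<lambda>x. \<phi> x * (grad \<psi> x \<bullet> b))" "integrable lebesgue (\<lambda>x. (grad \<phi> x \<bullet> b) * \<psi> x)"
      by (rule integrable_lebesgue_compact_support[OF _ S(1)];
        auto intro!: continuous_intros C1_compact_continuous[OF c] C1_compact_continuous[OF c'] simp: S)+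
    have \<phi>1: "Ck_on 1 UNIV \<phi>" using c by (simp add: C1_compact_def)
    have "(\<integral>x. grad (\<lambda>x. \<psi> x * \<phi> x) x \<bullet> b \<partial>lebesgue) = 0"
      by (rule integral_grad_eq_0[OF C1_compact_mult_on(1)[OF C1_compact_mono[OF c'] _ \<phi>1]]) auto
    moreover have "grad (\<lambda>x. \<psi> x * \<phi> x) x \<bullet> b = \<phi> x * (grad \<psi> x \<bullet> b) + (grad \<phi> x \<bullet> b) * \<psi> x" for x
      using C1_compact_mult_on(2)[OF C1_compact_mono[OF c'] _ \<phi>1, of x] by (simp add: inner_add_left mult.commute)
    ultimately have ibp: "(\<integral>x. \<phi> x * (grad \<psi> x \<bullet> b) \<partial>lebesgue) = - (\<integral>x. (grad \<phi> x \<bullet> b) * \<psi> x \<partial>lebesgue)"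
      using i\<phi> by simp
    have out: "\<psi> x = 0" "grad \<psi> x = 0" if "x \<notin> \<Omega>" for x using S that by blast+
    have cutS: "indicator \<Omega> x *\<^sub>R (g x * \<psi> x) = g x * \<psi> x" "indicator \<Omega> x *\<^sub>R (g x * (grad \<psi> x \<bullet> b)) = g x * (grad \<psi> x \<bullet> b)"
      for x and g :: "'a \<Rightarrow> real" by (cases "x \<in> \<Omega>"; simp add: out)+
    have "(LINT x:\<Omega>|lebesgue. (u x + t * \<phi> x) * (grad \<psi> x \<bullet> b))
        = (\<integral>x. cut \<Omega> u x \<bullet> (grad \<psi> x \<bullet> b) + t * (\<phi> x * (grad \<psi> x \<bullet> b)) \<partial>lebesgue)"
      unfolding set_lebesgue_integral_def cutS
      by (intro Bochner_Integration.integral_cong refl) (auto simp: indicator_def out algebra_simps)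
    also have "\<dots> = (\<integral>x. cut \<Omega> u x \<bullet> (grad \<psi> x \<bullet> b) \<partial>lebesgue) + t * (\<integral>x. \<phi> x * (grad \<psi> x \<bullet> b) \<partial>lebesgue)"
      using iu i\<phi> by simp
    also have "(\<integral>x. cut \<Omega> u x \<bullet> (grad \<psi> x \<bullet> b) \<partial>lebesgue) = (LINT x:\<Omega>|lebesgue. u x * (grad \<psi> x \<bullet> b))"
      unfolding set_lebesgue_integral_def by (simp add: mult.assoc)
    also have "\<dots> = - (LINT x:\<Omega>|lebesgue. (Du x \<bullet> b) * \<psi> x)"
      using W1(3) \<psi> b unfolding weak_gradient_def by blast
    also have "(LINT x:\<Omega>|lebesgue. (Du x \<bullet> b) * \<psi> x) = (\<integral>x. cut \<Omega> Du x \<bullet> (\<psi> x *\<^sub>R b) \<partial>lebesgue)"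
      unfolding set_lebesgue_integral_def by (simp add: mult_ac)
    also have "- (\<integral>x. cut \<Omega> Du x \<bullet> (\<psi> x *\<^sub>R b) \<partial>lebesgue) + t * (\<integral>x. \<phi> x * (grad \<psi> x \<bullet> b) \<partial>lebesgue)
        = - (\<integral>x. cut \<Omega> Du x \<bullet> (\<psi> x *\<^sub>R b) + t * ((grad \<phi> x \<bullet> b) * \<psi> x) \<partial>lebesgue)"
      unfolding ibp using iD i\<phi> by simp
    also have "(\<integral>x. cut \<Omega> Du x \<bullet> (\<psi> x *\<^sub>R b) + t * ((grad \<phi> x \<bullet> b) * \<psi> x) \<partial>lebesgue)
        = (LINT x:\<Omega>|lebesgue. ((Du x + t *\<^sub>R grad \<phi> x) \<bullet> b) * \<psi> x)"
      unfolding set_lebesgue_integral_def cutS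
      by (intro Bochner_Integration.integral_cong refl) (auto simp: indicator_def out algebra_simps inner_add_left)
    finally show "(LINT x:\<Omega>|lebesgue. (u x + t * \<phi> x) * (grad \<psi> x \<bullet> b)) =
        - (LINT x:\<Omega>|lebesgue. ((Du x + t *\<^sub>R grad \<phi> x) \<bullet> b) * \<psi> x)" .
  qed
  moreover obtain \<psi> where \<psi>: "\<And>n::nat. test_function \<Omega> (\<psi> n)"
    "(\<lambda>n. Lp_pow p \<Omega> (\<lambda>x. \<psi> n x - u x)) \<longlonglongrightarrow> 0" "(\<lambda>n. Lp_pow p \<Omega> (\<lambda>x. grad (\<psi> n) x - Du x)) \<longlonglongrightarrow> 0"
    using W unfolding W01p_def by blast
  moreover have g: "grad (\<lambda>x. \<psi> n x + t * \<phi> x) x - (Du x + t *\<^sub>R grad \<phi> x) = grad (\<psi> n) x - Du x" for n x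
    using grad_add_cmult[OF test_function_imp_C1_compact[OF \<psi>(1)] c] by simp
  ultimately show ?thesis
    unfolding W01p_def W1p_def using L1
    by (intro conjI exI[of _ "\<lambda>n x. \<psi> n x + t * \<phi> x"])
      (simp_all only: g add_diff_cancel_right test_function_add[OF _ \<phi>] simp_thms)
qed

section \<open>The equation of the logarithmic gradient\<close>

text \<open>\<open>Du\<close> is the Sobolev gradient supplied by \<open>W01p\<close>, at first
  unrelated to the classical \<open>grad u\<close>; the two are identified almost everywhere
  below.\<close>

locale p_eigenfunction =
  fixes p :: real and \<Omega> :: "'a::euclidean_space set" and u :: "'a \<Rightarrow> real" and Du :: "'a \<Rightarrow> 'a"
  assumes p: "1 < p" "p < 2" and \<Omega>: "open \<Omega>" "\<Omega> \<noteq> {}"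
    and u_pos: "\<And>x. x \<in> \<Omega> \<Longrightarrow> u x > 0" and u_C1: "Ck_on 1 \<Omega> u" and W: "W01p p \<Omega> u Du"
    and minimal: "Lp_pow p \<Omega> Du / Lp_pow p \<Omega> u = first_eigenvalue p \<Omega>"
begin

abbreviation "ev \<equiv> first_eigenvalue p \<Omega>"

lemma p1: "p \<ge> 1" "p \<le> 2" "p > 0" using p by auto

lemma u_Lp: "in_Lp p \<Omega> u" "in_Lp p \<Omega> Du" "weak_gradient \<Omega> u Du"
  using W by (auto simp: W01p_def W1p_def)

lemma u_meas [measurable]: "cut \<Omega> u \<in> borel_measurable lebesgue" "cut \<Omega> Du \<in> borel_measurable lebesgue"
  and u_int: "integrable lebesgue (\<lambda>x. norm (cut \<Omega> u x) powr p)"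
    "integrable lebesgue (\<lambda>x. norm (cut \<Omega> Du x) powr p)"
  using u_Lp by (auto simp: in_Lp_cut)

lemma Lp_pow_u_pos: "Lp_pow p \<Omega> u > 0"
proof -
  have "Lp_pow p \<Omega> u \<noteq> 0"
  proof
    assume "Lp_pow p \<Omega> u = 0"
    then have "AE x in lebesgue. norm (cut \<Omega> u x) powr p = 0"
      unfolding Lp_pow_cut using integral_nonneg_eq_0_iff_AE[OF u_int(1)] by simp
    then have "AE x in lebesgue. x \<notin> \<Omega>"
      by eventually_elim (use u_pos in force)
    then have "\<Omega> \<in> null_sets lebesgue" using \<Omega>(1) by (subst AE_iff_null_sets) (auto simp: borel_open)
    then have "negligible \<Omega>" by (simp add: negligible_iff_null_sets)
    then show False using open_not_negligible \<Omega> by blast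
  qed
  then show ?thesis using Lp_pow_nonneg[of p \<Omega> u] by simp
qed

lemma ev_mult: "ev * Lp_pow p \<Omega> u = Lp_pow p \<Omega> Du"
  using minimal Lp_pow_u_pos by (simp add: field_simps)

lemma ev_nonneg: "ev \<ge> 0"
  using minimal Lp_pow_nonneg divide_nonneg_nonneg by metis

lemma flux_meas [measurable]: "(\<lambda>x. p_power p (cut \<Omega> Du x)) \<in> borel_measurable lebesgue"
  by (rule measurable_compose[OF u_meas(2) borel_measurable_p_power[OF p(1)]])

lemma flux_bound: "norm (p_power p (cut \<Omega> Du x)) \<le> 1 + norm (cut \<Omega> Du x) powr p"
  unfolding norm_p_power using p by (intro powr_le_1_add_powr) auto

lemma source_meas [measurable]: "(\<lambda>x. cut \<Omega> u x powr (p - 1)) \<in> borel_measurable lebesgue"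
  using u_meas(1) by measurable

lemma source_bound: "norm (cut \<Omega> u x powr (p - 1)) \<le> 1 + norm (cut \<Omega> u x) powr p"
proof -
  have "cut \<Omega> u x \<ge> 0" using u_pos by (auto simp: indicator_def intro: less_imp_le)
  then show ?thesis using powr_le_1_add_powr[of "cut \<Omega> u x" "p - 1" p] p by simp
qed

text \<open>Every \<open>u + t * \<phi>\<close> is a competitor. Convexity bounds its mass from
  below and \<open>norm_add_powr_le\<close> bounds its energy from above, both to first order in
  \<open>t\<close>; by minimality the terms of order zero cancel, and the linear term cannot have a
  sign.\<close>

lemma Euler_Lagrange_test:
  assumes \<phi>: "test_function \<Omega> \<phi>"
  shows "(\<integral>x. p_power p (cut \<Omega> Du x) \<bullet> grad \<phi> x \<partial>lebesgue) = ev * (\<integral>x. cut \<Omega> u x powr (p - 1) * \<phi> x \<partial>lebesgue)"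
proof -
  note c = test_function_imp_C1_compact[OF \<phi>]
  obtain S where S: "compact S" "S \<subseteq> \<Omega>" "\<And>x. x \<notin> S \<Longrightarrow> \<phi> x = 0" "\<And>x. x \<notin> S \<Longrightarrow> grad \<phi> x = 0"
    using C1_compact_support[OF c] by metis
  note L = test_function_Lp[OF \<phi> p1(3)]
  let ?P = "\<lambda>x. p_power p (cut \<Omega> Du x)" and ?U = "\<lambda>x. cut \<Omega> u x powr (p - 1)"
  have iP: "integrable lebesgue (\<lambda>x. ?P x \<bullet> grad \<phi> x)"
    by (rule integrable_inner_compact_support[OF p1(1) u_meas(2) u_int(2) flux_meas flux_bound
          C1_compact_continuous(2)[OF c] S(1) S(4)])
  have iU: "integrable lebesgue (\<lambda>x. ?U x * \<phi> x)"
    using integrable_inner_compact_support[OF p1(1) u_meas(1) u_int(1) source_meas source_bound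
          C1_compact_continuous(1)[OF c] S(1) S(3)] by simp
  have ig: "integrable lebesgue (\<lambda>x. norm (grad \<phi> x) powr p)"
    using L(2) unfolding in_Lp_cut L(4)[THEN fun_cong] by simp
  let ?C = "2 powr p + p"
  have "0 \<le> (p * ((\<integral>x. ?P x \<bullet> grad \<phi> x \<partial>lebesgue) - ev * (\<integral>x. ?U x * \<phi> x \<partial>lebesgue))) * t
      + (?C * (\<integral>x. norm (grad \<phi> x) powr p \<partial>lebesgue)) * \<bar>t\<bar> powr p" for t
  proof -
    have W': "W01p p \<Omega> (\<lambda>x. u x + t * \<phi> x) (\<lambda>x. Du x + t *\<^sub>R grad \<phi> x)"
      by (rule W01p_add_test_function[OF p(1) W \<phi>])
    have c1: "cut \<Omega> (\<lambda>x. u x + t * \<phi> x) x = cut \<Omega> u x + t * \<phi> x"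
      "cut \<Omega> (\<lambda>x. Du x + t *\<^sub>R grad \<phi> x) x = cut \<Omega> Du x + t *\<^sub>R grad \<phi> x" for x
      using L(3,4)[THEN fun_cong, of x] by (auto simp: indicator_def split: if_splits)
    have i2: "integrable lebesgue (\<lambda>x. norm (cut \<Omega> u x + t * \<phi> x) powr p)"
      "integrable lebesgue (\<lambda>x. norm (cut \<Omega> Du x + t *\<^sub>R grad \<phi> x) powr p)"
      using W' unfolding W01p_def W1p_def in_Lp_cut c1 by blast+
    have "Lp_pow p \<Omega> u + p * t * (\<integral>x. ?U x * \<phi> x \<partial>lebesgue)
        = (\<integral>x. norm (cut \<Omega> u x) powr p + p * t * (?U x * \<phi> x) \<partial>lebesgue)"
      unfolding Lp_pow_cut using iU u_int(1) by simp
    also have "\<dots> \<le> (\<integral>x. norm (cut \<Omega> u x + t * \<phi> x) powr p \<partial>lebesgue)"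
    proof (rule integral_mono)
      show "norm (cut \<Omega> u x) powr p + p * t * (?U x * \<phi> x) \<le> norm (cut \<Omega> u x + t * \<phi> x) powr p" for x
      proof (cases "x \<in> \<Omega>")
        case True
        then show ?thesis using abs_add_powr_ge[OF p1(1) u_pos[OF True], of "t * \<phi> x"] u_pos[OF True]
          by (simp add: mult_ac)
      next
        case False
        then have "\<phi> x = 0" using S by blast
        then show ?thesis using False by simp
      qed
    qed (use i2 iU u_int(1) in auto)
    also have "\<dots> = Lp_pow p \<Omega> (\<lambda>x. u x + t * \<phi> x)" unfolding Lp_pow_cut c1 ..
    finally have "ev * (Lp_pow p \<Omega> u + p * t * (\<integral>x. ?U x * \<phi> x \<partial>lebesgue))
        \<le> ev * Lp_pow p \<Omega> (\<lambda>x. u x + t * \<phi> x)" using ev_nonneg by (rule mult_left_mono)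
    also have "\<dots> \<le> Lp_pow p \<Omega> (\<lambda>x. Du x + t *\<^sub>R grad \<phi> x)" by (rule first_eigenvalue_le[OF W'])
    also have "\<dots> = (\<integral>x. norm (cut \<Omega> Du x + t *\<^sub>R grad \<phi> x) powr p \<partial>lebesgue)" unfolding Lp_pow_cut c1 ..
    also have "\<dots> \<le> (\<integral>x. norm (cut \<Omega> Du x) powr p + p * t * (?P x \<bullet> grad \<phi> x)
        + ?C * \<bar>t\<bar> powr p * norm (grad \<phi> x) powr p \<partial>lebesgue)"
    proof (rule integral_mono)
      show "norm (cut \<Omega> Du x + t *\<^sub>R grad \<phi> x) powr p \<le> norm (cut \<Omega> Du x) powr p
          + p * t * (?P x \<bullet> grad \<phi> x) + ?C * \<bar>t\<bar> powr p * norm (grad \<phi> x) powr p" for x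
        using norm_add_powr_le[OF p(1) p1(2), of "cut \<Omega> Du x" "t *\<^sub>R grad \<phi> x"]
        by (simp add: powr_mult mult_ac)
    qed (use i2 iP u_int(2) ig in auto)
    also have "\<dots> = Lp_pow p \<Omega> Du + p * t * (\<integral>x. ?P x \<bullet> grad \<phi> x \<partial>lebesgue)
        + ?C * \<bar>t\<bar> powr p * (\<integral>x. norm (grad \<phi> x) powr p \<partial>lebesgue)"
      unfolding Lp_pow_cut using iP u_int(2) ig by simp
    finally show ?thesis unfolding distrib_left ev_mult by (simp add: algebra_simps)
  qed
  from linear_le_powr_imp_0[OF p(1) this] show ?thesis using p by simp
qed

lemma Euler_Lagrange:
  assumes \<psi>: "C1_compact \<Omega> \<psi>"
  shows "(\<integral>x. p_power p (cut \<Omega> Du x) \<bullet> grad \<psi> x \<partial>lebesgue) = ev * (\<integral>x. cut \<Omega> u x powr (p - 1) * \<psi> x \<partial>lebesgue)"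
proof -
  obtain \<phi> T where T: "compact T" "T \<subseteq> \<Omega>" and \<phi>: "\<And>n::nat. test_function \<Omega> (\<phi> n)"
    and 0: "\<And>x. x \<notin> T \<Longrightarrow> \<psi> x = 0 \<and> grad \<psi> x = 0" "\<And>n x. x \<notin> T \<Longrightarrow> \<phi> n x = 0 \<and> grad (\<phi> n) x = 0"
    and close: "\<And>e. e > 0 \<Longrightarrow> \<forall>\<^sub>F n in sequentially. \<forall>x. \<bar>\<phi> n x - \<psi> x\<bar> \<le> e \<and> norm (grad (\<phi> n) x - grad \<psi> x) \<le> e"
    by (rule C1_compact_approx_test_functions[OF \<Omega>(1) \<psi>]) blast
  note c = C1_compact_continuous[OF \<psi>] and cn = C1_compact_continuous[OF test_function_imp_C1_compact[OF \<phi>]]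
  have "(\<lambda>n. \<integral>x. p_power p (cut \<Omega> Du x) \<bullet> grad (\<phi> n) x \<partial>lebesgue) \<longlonglongrightarrow>
      (\<integral>x. p_power p (cut \<Omega> Du x) \<bullet> grad \<psi> x \<partial>lebesgue)"
    by (rule integral_inner_uniform_limit[OF p1(1) u_meas(2) u_int(2) flux_meas flux_bound T(1) c(2) _ cn(2)])
      (use 0 in \<open>auto elim!: eventually_mono[OF close]\<close>)
  moreover have "(\<lambda>n. \<integral>x. cut \<Omega> u x powr (p - 1) \<bullet> \<phi> n x \<partial>lebesgue) \<longlonglongrightarrow>
      (\<integral>x. cut \<Omega> u x powr (p - 1) \<bullet> \<psi> x \<partial>lebesgue)"
    by (rule integral_inner_uniform_limit[OF p1(1) u_meas(1) u_int(1) source_meas source_bound T(1) c(1) _ cn(1)])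
      (use 0 in \<open>auto elim!: eventually_mono[OF close]\<close>)
  then have "(\<lambda>n. ev * (\<integral>x. cut \<Omega> u x powr (p - 1) * \<phi> n x \<partial>lebesgue)) \<longlonglongrightarrow>
      ev * (\<integral>x. cut \<Omega> u x powr (p - 1) * \<psi> x \<partial>lebesgue)"
    by (intro tendsto_mult tendsto_const) simp
  ultimately show ?thesis unfolding Euler_Lagrange_test[OF \<phi>] by (rule LIMSEQ_unique)
qed

text \<open>The classical gradient is a weak gradient too, by integration by parts for
  \<open>\<phi> * u\<close>; so each component of the difference integrates to 0 against all test
  functions.\<close>

lemma Du_eq_grad: "AE x in lebesgue. x \<in> \<Omega> \<longrightarrow> Du x = grad u x"
proof -
  have "AE x in lebesgue. x \<in> \<Omega> \<longrightarrow> (Du x - grad u x) \<bullet> b = 0" if b: "b \<in> Basis" for b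
  proof -
    let ?h = "\<lambda>x. cut \<Omega> Du x \<bullet> b - cut \<Omega> (grad u) x \<bullet> b"
    have cg: "continuous_on \<Omega> (grad u)" by (rule Ck_on_1_continuous_grad[OF u_C1])
    have [measurable]: "cut \<Omega> (grad u) \<in> borel_measurable lebesgue"
      using borel_measurable_continuous_on_indicator[OF _ cg] \<Omega>(1) by (intro measurable_completion) (simp add: borel_open)
    have iD: "integrable lebesgue (\<lambda>x. indicator K x * (cut \<Omega> Du x \<bullet> b))" if "compact K" for K
    proof -
      have [measurable]: "K \<in> sets lebesgue" using that fmeasurableD lmeasurable_compact by blast
      show ?thesis
      proof (rule integrable_Lp_mult_bounded[OF p1(1) u_meas(2) u_int(2) that])
        show "\<bar>indicator K x * (cut \<Omega> Du x \<bullet> b)\<bar> \<le> 1 * (1 + norm (cut \<Omega> Du x) powr p) * indicator K x" for x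
          using Basis_le_norm[OF b, of "cut \<Omega> Du x"] powr_le_1_add_powr[of "norm (cut \<Omega> Du x)" 1 p] p
          by (auto simp: indicator_def)
      qed measurable
    qed
    have "AE x in lebesgue. x \<in> \<Omega> \<longrightarrow> ?h x = 0"
    proof (rule fundamental_lemma_calculus_of_variations[OF \<Omega>(1)])
      show "?h \<in> borel_measurable lebesgue" by measurable
      fix K assume K: "compact K" "K \<subseteq> \<Omega>"
      have "integrable lborel (\<lambda>x. indicator K x *\<^sub>R (grad u x \<bullet> b))"
        by (rule borel_integrable_compact[OF K(1)]) (intro continuous_intros continuous_on_subset[OF cg K(2)])
      then have "integrable lebesgue (\<lambda>x. indicator K x *\<^sub>R (grad u x \<bullet> b))"
        by (subst integrable_completion) auto
      also have "(\<lambda>x. indicator K x *\<^sub>R (grad u x \<bullet> b)) = (\<lambda>x. indicator K x * (cut \<Omega> (grad u) x \<bullet> b))"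
        using K(2) by (auto simp: indicator_def fun_eq_iff)
      finally show "integrable lebesgue (\<lambda>x. indicator K x * ?h x)"
        using iD[OF K(1)] by (simp add: right_diff_distrib)
    next
      fix \<phi> assume \<phi>: "test_function \<Omega> \<phi>"
      note c = test_function_imp_C1_compact[OF \<phi>]
      obtain S where S: "compact S" "S \<subseteq> \<Omega>" "\<And>x. x \<notin> S \<Longrightarrow> \<phi> x = 0" "\<And>x. x \<notin> S \<Longrightarrow> grad \<phi> x = 0"
        using C1_compact_support[OF c] by metis
      have out: "\<phi> x = 0" "grad \<phi> x = 0" if "x \<notin> \<Omega>" for x using S that by blast+
      have i1: "integrable lebesgue (\<lambda>x. u x * (grad \<phi> x \<bullet> b))"
      proof -
        have "continuous_on UNIV (\<lambda>x. (grad \<phi> x \<bullet> b) *\<^sub>R u x)"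
          by (rule continuous_on_mult_compact_support[OF _ S(1,2) _ \<Omega>(1) Ck_on_imp_continuous_on[OF u_C1]])
            (auto intro!: continuous_intros C1_compact_continuous[OF c] simp: S)
        then show ?thesis
          by (intro integrable_lebesgue_compact_support[OF _ S(1)]) (auto simp: S mult.commute)
      qed
      have i2: "integrable lebesgue (\<lambda>x. (grad u x \<bullet> b) * \<phi> x)"
      proof -
        have "continuous_on UNIV (\<lambda>x. \<phi> x *\<^sub>R (grad u x \<bullet> b))"
          by (rule continuous_on_mult_compact_support[OF C1_compact_continuous(1)[OF c] S(1,2) _ \<Omega>(1)])
            (auto intro!: continuous_intros cg simp: S)
        then show ?thesis
          by (intro integrable_lebesgue_compact_support[OF _ S(1)]) (auto simp: S mult.commute)
      qed
      have i3: "integrable lebesgue (\<lambda>x. (cut \<Omega> Du x \<bullet> b) * \<phi> x)"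
      proof -
        have le1: "norm y \<le> 1 + norm y powr p" for y :: 'a
          using powr_le_1_add_powr[of "norm y" 1 p] p by simp
        have "integrable lebesgue (\<lambda>x. cut \<Omega> Du x \<bullet> (\<phi> x *\<^sub>R b))"
          by (intro integrable_inner_compact_support[OF p1(1) u_meas(2) u_int(2) u_meas(2) le1 _ S(1)])
            (auto intro!: continuous_intros C1_compact_continuous[OF c] simp: S)
        then show ?thesis by (simp add: mult_ac)
      qed
      have z0: "0 = (\<integral>x. grad (\<lambda>x. \<phi> x * u x) x \<bullet> b \<partial>lebesgue)"
        by (rule integral_grad_eq_0[OF C1_compact_mult_on(1)[OF c \<Omega>(1) u_C1], symmetric])
      have g: "grad (\<lambda>x. \<phi> x * u x) x \<bullet> b = u x * (grad \<phi> x \<bullet> b) + (grad u x \<bullet> b) * \<phi> x" for x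
      proof (cases "x \<in> \<Omega>")
        case True
        then show ?thesis using C1_compact_mult_on(2)[OF c \<Omega>(1) u_C1 True] by (simp add: inner_add_left mult.commute)
      next
        case False
        then have "x \<notin> S" using S(2) by blast
        then have "grad (\<lambda>x. \<phi> x * u x) x = 0"
          by (intro grad_eq_0_outside[of S]) (auto simp: S intro: compact_imp_closed)
        then show ?thesis using out[OF False] by simp
      qed
      have "0 = (\<integral>x. u x * (grad \<phi> x \<bullet> b) + (grad u x \<bullet> b) * \<phi> x \<partial>lebesgue)"
        using z0 unfolding g .
      also have "(\<integral>x. u x * (grad \<phi> x \<bullet> b) + (grad u x \<bullet> b) * \<phi> x \<partial>lebesgue)
          = (\<integral>x. u x * (grad \<phi> x \<bullet> b) \<partial>lebesgue) + (\<integral>x. (grad u x \<bullet> b) * \<phi> x \<partial>lebesgue)"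
        using i1 i2 by simp
      also have "(\<integral>x. u x * (grad \<phi> x \<bullet> b) \<partial>lebesgue) = (LINT x:\<Omega>|lebesgue. u x * (grad \<phi> x \<bullet> b))"
        unfolding set_lebesgue_integral_def
        by (intro Bochner_Integration.integral_cong refl) (auto simp: indicator_def out)
      also have "\<dots> = - (LINT x:\<Omega>|lebesgue. (Du x \<bullet> b) * \<phi> x)"
        using u_Lp(3) \<phi> b unfolding weak_gradient_def by blast
      also have "(LINT x:\<Omega>|lebesgue. (Du x \<bullet> b) * \<phi> x) = (\<integral>x. (cut \<Omega> Du x \<bullet> b) * \<phi> x \<partial>lebesgue)"
        unfolding set_lebesgue_integral_def by (simp add: mult_ac)
      finally have "(\<integral>x. (grad u x \<bullet> b) * \<phi> x \<partial>lebesgue) = (\<integral>x. (cut \<Omega> Du x \<bullet> b) * \<phi> x \<partial>lebesgue)" by simp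
      moreover have "?h x * \<phi> x = (cut \<Omega> Du x \<bullet> b) * \<phi> x - (grad u x \<bullet> b) * \<phi> x" for x
        by (cases "x \<in> \<Omega>") (auto simp: out left_diff_distrib)
      ultimately show "(\<integral>x. ?h x * \<phi> x \<partial>lebesgue) = 0" using i2 i3 by simp
    qed
    then show ?thesis by eventually_elim (simp add: inner_diff_left)
  qed
  then have "AE x in lebesgue. \<forall>b\<in>Basis. x \<in> \<Omega> \<longrightarrow> (Du x - grad u x) \<bullet> b = 0"
    by (subst AE_ball_countable) (auto simp: countable_finite)
  then show ?thesis
    by eventually_elim (metis euclidean_all_zero_iff right_minus_eq)
qed

section \<open>The logarithmic gradient field and its equation\<close>

abbreviation "X \<equiv> log_grad_field p u"

lemma GDERIV_u: "x \<in> \<Omega> \<Longrightarrow> GDERIV u x :> grad u x"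
  by (rule Ck_on_1_GDERIV[OF u_C1])

lemma X_eq:
  assumes "x \<in> \<Omega>"
  shows "X x = u x powr (1 - p) *\<^sub>R p_power p (grad u x)"
proof -
  have "GDERIV (\<lambda>z. ln (u z)) x :> (1 / u x) *\<^sub>R grad u x"
    by (rule GDERIV_DERIV_compose[OF GDERIV_u[OF assms] DERIV_ln_divide[OF u_pos[OF assms]]])
  then have "X x = p_power p ((1 / u x) *\<^sub>R grad u x)"
    unfolding log_grad_field_def by (simp add: GDERIV_grad_eq)
  also have "\<dots> = (1 / u x) powr (p - 1) *\<^sub>R p_power p (grad u x)"
    using u_pos[OF assms] by (intro p_power_scale) simp
  also have "(1 / u x) powr (p - 1) = u x powr (1 - p)"
    using u_pos[OF assms] by (simp add: powr_divide powr_diff)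
  finally show ?thesis .
qed

lemma continuous_u: "continuous_on \<Omega> u"
  by (rule Ck_on_imp_continuous_on[OF u_C1])

lemma continuous_X: "continuous_on \<Omega> X"
proof -
  have "continuous_on \<Omega> (\<lambda>x. u x powr (1 - p) *\<^sub>R p_power p (grad u x))"
    using u_pos p by (intro continuous_intros continuous_u Ck_on_1_continuous_grad[OF u_C1]) force+
  then show ?thesis by (rule continuous_on_eq) (simp add: X_eq)
qed

lemma norm_X_powr:
  assumes "x \<in> \<Omega>"
  shows "norm (X x) powr (p / (p - 1)) = u x powr (- p) * norm (grad u x) powr p"
proof -
  have "norm (X x) powr (p / (p - 1)) = (u x powr (1 - p)) powr (p / (p - 1)) * norm (p_power p (grad u x)) powr (p / (p - 1))"
    unfolding X_eq[OF assms] by (simp add: powr_mult)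
  also have "(u x powr (1 - p)) powr (p / (p - 1)) = u x powr (- p)"
  proof -
    have "(1 - p) * (p / (p - 1)) = - p" using p by (simp add: field_simps)
    then show ?thesis by (simp only: powr_powr)
  qed
  finally show ?thesis using p by (simp add: norm_p_power_conjugate)
qed

lemma log_integrand_integrable:
  assumes \<eta>: "C1_compact \<Omega> \<eta>"
  shows "integrable lebesgue (\<lambda>x. X x \<bullet> grad \<eta> x - (p - 1) * norm (X x) powr (p / (p - 1)) * \<eta> x - ev * \<eta> x)"
proof -
  obtain S where S: "compact S" "S \<subseteq> \<Omega>" "\<And>x. x \<notin> S \<Longrightarrow> \<eta> x = 0" "\<And>x. x \<notin> S \<Longrightarrow> grad \<eta> x = 0"
    using C1_compact_support[OF \<eta>] by metis
  have "continuous_on UNIV (\<lambda>x. grad \<eta> x \<bullet> X x)"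
  proof -
    have "continuous_on UNIV (\<lambda>x. (grad \<eta> x \<bullet> b) *\<^sub>R (X x \<bullet> b))" for b
    proof (rule continuous_on_mult_compact_support[OF _ S(1,2) _ \<Omega>(1)])
      show "continuous_on UNIV (\<lambda>x. grad \<eta> x \<bullet> b)"
        by (intro continuous_on_inner C1_compact_continuous[OF \<eta>] continuous_on_const)
      show "continuous_on \<Omega> (\<lambda>x. X x \<bullet> b)" by (intro continuous_on_inner continuous_X continuous_on_const)
    qed (simp add: S)
    then have "continuous_on UNIV (\<lambda>x. \<Sum>b\<in>Basis. (grad \<eta> x \<bullet> b) *\<^sub>R (X x \<bullet> b))" by (rule continuous_on_sum)
    also have "(\<lambda>x. \<Sum>b\<in>Basis. (grad \<eta> x \<bullet> b) *\<^sub>R (X x \<bullet> b)) = (\<lambda>x. grad \<eta> x \<bullet> X x)"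
      by (rule ext, subst euclidean_inner) simp
    finally show ?thesis .
  qed
  moreover have "continuous_on UNIV (\<lambda>x. \<eta> x *\<^sub>R ((p - 1) * norm (X x) powr (p / (p - 1)) + ev))"
    using p by (intro continuous_on_mult_compact_support[OF C1_compact_continuous(1)[OF \<eta>] S(1,2,3) \<Omega>(1)])
        (auto intro!: continuous_intros continuous_on_powr' continuous_X)
  ultimately have cont: "continuous_on UNIV (\<lambda>x. grad \<eta> x \<bullet> X x - \<eta> x *\<^sub>R ((p - 1) * norm (X x) powr (p / (p - 1)) + ev))"
    by (rule continuous_on_diff)
  from integrable_lebesgue_compact_support[OF this S(1)] show ?thesis
    by (simp add: S algebra_simps inner_commute)
qed

text \<open>Tests the Euler-Lagrange equation with \<open>\<eta> * u powr (1 - p)\<close>,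
  admissible because \<open>u\<close> is positive and C^1 in \<Omega>. Differentiating the power of
  \<open>u\<close> produces \<open>- (p - 1) |X|^q \<eta>\<close>, differentiating \<eta> produces
  \<open>X \<bullet> grad \<eta>\<close>, and the source becomes the eigenvalue times
  \<eta>.\<close>

lemma log_equation:
  assumes \<eta>: "C1_compact \<Omega> \<eta>"
  shows "(\<integral>x. X x \<bullet> grad \<eta> x - (p - 1) * norm (X x) powr (p / (p - 1)) * \<eta> x - ev * \<eta> x \<partial>lebesgue) = 0"
proof -
  obtain S where S: "compact S" "S \<subseteq> \<Omega>" "\<And>x. x \<notin> S \<Longrightarrow> \<eta> x = 0" "\<And>x. x \<notin> S \<Longrightarrow> grad \<eta> x = 0"
    using C1_compact_support[OF \<eta>] by metis
  have out: "\<eta> x = 0" "grad \<eta> x = 0" if "x \<notin> \<Omega>" for x using S that by blast+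
  let ?f = "\<lambda>x. u x powr (1 - p)"
  let ?\<psi> = "\<lambda>x. \<eta> x * ?f x"
  have f: "GDERIV ?f x :> ((1 - p) * u x powr (- p)) *\<^sub>R grad u x" if "x \<in> \<Omega>" for x
  proof -
    have "((\<lambda>y. y powr (1 - p)) has_real_derivative (1 - p) * u x powr (1 - p - 1)) (at (u x))"
      using has_real_derivative_powr[OF u_pos[OF that]] .
    from GDERIV_DERIV_compose[OF GDERIV_u[OF that] this] show ?thesis by simp
  qed
  have f1: "Ck_on 1 \<Omega> ?f"
    by (rule Ck_on_1_I[OF \<Omega>(1) f])
      (use u_pos in \<open>force intro!: continuous_intros continuous_u Ck_on_1_continuous_grad[OF u_C1]\<close>)+
  note \<psi>1 = C1_compact_mult_on[OF \<eta> \<Omega>(1) f1]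
  have \<psi>0: "grad ?\<psi> x = 0" if "x \<notin> S" for x
    using that by (intro grad_eq_0_outside[of S]) (auto simp: S intro: compact_imp_closed)
  let ?A = "\<lambda>x. p_power p (cut \<Omega> Du x) \<bullet> grad ?\<psi> x" and ?B = "\<lambda>x. cut \<Omega> u x powr (p - 1) * ?\<psi> x"
  have iA: "integrable lebesgue ?A"
    by (rule integrable_inner_compact_support[OF p1(1) u_meas(2) u_int(2) flux_meas flux_bound
          C1_compact_continuous(2)[OF \<psi>1(1)] S(1) \<psi>0])
  have "integrable lebesgue (\<lambda>x. cut \<Omega> u x powr (p - 1) \<bullet> ?\<psi> x)"
    by (rule integrable_inner_compact_support[OF p1(1) u_meas(1) u_int(1) source_meas source_bound
          C1_compact_continuous(1)[OF \<psi>1(1)] S(1)]) (simp add: S)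
  then have iB: "integrable lebesgue ?B" by simp
  have "(\<integral>x. ?A x - ev * ?B x \<partial>lebesgue) = 0"
    using Euler_Lagrange[OF \<psi>1(1)] iA iB by simp
  moreover have "(\<integral>x. ?A x - ev * ?B x \<partial>lebesgue) =
    (\<integral>x. X x \<bullet> grad \<eta> x - (p - 1) * norm (X x) powr (p / (p - 1)) * \<eta> x - ev * \<eta> x \<partial>lebesgue)"
  proof (rule integral_cong_AE)
    show "(\<lambda>x. ?A x - ev * ?B x) \<in> borel_measurable lebesgue" using iA iB by auto
    show "(\<lambda>x. X x \<bullet> grad \<eta> x - (p - 1) * norm (X x) powr (p / (p - 1)) * \<eta> x - ev * \<eta> x) \<in> borel_measurable lebesgue"
      by (rule borel_measurable_integrable[OF log_integrand_integrable[OF \<eta>]])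
    show "AE x in lebesgue. ?A x - ev * ?B x =
      X x \<bullet> grad \<eta> x - (p - 1) * norm (X x) powr (p / (p - 1)) * \<eta> x - ev * \<eta> x"
      using Du_eq_grad
    proof eventually_elim
      case (elim x)
      show ?case
      proof (cases "x \<in> \<Omega>")
        case True
        have g: "grad ?f x = ((1 - p) * u x powr (- p)) *\<^sub>R grad u x" by (rule GDERIV_grad_eq[OF f[OF True]])
        have uu: "u x powr (p - 1) * u x powr (1 - p) = 1"
          using u_pos[OF True] by (simp add: powr_add[symmetric])
        have a: "?A x = (1 - p) * (u x powr (- p) * norm (grad u x) powr p) * \<eta> x + X x \<bullet> grad \<eta> x"
          using elim True unfolding \<psi>1(2)[OF True] g X_eq[OF True]
          by (simp add: inner_add_right p_power_inner_self mult_ac)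
        have b: "?B x = \<eta> x" using True uu by (simp add: mult_ac)
        show ?thesis unfolding a b norm_X_powr[OF True] by (simp add: algebra_simps)
      next
        case False
        then have "x \<notin> S" using S(2) by blast
        then show ?thesis using out[OF False] \<psi>0 by simp
      qed
    qed
  qed
  ultimately show ?thesis by simp
qed

end

section \<open>Uniqueness of the logarithmic gradient\<close>

lemma C1_compact_abs_powr:
  assumes \<phi>: "C1_compact \<Omega> \<phi>" and p: "p > 1"
  shows "C1_compact \<Omega> (\<lambda>x. \<bar>\<phi> x\<bar> powr p)"
    and "grad (\<lambda>x. \<bar>\<phi> x\<bar> powr p) x = (p * p_power p (\<phi> x)) *\<^sub>R grad \<phi> x"
proof -
  obtain S where S: "compact S" "S \<subseteq> \<Omega>" "\<And>x. x \<notin> S \<Longrightarrow> \<phi> x = 0" "\<And>x. x \<notin> S \<Longrightarrow> grad \<phi> x = 0"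
    using C1_compact_support[OF \<phi>] by metis
  have g: "GDERIV (\<lambda>x. \<bar>\<phi> x\<bar> powr p) x :> (p * p_power p (\<phi> x)) *\<^sub>R grad \<phi> x" for x
    by (rule GDERIV_DERIV_compose[OF C1_compact_GDERIV[OF \<phi>] DERIV_abs_powr[OF p]])
  then show "grad (\<lambda>x. \<bar>\<phi> x\<bar> powr p) x = (p * p_power p (\<phi> x)) *\<^sub>R grad \<phi> x" by (rule GDERIV_grad_eq)
  show "C1_compact \<Omega> (\<lambda>x. \<bar>\<phi> x\<bar> powr p)"
    by (rule C1_compactI[OF S(1,2) _ g])
      (auto simp: S intro!: continuous_intros C1_compact_continuous[OF \<phi>] p)
qed

context p_eigenfunction
begin

text \<open>Testing with \<open>|\<phi>|\<^sup>p\<close> turns the energy excess of \<open>\<phi>\<close> into an integral of pointwise Young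
  remainders between \<open>\<nabla>\<phi>\<close> and \<open>X\<close>.\<close>

lemma Picone_identity:
  assumes \<phi>: "test_function \<Omega> \<phi>"
  defines "R \<equiv> \<lambda>x. norm (grad \<phi> x) powr p + (p - 1) * norm (p_power p (\<phi> x) *\<^sub>R X x) powr (p / (p - 1))
      - p * ((p_power p (\<phi> x) *\<^sub>R X x) \<bullet> grad \<phi> x)"
  shows "R x \<ge> 0" "integrable lebesgue R" "(\<integral>x. R x \<partial>lebesgue) = Lp_pow p \<Omega> (grad \<phi>) - ev * Lp_pow p \<Omega> \<phi>"
proof -
  note c = test_function_imp_C1_compact[OF \<phi>] and L = test_function_Lp[OF \<phi> p1(3)]
  note \<eta> = C1_compact_abs_powr[OF c p(1)]
  let ?\<eta> = "\<lambda>x. \<bar>\<phi> x\<bar> powr p"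
  let ?Z = "\<lambda>x. X x \<bullet> grad ?\<eta> x - (p - 1) * norm (X x) powr (p / (p - 1)) * ?\<eta> x - ev * ?\<eta> x"
  show "R x \<ge> 0" unfolding R_def
    using Young_remainder_nonneg[OF p(1), of "p_power p (\<phi> x) *\<^sub>R X x" "grad \<phi> x"] by simp
  have i: "integrable lebesgue (\<lambda>x. norm (grad \<phi> x) powr p)" "integrable lebesgue ?\<eta>"
    using L(1,2) unfolding in_Lp_cut L(3,4)[THEN fun_cong] by simp_all
  have R: "R x = norm (grad \<phi> x) powr p - (?Z x + ev * ?\<eta> x)" for x
    using p norm_p_power_conjugate[OF p(1), of "\<phi> x"]
    by (simp add: R_def \<eta>(2) powr_mult algebra_simps)
  note iZ = log_integrand_integrable[OF \<eta>(1)]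
  have iE: "integrable lebesgue (\<lambda>x. ev * ?\<eta> x)" using i(2) by simp
  note iZE = Bochner_Integration.integrable_add[OF iZ iE]
  show "integrable lebesgue R" unfolding R by (rule Bochner_Integration.integrable_diff[OF i(1) iZE])
  have "(\<integral>x. R x \<partial>lebesgue) = (\<integral>x. norm (grad \<phi> x) powr p \<partial>lebesgue) - ((\<integral>x. ?Z x \<partial>lebesgue) + ev * (\<integral>x. ?\<eta> x \<partial>lebesgue))"
    unfolding R Bochner_Integration.integral_diff[OF i(1) iZE] Bochner_Integration.integral_add[OF iZ iE] by simp
  then show "(\<integral>x. R x \<partial>lebesgue) = Lp_pow p \<Omega> (grad \<phi>) - ev * Lp_pow p \<Omega> \<phi>"
    unfolding log_equation[OF \<eta>(1)] Lp_pow_cut L(3,4)[THEN fun_cong] by simp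
qed

end

text \<open>The test functions approximating \<open>u\<close> enter the Picone identity of
  \<open>v\<close>. Since \<open>u\<close> is a minimiser, the integrals of the remainders tend to
  0, so in the limit Young's inequality between \<open>grad u\<close> and \<open>u^(p-1)\<close>
  times the field of \<open>v\<close> is an equality almost everywhere. Continuity of both fields
  removes the exceptional set.\<close>

lemma log_grad_field_unique:
  assumes u: "p_eigenfunction p \<Omega> u Du" and v: "p_eigenfunction p \<Omega> v Dv" and x: "x \<in> \<Omega>"
  shows "log_grad_field p u x = log_grad_field p v x"
proof -
  interpret u: p_eigenfunction p \<Omega> u Du by (rule u)
  interpret v: p_eigenfunction p \<Omega> v Dv by (rule v)
  obtain \<phi> where \<phi>: "\<And>n::nat. test_function \<Omega> (\<phi> n)"
    "(\<lambda>n. Lp_pow p \<Omega> (\<lambda>x. \<phi> n x - u x)) \<longlonglongrightarrow> 0" "(\<lambda>n. Lp_pow p \<Omega> (\<lambda>x. grad (\<phi> n) x - Du x)) \<longlonglongrightarrow> 0"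
    using u.W unfolding W01p_def by blast
  note L = test_function_Lp[OF \<phi>(1) u.p1(3)]
  define R where "R n x = norm (grad (\<phi> n) x) powr p + (p - 1) * norm (p_power p (\<phi> n x) *\<^sub>R v.X x) powr (p / (p - 1))
      - p * ((p_power p (\<phi> n x) *\<^sub>R v.X x) \<bullet> grad (\<phi> n) x)" for n x
  note R = v.Picone_identity[OF \<phi>(1), folded R_def]
  have limR: "(\<lambda>n. \<integral>x. R n x \<partial>lebesgue) \<longlonglongrightarrow> 0"
  proof -
    have "(\<lambda>n. Lp_pow p \<Omega> (grad (\<phi> n)) - u.ev * Lp_pow p \<Omega> (\<phi> n)) \<longlonglongrightarrow> Lp_pow p \<Omega> Du - u.ev * Lp_pow p \<Omega> u"
      by (intro tendsto_diff tendsto_mult tendsto_const Lp_pow_tendsto u.p u.p1 u.u_Lp L \<phi>)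
    then show ?thesis by (simp add: R(3) u.ev_mult)
  qed
  let ?a = "\<lambda>n x. norm (cut \<Omega> (\<lambda>x. \<phi> n x - u x) x) powr p"
  let ?b = "\<lambda>n x. norm (cut \<Omega> (\<lambda>x. grad (\<phi> n) x - Du x) x) powr p"
  have in_diff: "in_Lp p \<Omega> (\<lambda>x. f x - g x)" if "in_Lp p \<Omega> f" "in_Lp p \<Omega> g" for f g :: "'a \<Rightarrow> 'c::euclidean_space"
    using in_Lp_add[of p \<Omega> f "\<lambda>x. - g x"] that u.p1 by (simp add: in_Lp_cut)
  have i: "integrable lebesgue (?a n)" "integrable lebesgue (?b n)" for n
    using in_diff[OF L(1) u.u_Lp(1)] in_diff[OF L(2) u.u_Lp(2)] by (auto simp: in_Lp_cut)
  \<comment> \<open>The three nonnegative sequences are added so that a single subsequence makes all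
    of them converge to 0 almost everywhere.\<close>
  let ?h = "\<lambda>n x. R n x + ?a n x + ?b n x"
  have "\<exists>r::nat\<Rightarrow>nat. strict_mono r \<and> (AE x in lebesgue. (\<lambda>n. ?h (r n) x) \<longlonglongrightarrow> 0)"
  proof (rule tendsto_L1_AE_subseq)
    show "integrable lebesgue (?h n)" for n using R(2) i by (intro Bochner_Integration.integrable_add)
    have "(\<integral>x. norm (?h n x) \<partial>lebesgue) = (\<integral>x. R n x \<partial>lebesgue) + Lp_pow p \<Omega> (\<lambda>x. \<phi> n x - u x) + Lp_pow p \<Omega> (\<lambda>x. grad (\<phi> n) x - Du x)" for n
    proof -
      have "norm (?h n x) = ?h n x" for x unfolding real_norm_def by (intro abs_of_nonneg add_nonneg_nonneg R(1)) auto
      then show ?thesis unfolding Lp_pow_cut using R(2) i by simp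
    qed
    then show "(\<lambda>n. \<integral>x. norm (?h n x) \<partial>lebesgue) \<longlonglongrightarrow> 0"
      using tendsto_add[OF tendsto_add[OF limR \<phi>(2)] \<phi>(3)] by simp
  qed
  then obtain r where r: "AE x in lebesgue. (\<lambda>n. ?h (r n) x) \<longlonglongrightarrow> 0" by blast
  have ae: "AE x in lebesgue. x \<in> \<Omega> \<longrightarrow> u.X x = v.X x"
    using r u.Du_eq_grad
  proof eventually_elim
    case (elim x)
    show ?case
    proof
      assume x: "x \<in> \<Omega>"
      have small: "(\<lambda>n. f (r n)) \<longlonglongrightarrow> 0" if "\<And>n. 0 \<le> f n" "\<And>n. f n \<le> ?h n x" for f :: "nat \<Rightarrow> real"
        by (rule tendsto_sandwich[OF _ _ tendsto_const elim(1)]; intro always_eventually allI that)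
      have root: "(\<lambda>n. y n) \<longlonglongrightarrow> z" if "(\<lambda>n. norm (y n - z) powr p) \<longlonglongrightarrow> 0" for y :: "nat \<Rightarrow> 'c::real_normed_vector" and z
      proof -
        have "(\<lambda>n. (norm (y n - z) powr p) powr (1 / p)) \<longlonglongrightarrow> 0 powr (1 / p)"
          by (intro tendsto_powr' that tendsto_const) (use u.p in auto)
        then have "(\<lambda>n. norm (y n - z)) \<longlonglongrightarrow> 0" using u.p by (simp add: powr_powr)
        then show ?thesis by (simp add: LIM_zero_iff tendsto_norm_zero_iff)
      qed
      have 1: "(\<lambda>n. \<phi> (r n) x) \<longlonglongrightarrow> u x"
        by (rule root, rule small) (use x R(1) in \<open>auto intro!: add_increasing add_increasing2\<close>)
      have 2: "(\<lambda>n. grad (\<phi> (r n)) x) \<longlonglongrightarrow> grad u x"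
        by (rule root, rule small) (use x R(1) elim(2) in \<open>auto intro!: add_increasing add_increasing2\<close>)
      have "(\<lambda>n. R (r n) x) \<longlonglongrightarrow> 0" by (rule small) (auto intro: R(1))
      moreover have "(\<lambda>n. R (r n) x) \<longlonglongrightarrow> norm (grad u x) powr p + (p - 1) * norm (p_power p (u x) *\<^sub>R v.X x) powr (p / (p - 1))
          - p * ((p_power p (u x) *\<^sub>R v.X x) \<bullet> grad u x)"
        unfolding R_def
        by (intro tendsto_intros tendsto_powr' 1 2 isCont_tendsto_compose[OF isCont_p_power[OF u.p(1)]])
          (use u.p in auto)
      ultimately have "norm (grad u x) powr p + (p - 1) * norm (p_power p (u x) *\<^sub>R v.X x) powr (p / (p - 1))
          - p * ((p_power p (u x) *\<^sub>R v.X x) \<bullet> grad u x) = 0" by (rule LIMSEQ_unique[symmetric])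
      then have "p_power p (u x) *\<^sub>R v.X x = p_power p (grad u x)"
        by (intro Young_remainder_eq_0 u.p u.p1) simp
      moreover have "p_power p (u x) = u x powr (p - 1)"
        using u.u_pos[OF x] by (simp add: p_power_def powr_diff power2_eq_square)
      ultimately have "u x powr (1 - p) *\<^sub>R (u x powr (p - 1) *\<^sub>R v.X x) = u.X x" by (simp add: u.X_eq[OF x])
      then show "u.X x = v.X x" using u.u_pos[OF x] by (simp add: powr_add[symmetric])
    qed
  qed
  \<comment> \<open>The set where the fields differ is open and null, hence empty.\<close>
  have "open {x \<in> \<Omega>. u.X x - v.X x \<in> - {0}}"
    by (rule continuous_open_preimage[unfolded vimage_def Int_def, OF _ u.\<Omega>(1), simplified])
      (auto intro!: continuous_intros u.continuous_X v.continuous_X)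
  moreover have "negligible {x \<in> \<Omega>. u.X x - v.X x \<in> - {0}}"
  proof -
    have "AE x in lebesgue. x \<notin> {x \<in> \<Omega>. u.X x - v.X x \<in> - {0}}" using ae by eventually_elim auto
    then show ?thesis using calculation
      by (subst (asm) AE_iff_null_sets[symmetric]) (auto simp: negligible_iff_null_sets borel_open)
  qed
  ultimately have "{x \<in> \<Omega>. u.X x - v.X x \<in> - {0}} = {}" using open_not_negligible by blast
  then show ?thesis using x by auto
qed

section \<open>Comparison with the slab\<close>

context comparison_ode
begin

text \<open>The field belonging to \<open>v(s / \<epsilon>)\<close>: differentiation brings out
  \<open>1 / \<epsilon>\<close>, and the field is homogeneous of degree \<open>p - 1\<close> in the
  logarithmic gradient.\<close>

definition ws :: "real \<Rightarrow> real \<Rightarrow> real" where "ws \<epsilon> s = \<epsilon> powr (1 - p) * w (s / \<epsilon>)"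

lemma abs_ws_powr: "\<epsilon> > 0 \<Longrightarrow> \<bar>ws \<epsilon> s\<bar> powr q = \<epsilon> powr (- p) * \<bar>w (s / \<epsilon>)\<bar> powr q"
proof -
  have e: "(1 - p) * q = - p" using pq(1) by (simp add: algebra_simps)
  assume "\<epsilon> > 0"
  then show ?thesis by (auto simp: ws_def abs_mult powr_mult powr_powr e)
qed

lemma DERIV_ws:
  assumes "\<epsilon> > 0" "\<bar>s\<bar> < \<epsilon> * len"
  shows "(ws \<epsilon> has_real_derivative - ((p - 1) * (\<epsilon> powr (- p) + \<bar>ws \<epsilon> s\<bar> powr q))) (at s)"
proof -
  have s: "\<bar>s / \<epsilon>\<bar> < len" using assms by (simp add: field_simps)
  have "((\<lambda>s. s / \<epsilon>) has_real_derivative 1 / \<epsilon>) (at s)" using DERIV_cdivide[OF DERIV_ident] .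
  from DERIV_cmult[OF DERIV_chain2[OF DERIV_w[OF s] this], of "\<epsilon> powr (1 - p)"]
  have "(ws \<epsilon> has_real_derivative \<epsilon> powr (1 - p) * (- ((p - 1) * (1 + \<bar>w (s / \<epsilon>)\<bar> powr q)) * (1 / \<epsilon>))) (at s)"
    by (simp add: ws_def[abs_def])
  moreover have "\<epsilon> powr (1 - p) * (- ((p - 1) * (1 + \<bar>w (s / \<epsilon>)\<bar> powr q)) * (1 / \<epsilon>))
      = - ((p - 1) * (\<epsilon> powr (- p) + \<bar>ws \<epsilon> s\<bar> powr q))"
  proof -
    have "\<epsilon> powr (1 - p) = \<epsilon> * \<epsilon> powr (- p)"
      using assms by (simp add: powr_diff powr_minus field_simps)
    then show ?thesis using assms(1) by (simp add: abs_ws_powr) (simp add: algebra_simps)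
  qed
  ultimately show ?thesis by simp
qed

text \<open>The divergence of \<open>|\<phi>|^p W\<close> has integral 0, \<open>W\<close> being the
  blow-up field of the slab. Young's inequality splits the cross term so that its
  \<open>|W|^q\<close> part cancels the one in the divergence of \<open>W\<close>, leaving
  \<open>(p - 1) \<epsilon>^(-p)\<close>.\<close>

lemma slab_Poincare:
  fixes \<phi> :: "'a::euclidean_space \<Rightarrow> real"
  assumes \<phi>: "C1_compact \<Omega> \<phi>" and e: "norm e = 1" and \<epsilon>: "\<epsilon> > 0"
    and \<Omega>: "\<And>x. x \<in> \<Omega> \<Longrightarrow> \<bar>x \<bullet> e\<bar> < \<epsilon> * len"
  shows "(p - 1) * \<epsilon> powr (- p) * (\<integral>x. \<bar>\<phi> x\<bar> powr p \<partial>lebesgue) \<le> (\<integral>x. norm (grad \<phi> x) powr p \<partial>lebesgue)"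
proof -
  define T where "T = {x::'a. \<bar>x \<bullet> e\<bar> < \<epsilon> * len}"
  have T: "open T" unfolding T_def by (intro open_Collect_less continuous_intros)
  have "\<Omega> \<subseteq> T" using \<Omega> by (auto simp: T_def)
  let ?\<eta> = "\<lambda>x. \<bar>\<phi> x\<bar> powr p"
  note \<eta> = C1_compact_abs_powr[OF C1_compact_mono[OF \<phi> \<open>\<Omega> \<subseteq> T\<close>] p(1)]
  obtain S where S: "compact S" "S \<subseteq> T" "\<And>x. x \<notin> S \<Longrightarrow> \<phi> x = 0" "\<And>x. x \<notin> S \<Longrightarrow> grad \<phi> x = 0"
    using C1_compact_support[OF C1_compact_mono[OF \<phi> \<open>\<Omega> \<subseteq> T\<close>]] by metis
  let ?f = "\<lambda>x. ws \<epsilon> (x \<bullet> e)"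
  let ?D = "\<lambda>x. - ((p - 1) * (\<epsilon> powr (- p) + \<bar>?f x\<bar> powr q))"
  have g: "GDERIV ?f x :> ?D x *\<^sub>R e" if "x \<in> T" for x
    by (rule GDERIV_DERIV_compose[OF GDERIV_inner_left DERIV_ws[OF \<epsilon>]]) (use that in \<open>simp add: T_def\<close>)
  have cf: "continuous_on T ?f"
    using g by (meson continuous_at_imp_continuous_on gderiv_def has_derivative_continuous)
  have f1: "Ck_on 1 T ?f"
    by (rule Ck_on_1_I[OF T g]) (use q_gt_2 in \<open>auto intro!: continuous_intros continuous_on_powr' cf\<close>)
  note m = C1_compact_mult_on[OF \<eta>(1) T f1]
  have iR: "integrable lebesgue (\<lambda>x. grad (\<lambda>x. ?\<eta> x * ?f x) x \<bullet> e)"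
    by (rule integrable_lebesgue_compact_support[OF _ S(1)])
      (auto intro!: continuous_intros C1_compact_continuous[OF m(1)]
        simp: grad_eq_0_outside[OF compact_imp_closed[OF S(1)]] S(3))
  have i\<eta>: "integrable lebesgue ?\<eta>"
    by (rule integrable_lebesgue_compact_support[OF C1_compact_continuous(1)[OF \<eta>(1)] S(1)]) (simp add: S)
  have ig: "integrable lebesgue (\<lambda>x. norm (grad \<phi> x) powr p)"
  proof (rule integrable_lebesgue_compact_support[OF _ S(1)])
    show "continuous_on UNIV (\<lambda>x. norm (grad \<phi> x) powr p)"
      using p by (intro continuous_on_powr' continuous_on_norm continuous_on_const C1_compact_continuous[OF \<phi>]) auto
  qed (simp add: S)
  have "0 = (\<integral>x. grad (\<lambda>x. ?\<eta> x * ?f x) x \<bullet> e \<partial>lebesgue)"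
    by (rule integral_grad_eq_0[OF m(1), symmetric])
  also have "\<dots> \<le> (\<integral>x. norm (grad \<phi> x) powr p - (p - 1) * \<epsilon> powr (- p) * ?\<eta> x \<partial>lebesgue)"
  proof (rule integral_mono[OF iR])
    show "grad (\<lambda>x. ?\<eta> x * ?f x) x \<bullet> e \<le> norm (grad \<phi> x) powr p - (p - 1) * \<epsilon> powr (- p) * ?\<eta> x" for x
    proof (cases "x \<in> S")
      case True
      then have x: "x \<in> T" using S(2) by blast
      have "grad (\<lambda>x. ?\<eta> x * ?f x) x \<bullet> e = ?\<eta> x * ?D x + p * ((?f x * p_power p (\<phi> x)) \<bullet> (grad \<phi> x \<bullet> e))"
        unfolding m(2)[OF x] \<eta>(2) GDERIV_grad_eq[OF g[OF x]]
        using e by (simp add: inner_add_left inner_diff_left dot_square_norm mult_ac)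
      also have "p * ((?f x * p_power p (\<phi> x)) \<bullet> (grad \<phi> x \<bullet> e)) \<le> norm (grad \<phi> x \<bullet> e) powr p
          + (p - 1) * norm (?f x * p_power p (\<phi> x)) powr (p / (p - 1))"
        by (rule Young_remainder_nonneg[OF p(1)])
      also have "norm (?f x * p_power p (\<phi> x)) powr (p / (p - 1)) = \<bar>?f x\<bar> powr q * ?\<eta> x"
        using norm_p_power_conjugate[OF p(1), of "\<phi> x"] by (simp add: abs_mult powr_mult q_def)
      also have "norm (grad \<phi> x \<bullet> e) powr p \<le> norm (grad \<phi> x) powr p"
        using Cauchy_Schwarz_ineq2[of "grad \<phi> x" e] e p by (intro powr_mono2) auto
      finally show ?thesis by (simp add: algebra_simps)
    next
      case False
      then show ?thesis using S grad_eq_0_outside[OF compact_imp_closed[OF S(1)], of "\<lambda>x. ?\<eta> x * ?f x" x] by simp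
    qed
  qed (use ig i\<eta> in auto)
  finally show ?thesis using ig i\<eta> by simp
qed

end

lemma (in p_eigenfunction) ev_ge_slab:
  assumes "norm e = 1" "\<epsilon> > 0" "\<And>x. x \<in> \<Omega> \<Longrightarrow> \<bar>x \<bullet> e\<bar> < \<epsilon> * comparison_ode.len p (p / (p - 1))"
  shows "(p - 1) * \<epsilon> powr (- p) \<le> ev"
proof -
  interpret comparison_ode p "p / (p - 1)" using p by unfold_locales auto
  obtain \<phi> where \<phi>: "\<And>n::nat. test_function \<Omega> (\<phi> n)"
    "(\<lambda>n. Lp_pow p \<Omega> (\<lambda>x. \<phi> n x - u x)) \<longlonglongrightarrow> 0" "(\<lambda>n. Lp_pow p \<Omega> (\<lambda>x. grad (\<phi> n) x - Du x)) \<longlonglongrightarrow> 0"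
    using W unfolding W01p_def by blast
  note L = test_function_Lp[OF \<phi>(1) p1(3)]
  have "(p - 1) * \<epsilon> powr (- p) * Lp_pow p \<Omega> u \<le> Lp_pow p \<Omega> Du"
  proof (rule LIMSEQ_le)
    show "(\<lambda>n. (p - 1) * \<epsilon> powr (- p) * Lp_pow p \<Omega> (\<phi> n)) \<longlonglongrightarrow> (p - 1) * \<epsilon> powr (- p) * Lp_pow p \<Omega> u"
      "(\<lambda>n. Lp_pow p \<Omega> (grad (\<phi> n))) \<longlonglongrightarrow> Lp_pow p \<Omega> Du"
      by (intro tendsto_mult tendsto_const Lp_pow_tendsto p p1 u_Lp L \<phi>)+
    show "\<exists>N. \<forall>n\<ge>N. (p - 1) * \<epsilon> powr (- p) * Lp_pow p \<Omega> (\<phi> n) \<le> Lp_pow p \<Omega> (grad (\<phi> n))"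
      unfolding Lp_pow_cut L(3,4)[THEN fun_cong] real_norm_def
      using slab_Poincare[OF test_function_imp_C1_compact[OF \<phi>(1)] assms] by simp
  qed
  also have "Lp_pow p \<Omega> Du = ev * Lp_pow p \<Omega> u" by (simp add: ev_mult)
  finally show ?thesis using Lp_pow_u_pos by simp
qed

section \<open>Boxes and the projection orthogonal to \<open>e\<close>\<close>

definition slab_box :: "'a::euclidean_space \<Rightarrow> real \<Rightarrow> real \<Rightarrow> 'a set" where
  "slab_box e a h = {x. \<forall>b\<in>Basis. \<bar>x \<bullet> b\<bar> \<le> (if b = e then h else a)}"

lemma slab_box_eq_cbox:
  "slab_box e a h = cbox (- (\<Sum>b\<in>Basis. (if b = e then h else a) *\<^sub>R b)) (\<Sum>b\<in>Basis. (if b = e then h else a) *\<^sub>R b)"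
  unfolding slab_box_def
  by (rule set_eqI) (auto simp: mem_box inner_sum_left_Basis abs_le_iff; smt (verit) minus_le_iff)

lemma measure_slab_box:
  fixes e :: "'a::euclidean_space"
  assumes "e \<in> Basis" "a \<ge> 0" "h \<ge> 0"
  shows "measure lebesgue (slab_box e a h) = (2 * a) ^ (DIM('a) - 1) * (2 * h)"
proof -
  let ?v = "\<lambda>b. if b = e then h else a"
  have "measure lebesgue (slab_box e a h) = (\<Prod>b\<in>Basis. 2 * ?v b)"
  proof -
    define v where "v = (\<Sum>b\<in>Basis. ?v b *\<^sub>R b)"
    have v: "v \<bullet> b = ?v b" if "b \<in> Basis" for b using that by (simp add: v_def inner_sum_left_Basis)
    have "measure lebesgue (cbox (- v) v) = measure lborel (cbox (- v) v)"
      by (simp add: measure_completion)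
    also have "\<dots> = (\<Prod>b\<in>Basis. v \<bullet> b - (- v) \<bullet> b)"
      using assms v by (intro content_cbox) (auto simp: v)
    also have "\<dots> = (\<Prod>b\<in>Basis. 2 * ?v b)" using v by (intro prod.cong) auto
    finally show ?thesis unfolding slab_box_eq_cbox v_def .
  qed
  also have "\<dots> = 2 * h * (\<Prod>b\<in>Basis - {e}. 2 * ?v b)"
    using assms(1) by (subst prod.remove[of _ e]) auto
  also have "(\<Prod>b\<in>Basis - {e}. 2 * ?v b) = (\<Prod>b\<in>(Basis - {e}). 2 * a)" by (rule prod.cong) auto
  also have "\<dots> = (2 * a) ^ (DIM('a) - 1)" using assms(1) by (simp add: card_Diff_singleton)
  finally show ?thesis by simp
qed

lemma compact_slab_box: "compact (slab_box e a h)"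
  by (simp add: slab_box_eq_cbox)

lemma integrable_slab_box: "integrable lebesgue (\<lambda>x. c * indicator (slab_box e a h) x :: real)"
  by (rule integrable_lebesgue_indicator_compact[OF compact_slab_box])

lemma integral_slab_box:
  fixes e :: "'a::euclidean_space"
  assumes "e \<in> Basis" "a \<ge> 0" "h \<ge> 0"
  shows "(\<integral>x. c * indicator (slab_box e a h) x \<partial>lebesgue) = c * ((2 * a) ^ (DIM('a) - 1) * (2 * h))"
  using measure_slab_box[OF assms] by simp

definition perp :: "'a::euclidean_space \<Rightarrow> 'a \<Rightarrow> 'a" where "perp e x = x - (x \<bullet> e) *\<^sub>R e"

lemma perp_inner:
  assumes "norm e = 1"
  shows "perp e x \<bullet> e = 0" "x \<bullet> perp e y = perp e x \<bullet> perp e y"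
    "x \<bullet> x = (x \<bullet> e)\<^sup>2 + (norm (perp e x))\<^sup>2" "perp e (x + t *\<^sub>R e) = perp e x"
proof -
  have ee: "e \<bullet> e = 1" using assms by (simp add: dot_square_norm)
  show "perp e x \<bullet> e = 0" by (simp add: perp_def inner_diff_left ee)
  show "x \<bullet> perp e y = perp e x \<bullet> perp e y"
    by (simp add: perp_def inner_diff_left inner_diff_right ee inner_commute[of e y])
  show "perp e (x + t *\<^sub>R e) = perp e x" by (simp add: perp_def inner_add_left ee scaleR_add_left)
  show "x \<bullet> x = (x \<bullet> e)\<^sup>2 + (norm (perp e x))\<^sup>2"
    unfolding power2_norm_eq_inner perp_def
    by (simp add: inner_diff_left inner_diff_right ee inner_commute[of e x] power2_eq_square)
qed

lemma perp_inner_Basis: "e \<in> Basis \<Longrightarrow> b \<in> Basis \<Longrightarrow> b \<noteq> e \<Longrightarrow> perp e x \<bullet> b = x \<bullet> b"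
  by (simp add: perp_def inner_diff_left inner_not_same_Basis)

section \<open>The slab weight and the transverse cutoff\<close>

context comparison_ode
begin

definition vs :: "real \<Rightarrow> real \<Rightarrow> real" where "vs \<epsilon> s = V (s / \<epsilon>)"

lemma DERIV_vs:
  assumes "\<epsilon> > 0"
  shows "(vs \<epsilon> has_real_derivative p * vs \<epsilon> s * p_power q (ws \<epsilon> s)) (at s)"
proof -
  have "((\<lambda>s. s / \<epsilon>) has_real_derivative 1 / \<epsilon>) (at s)" using DERIV_cdivide[OF DERIV_ident] .
  from DERIV_chain2[OF DERIV_V this]
  have "(vs \<epsilon> has_real_derivative V' (s / \<epsilon>) * (1 / \<epsilon>)) (at s)" by (simp add: vs_def[abs_def])
  moreover have "p_power q (ws \<epsilon> s) = 1 / \<epsilon> * p_power q (w (s / \<epsilon>))"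
  proof -
    have "(1 - p) * (q - 1) = - 1" using pq(2) by (simp add: algebra_simps)
    then have "(\<epsilon> powr (1 - p)) powr (q - 1) = 1 / \<epsilon>"
      using assms by (simp add: powr_powr powr_minus field_simps)
    then show ?thesis
      using p_power_scale[of "\<epsilon> powr (1 - p)" q "w (s / \<epsilon>)"] assms by (simp add: ws_def)
  qed
  ultimately show ?thesis by (simp add: V'_def vs_def mult_ac)
qed

lemma continuous_on_vs [continuous_intros]:
  "\<epsilon> > 0 \<Longrightarrow> continuous_on S f \<Longrightarrow> continuous_on S (\<lambda>x. vs \<epsilon> (f x))"
  unfolding vs_def by (auto intro!: continuous_intros)

text \<open>The factor \<open>ws\<close> blows up at the faces, but the product is the derivative of
  \<open>vs\<close>, which is continuous on the whole line.\<close>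

lemma continuous_on_vs':
  assumes "\<epsilon> > 0" "continuous_on S f"
  shows "continuous_on S (\<lambda>x. p * vs \<epsilon> (f x) * p_power q (ws \<epsilon> (f x)))"
proof -
  have "p * vs \<epsilon> s * p_power q (ws \<epsilon> s) = V' (s / \<epsilon>) * (1 / \<epsilon>)" for s
  proof -
    have "((\<lambda>s. s / \<epsilon>) has_real_derivative 1 / \<epsilon>) (at s)" using DERIV_cdivide[OF DERIV_ident] .
    from DERIV_chain2[OF DERIV_V this]
    have "(vs \<epsilon> has_real_derivative V' (s / \<epsilon>) * (1 / \<epsilon>)) (at s)" by (simp add: vs_def[abs_def])
    then show ?thesis using DERIV_vs[OF assms(1), of s] by (rule DERIV_unique[symmetric])
  qed
  then show ?thesis using assms by (auto intro!: continuous_intros)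
qed

text \<open>\<open>flux_div\<close> is the derivative of \<open>ws vs\<close>, hence has mean zero against every weight that does
  not depend on the transverse variable.\<close>

definition flux_div :: "real \<Rightarrow> real \<Rightarrow> real" where
  "flux_div \<epsilon> s = (if \<bar>s\<bar> < \<epsilon> * len then \<epsilon> powr (- p) * (1 - p * vs \<epsilon> s) else 0)"

lemma DERIV_flux:
  assumes "\<epsilon> > 0" "\<bar>s\<bar> \<noteq> \<epsilon> * len"
  shows "((\<lambda>s. \<epsilon> powr (1 - p) * F (s / \<epsilon>)) has_real_derivative flux_div \<epsilon> s) (at s)"
proof -
  have 1: "((\<lambda>s. s / \<epsilon>) has_real_derivative 1 / \<epsilon>) (at s)" using DERIV_cdivide[OF DERIV_ident] .
  have "\<epsilon> powr (1 - p) = \<epsilon> * \<epsilon> powr (- p)" using assms by (simp add: powr_diff powr_minus field_simps)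
  then have e: "\<epsilon> powr (1 - p) * (c * (1 / \<epsilon>)) = \<epsilon> powr (- p) * c" for c using assms by simp
  show ?thesis
  proof (cases "\<bar>s\<bar> < \<epsilon> * len")
    case True
    then have "\<bar>s / \<epsilon>\<bar> < len" using assms by (simp add: field_simps)
    from DERIV_cmult[OF DERIV_chain2[OF DERIV_F[OF this] 1], of "\<epsilon> powr (1 - p)"]
    show ?thesis using True unfolding e by (simp add: flux_div_def vs_def)
  next
    case False
    then have "\<bar>s / \<epsilon>\<bar> > len" using assms by (simp add: field_simps)
    from DERIV_cmult[OF DERIV_chain2[OF DERIV_F_outside[OF this] 1], of "\<epsilon> powr (1 - p)"]
    show ?thesis using False by (simp add: flux_div_def)
  qed
qed

text \<open>Splits \<open>|W|^q v^p\<close> into a divergence, which integrates to 0, and the slab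
  value \<open>(p - 1) \<epsilon>^(-p)\<close> times \<open>v^p\<close>, which is compared with the
  eigenvalue of the domain.\<close>

lemma vs_mult_ws:
  assumes "\<epsilon> > 0" "\<bar>s\<bar> < \<epsilon> * len"
  shows "vs \<epsilon> s * \<bar>ws \<epsilon> s\<bar> powr q = flux_div \<epsilon> s + (p - 1) * \<epsilon> powr (- p) * vs \<epsilon> s"
proof -
  have "\<bar>s / \<epsilon>\<bar> < len" using assms by (simp add: field_simps)
  from V_mult[OF this] have "vs \<epsilon> s * \<bar>ws \<epsilon> s\<bar> powr q = \<epsilon> powr (- p) * (1 - vs \<epsilon> s)"
    using abs_ws_powr[OF assms(1), of s] by (simp add: vs_def mult_ac)
  then show ?thesis using assms(2) by (simp add: flux_div_def algebra_simps)
qed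

text \<open>Constant along \<open>e\<close>. Its square is used as weight: this is C^1 despite the
  truncation, and its gradient is at most \<open>4 / L\<close> times the cutoff itself, the form in
  which the cost can be absorbed.\<close>

definition cutoff :: "'a::euclidean_space \<Rightarrow> real \<Rightarrow> 'a \<Rightarrow> real" where
  "cutoff e L x = max 0 (1 - (norm (perp e x))\<^sup>2 / L\<^sup>2)"

lemma GDERIV_cutoff:
  assumes e: "norm e = 1"
  shows "GDERIV (\<lambda>x. (cutoff e L x)\<^sup>2) x :> (- (4 * cutoff e L x / L\<^sup>2)) *\<^sub>R perp e x"
proof -
  let ?k = "\<lambda>x. 1 - (x \<bullet> x - (x \<bullet> e)\<^sup>2) / L\<^sup>2"
  have k: "(norm (perp e x))\<^sup>2 = x \<bullet> x - (x \<bullet> e)\<^sup>2" for x using perp_inner(3)[OF e, of x] by simp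
  have m: "((\<lambda>s. (max 0 s)\<^sup>2) has_real_derivative 2 * max 0 s) (at s)" for s :: real
  proof -
    consider "s > 0" | "s < 0" | "s = 0" by linarith
    then show ?thesis
    proof cases
      case 1
      have "((\<lambda>s. s\<^sup>2) has_real_derivative 2 * max 0 s) (at s)" using 1 by (auto intro!: derivative_eq_intros)
      then show ?thesis by (rule has_field_derivative_transform_within_open[where S="{0<..}"]) (use 1 in auto)
    next
      case 2
      have "((\<lambda>s. 0) has_real_derivative 2 * max 0 s) (at s)" using 2 by simp
      then show ?thesis by (rule has_field_derivative_transform_within_open[where S="{..<0}"]) (use 2 in auto)
    next
      case 3
      have "((\<lambda>s. (max 0 s)\<^sup>2) has_real_derivative 0) (at (0::real))"
      proof (rule DERIV_0_I)
        fix c :: real assume "c > 0"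
        have "\<bar>(max 0 s)\<^sup>2\<bar> \<le> c * \<bar>s - 0\<bar>" if "\<bar>s - 0\<bar> < c" for s :: real
        proof (cases "s > 0")
          case True
          then show ?thesis using that mult_right_mono[of s c s] by (simp add: power2_eq_square)
        next
          case False
          then have "max 0 s = 0" by simp
          moreover have "0 \<le> c * \<bar>s - 0\<bar>" using \<open>c > 0\<close> by (intro mult_nonneg_nonneg) auto
          ultimately show ?thesis by (simp only: power2_eq_square mult_zero_left abs_zero)
        qed
        then show "\<exists>d>0. \<forall>s::real. \<bar>s - 0\<bar> < d \<longrightarrow> \<bar>(max 0 s)\<^sup>2\<bar> \<le> c * \<bar>s - 0\<bar>" using \<open>c > 0\<close> by blast
      qed simp
      then show ?thesis using 3 by simp
    qed
  qed
  have "((\<lambda>x. x \<bullet> x) has_derivative (\<lambda>h. x \<bullet> h + h \<bullet> x)) (at x)"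
    by (intro has_derivative_inner has_derivative_ident)
  then have 1: "GDERIV (\<lambda>x. x \<bullet> x) x :> 2 *\<^sub>R x"
    by (simp add: gderiv_def inner_commute)
  have 2: "GDERIV (\<lambda>x. x \<bullet> e) x :> e"
    unfolding gderiv_def by (intro has_derivative_inner_left has_derivative_ident)
  have 3: "DERIV (\<lambda>y. 1 - y / L\<^sup>2) y :> - (1 / L\<^sup>2)" for y
    using DERIV_diff[OF DERIV_const DERIV_cdivide[OF DERIV_ident]] by simp
  have "GDERIV ?k x :> (- (1 / L\<^sup>2)) *\<^sub>R (2 *\<^sub>R x - ((x \<bullet> e) *\<^sub>R e + (x \<bullet> e) *\<^sub>R e))"
    unfolding power2_eq_square[of "_ \<bullet> e"]
    by (rule GDERIV_DERIV_compose[OF GDERIV_diff[OF 1 GDERIV_mult[OF 2 2]] 3])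
  then have "GDERIV ?k x :> (- (2 / L\<^sup>2)) *\<^sub>R perp e x"
    by (rule GDERIV_subst) (simp add: perp_def scaleR_diff_right scaleR_add_left[symmetric])
  from GDERIV_DERIV_compose[OF this m]
  show ?thesis by (simp add: cutoff_def k)
qed

lemma cutoff_bounds: "0 \<le> cutoff e L x" "cutoff e L x \<le> 1"
  by (auto simp: cutoff_def)

lemma cutoff_eq_0: "L > 0 \<Longrightarrow> norm (perp e x) \<ge> L \<Longrightarrow> cutoff e L x = 0"
  by (simp add: cutoff_def power_mono)

lemma continuous_on_cutoff: "continuous_on UNIV (cutoff e L)"
  unfolding cutoff_def perp_def by (cases "L = 0") (auto intro!: continuous_intros)

lemma compact_cylinder:
  assumes e: "norm e = 1"
  shows "compact {x. norm (perp e x) \<le> L \<and> \<bar>x \<bullet> e\<bar> \<le> h}"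
proof -
  have "closed {x. norm (perp e x) \<le> L \<and> \<bar>x \<bullet> e\<bar> \<le> h}"
    unfolding perp_def by (intro closed_Collect_conj closed_Collect_le continuous_intros)
  moreover have "bounded {x. norm (perp e x) \<le> L \<and> \<bar>x \<bullet> e\<bar> \<le> h}"
  proof (rule boundedI)
    fix x assume x: "x \<in> {x. norm (perp e x) \<le> L \<and> \<bar>x \<bullet> e\<bar> \<le> h}"
    have "x = perp e x + (x \<bullet> e) *\<^sub>R e" by (simp add: perp_def)
    then have "norm x \<le> norm (perp e x) + norm ((x \<bullet> e) *\<^sub>R e)" by (metis norm_triangle_ineq)
    then show "norm x \<le> L + h" using x e by simp
  qed
  ultimately show ?thesis by (simp add: compact_eq_bounded_closed)
qed

lemma cylinder_subset_box:
  assumes "e \<in> Basis" "norm (perp e x) \<le> L" "\<bar>x \<bullet> e\<bar> \<le> h"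
  shows "x \<in> slab_box e L h"
proof -
  have "\<bar>x \<bullet> b\<bar> \<le> L" if "b \<in> Basis" "b \<noteq> e" for b
    using Basis_le_norm[OF that(1), of "perp e x"] perp_inner_Basis[OF assms(1) that] assms(2) by simp
  then show ?thesis using assms(3) by (auto simp: slab_box_def)
qed

text \<open>The weight is constant in the direction \<open>e\<close>, along which the flux is
  differentiated. The flux is Lipschitz, and the two faces where it fails to be differentiable are
  hyperplanes, hence null.\<close>

lemma integral_flux_div_eq_0:
  fixes e :: "'a::euclidean_space"
  assumes e: "norm e = 1" and \<epsilon>: "\<epsilon> > 0" and L: "L > 0"
  shows "(\<integral>x. (cutoff e L x)\<^sup>2 * flux_div \<epsilon> (x \<bullet> e) \<partial>lebesgue) = 0"
    "integrable lebesgue (\<lambda>x. (cutoff e L x)\<^sup>2 * flux_div \<epsilon> (x \<bullet> e))"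
proof -
  let ?F = "\<lambda>s. \<epsilon> powr (1 - p) * F (s / \<epsilon>)"
  let ?g = "\<lambda>x. (cutoff e L x)\<^sup>2 * ?F (x \<bullet> e)" and ?g' = "\<lambda>x. (cutoff e L x)\<^sup>2 * flux_div \<epsilon> (x \<bullet> e)"
  let ?S = "{x. norm (perp e x) \<le> L \<and> \<bar>x \<bullet> e\<bar> \<le> \<epsilon> * len}"
  have cF: "continuous_on UNIV (\<lambda>x. F (x \<bullet> e / \<epsilon>))" for e :: 'a
    by (rule continuous_on_compose2[of UNIV F])
      (use \<epsilon> in \<open>auto intro!: continuous_at_imp_continuous_on isCont_F continuous_intros\<close>)
  have c: "continuous_on UNIV ?g" by (intro continuous_intros continuous_on_cutoff cF)
  have 0: "?g x = 0" if "x \<notin> ?S" for x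
  proof (cases "norm (perp e x) \<le> L")
    case True
    then have "\<bar>x \<bullet> e / \<epsilon>\<bar> \<ge> len" using that \<epsilon> by (simp add: field_simps)
    then show ?thesis by (simp add: F_eq_0)
  qed (use L in \<open>simp add: cutoff_eq_0\<close>)
  have ce: "cutoff e L (x + t *\<^sub>R e) = cutoff e L x" for x t by (simp add: cutoff_def perp_inner(4)[OF e])
  have te: "(x + t *\<^sub>R e) \<bullet> e = x \<bullet> e + t" for x t using e by (simp add: inner_add_left dot_square_norm)
  have lip: "\<bar>?g (x + t *\<^sub>R e) - ?g x\<bar> \<le> \<epsilon> powr (1 - p) * ((1 + p) / \<epsilon>) * \<bar>t\<bar>" for x t
  proof -
    have "\<bar>F ((x \<bullet> e + t) / \<epsilon>) - F (x \<bullet> e / \<epsilon>)\<bar> \<le> (1 + p) * \<bar>(x \<bullet> e + t) / \<epsilon> - x \<bullet> e / \<epsilon>\<bar>" by (rule F_lipschitz)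
    also have "(x \<bullet> e + t) / \<epsilon> - x \<bullet> e / \<epsilon> = t / \<epsilon>" by (simp add: add_divide_distrib)
    also have "(1 + p) * \<bar>t / \<epsilon>\<bar> = (1 + p) / \<epsilon> * \<bar>t\<bar>" using \<epsilon> by simp
    finally have le: "\<bar>F ((x \<bullet> e + t) / \<epsilon>) - F (x \<bullet> e / \<epsilon>)\<bar> \<le> (1 + p) / \<epsilon> * \<bar>t\<bar>" .
    have "\<bar>?g (x + t *\<^sub>R e) - ?g x\<bar> = (cutoff e L x)\<^sup>2 * (\<epsilon> powr (1 - p) * \<bar>F ((x \<bullet> e + t) / \<epsilon>) - F (x \<bullet> e / \<epsilon>)\<bar>)"
      unfolding ce te by (simp add: abs_mult right_diff_distrib[symmetric])
    also have "\<dots> \<le> 1 * (\<epsilon> powr (1 - p) * ((1 + p) / \<epsilon> * \<bar>t\<bar>))"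
      using le cutoff_bounds[of e L x] by (intro mult_mono) (auto simp: power_le_one intro!: mult_left_mono)
    finally show ?thesis by (simp add: mult.assoc)
  qed
  have m: "?g' \<in> borel_measurable lebesgue"
  proof (rule measurable_completion)
    have [measurable]: "cutoff e L \<in> borel_measurable borel" by (rule borel_measurable_continuous_onI[OF continuous_on_cutoff])
    have [measurable]: "vs \<epsilon> \<in> borel_measurable borel"
      by (rule borel_measurable_continuous_onI) (intro continuous_intros \<epsilon>)
    show "?g' \<in> borel_measurable lborel" unfolding flux_div_def by measurable
  qed
  have n: "negligible {x. e \<bullet> x = c}" for c using e by (intro negligible_hyperplane) auto
  have "AE x in lebesgue. x \<notin> {x. e \<bullet> x = \<epsilon> * len}" "AE x in lebesgue. x \<notin> {x. e \<bullet> x = - (\<epsilon> * len)}"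
    by (rule AE_not_in, use n in \<open>simp add: negligible_iff_null_sets\<close>)+
  then have ae: "AE x in lebesgue. ((\<lambda>t. ?g (x + t *\<^sub>R e)) has_real_derivative ?g' x) (at 0)"
  proof eventually_elim
    case (elim x)
    then have "\<bar>x \<bullet> e\<bar> \<noteq> \<epsilon> * len" by (auto simp: inner_commute abs_if split: if_splits)
    from DERIV_flux[OF \<epsilon> this] have "(?F has_real_derivative flux_div \<epsilon> (x \<bullet> e)) (at (0 + x \<bullet> e))" by simp
    then have "((\<lambda>t. ?F (t + x \<bullet> e)) has_real_derivative flux_div \<epsilon> (x \<bullet> e)) (at 0)"
      by (subst (asm) DERIV_shift)
    then have "((\<lambda>t. ?F (x \<bullet> e + t)) has_real_derivative flux_div \<epsilon> (x \<bullet> e)) (at 0)"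
      by (simp add: add.commute)
    then show ?case unfolding ce te by (rule DERIV_cmult)
  qed
  show "integral\<^sup>L lebesgue ?g' = 0" "integrable lebesgue ?g'"
    using integral_directional_derivative_eq_0[OF c compact_cylinder[OF e] 0 lip m ae] by blast+
qed

section \<open>Energy estimate for the transverse part of \<open>X\<close>\<close>

lemma absorb_constant:
  assumes "K \<ge> 0"
  obtains C where "C \<ge> 0" "\<And>y. y \<ge> 0 \<Longrightarrow> K * y \<le> (p - 1) / 2 * y powr q + C"
proof
  \<comment> \<open>Solves \<open>(p - 1) / 2 * z powr (q - 1) = K\<close>: beyond \<open>z\<close>
    the power term exceeds \<open>K * y\<close>, and up to \<open>z\<close> the constant
    \<open>K * z\<close> does.\<close>
  define z where "z = (2 * K / (p - 1)) powr (1 / (q - 1))"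
  have z: "z \<ge> 0" "(p - 1) / 2 * z powr (q - 1) = K"
    using p q_gt_2 assms by (auto simp: z_def powr_powr)
  show "K * z \<ge> 0" using assms z by simp
  fix y :: real assume y: "y \<ge> 0"
  show "K * y \<le> (p - 1) / 2 * y powr q + K * z"
  proof (cases "y \<le> z")
    case True
    then have "K * y \<le> K * z" using assms by (intro mult_left_mono)
    then show ?thesis using p by (simp add: add_increasing)
  next
    case False
    then have "z powr (q - 1) \<le> y powr (q - 1)" using z q_gt_2 by (intro powr_mono2) auto
    then have "(p - 1) / 2 * z powr (q - 1) * y \<le> (p - 1) / 2 * y powr (q - 1) * y"
      using p y by (intro mult_right_mono mult_left_mono) auto
    also have "\<dots> = (p - 1) / 2 * y powr q" using False z by (simp add: powr_diff)
    finally have "K * y \<le> (p - 1) / 2 * y powr q" using z(2) by simp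
    then show ?thesis using assms z by (simp add: add_increasing2)
  qed
qed

lemma absorb_quadratic:
  fixes a K t :: real
  assumes "a > 0"
  shows "K * t \<le> a * t\<^sup>2 + K\<^sup>2 / (4 * a)"
proof -
  have "0 \<le> (2 * a * t - K)\<^sup>2 / (4 * a)" using assms by simp
  also have "\<dots> = a * t\<^sup>2 - K * t + K\<^sup>2 / (4 * a)"
    using assms by (simp add: power2_eq_square field_simps)
  finally show ?thesis by simp
qed

text \<open>The last two summands bound the cost of the cutoff: near the mid-plane, where \<open>ws\<close> vanishes,
  only a constant is available, but elsewhere \<open>|ws|\<^bsup>q-2\<^esup>\<close> has size \<open>\<epsilon>\<^bsup>p-2\<^esup>\<close>. This is where
  \<open>p < 2\<close> enters.\<close>

lemma cutoff_cost:
  fixes X e :: "'a::euclidean_space"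
  assumes e: "norm e = 1" and \<epsilon>: "\<epsilon> > 0" and \<sigma>: "0 < \<sigma>" "\<sigma> < len" and s: "\<bar>s\<bar> < \<epsilon> * len" and K: "K \<ge> 0"
    and m: "0 \<le> m" "m \<le> 1"
    and C1: "\<And>y. y \<ge> 0 \<Longrightarrow> K * y \<le> (p - 1) / 2 * y powr q + C1" "C1 \<ge> 0"
  defines "B \<equiv> norm X powr q - \<bar>ws \<epsilon> s\<bar> powr q - q * (\<bar>ws \<epsilon> s\<bar> powr (q - 2) * ws \<epsilon> s) * (X \<bullet> e - ws \<epsilon> s)"
  shows "K * (m * norm (perp e X)) \<le> (p - 1) / 2 * (m\<^sup>2 * B) + (if \<bar>s\<bar> \<le> \<epsilon> * \<sigma> then C1 else 0)
     + K\<^sup>2 / (p * \<bar>w \<sigma>\<bar> powr (q - 2)) * \<epsilon> powr (2 - p)"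
proof -
  have B: "norm (perp e X) powr q \<le> B" "q / 2 * \<bar>ws \<epsilon> s\<bar> powr (q - 2) * (norm (perp e X))\<^sup>2 \<le> B"
    unfolding B_def perp_def using q_gt_2 e by (intro Bregman_lower_bounds; simp)+
  let ?t = "m * norm (perp e X)" and ?C2 = "K\<^sup>2 / (p * \<bar>w \<sigma>\<bar> powr (q - 2)) * \<epsilon> powr (2 - p)"
  have C2: "?C2 \<ge> 0" using p by simp
  show ?thesis
  proof (cases "\<bar>s\<bar> \<le> \<epsilon> * \<sigma>")
    case True
    \<comment> \<open>Since \<open>m\<close> lies between 0 and 1 and \<open>q > 2\<close>, the
      power of the cutoff produced by the first Bregman bound is at most the available weight
      \<open>m^2\<close>.\<close>
    have "m powr q \<le> m\<^sup>2"
    proof (cases "m = 0")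
      case False
      then have "m powr q \<le> m powr 2" using m q_gt_2 by (intro powr_mono') auto
      then show ?thesis using m False by simp
    qed (use q_gt_2 in simp)
    then have "?t powr q \<le> m\<^sup>2 * B"
      unfolding powr_mult using B(1) by (intro mult_mono) auto
    then have "(p - 1) / 2 * ?t powr q \<le> (p - 1) / 2 * (m\<^sup>2 * B)" using p by (intro mult_left_mono) auto
    then show ?thesis using C1(1)[of ?t] m True C2 by simp
  next
    case False
    have s': "\<bar>s / \<epsilon>\<bar> < len" using s \<epsilon> by (simp add: field_simps)
    have w0: "\<bar>w \<sigma>\<bar> > 0" using w_nonzero[of \<sigma>] \<sigma> by simp
    have "\<bar>w \<sigma>\<bar> \<le> \<bar>w (s / \<epsilon>)\<bar>" using False s' \<epsilon> \<sigma> by (intro abs_w_mono) (auto simp: field_simps)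
    then have "\<bar>w \<sigma>\<bar> powr (q - 2) \<le> \<bar>w (s / \<epsilon>)\<bar> powr (q - 2)" using q_gt_2 by (intro powr_mono2) auto
    moreover have "\<bar>ws \<epsilon> s\<bar> powr (q - 2) = \<epsilon> powr (p - 2) * \<bar>w (s / \<epsilon>)\<bar> powr (q - 2)"
    proof -
      have "(1 - p) * (q - 2) = p - 2" using pq by (simp add: algebra_simps)
      then show ?thesis by (simp add: ws_def abs_mult powr_mult powr_powr)
    qed
    ultimately have le: "\<epsilon> powr (p - 2) * \<bar>w \<sigma>\<bar> powr (q - 2) \<le> \<bar>ws \<epsilon> s\<bar> powr (q - 2)"
      by (simp add: mult_left_mono)
    \<comment> \<open>The coefficient that \<open>(p - 1) / 2\<close> times the second Bregman bound
      pays for, since \<open>(p - 1) / 2 * (q / 2) = p / 4\<close>; its inverse contributes the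
      power \<open>\<epsilon> powr (2 - p)\<close>.\<close>
    define a where "a = p / 4 * (\<epsilon> powr (p - 2) * \<bar>w \<sigma>\<bar> powr (q - 2))"
    have a: "a > 0" using p \<epsilon> w0 by (simp add: a_def)
    have "K * ?t \<le> a * ?t\<^sup>2 + K\<^sup>2 / (4 * a)" by (rule absorb_quadratic[OF a])
    also have "K\<^sup>2 / (4 * a) = ?C2"
      using \<epsilon> by (simp add: a_def powr_diff field_simps)
    also have "a * ?t\<^sup>2 \<le> (p - 1) / 2 * (m\<^sup>2 * B)"
    proof -
      have "a * ?t\<^sup>2 \<le> p / 4 * \<bar>ws \<epsilon> s\<bar> powr (q - 2) * ?t\<^sup>2"
        unfolding a_def using p le by (intro mult_right_mono mult_left_mono) auto
      also have "p / 4 = (p - 1) / 2 * (q / 2)" using pq(1) by (simp add: field_simps)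
      also have "(p - 1) / 2 * (q / 2) * \<bar>ws \<epsilon> s\<bar> powr (q - 2) * ?t\<^sup>2
          = (p - 1) / 2 * (m\<^sup>2 * (q / 2 * \<bar>ws \<epsilon> s\<bar> powr (q - 2) * (norm (perp e X))\<^sup>2))"
        by (simp add: power_mult_distrib mult_ac)
      also have "\<dots> \<le> (p - 1) / 2 * (m\<^sup>2 * B)" using B(2) p by (intro mult_left_mono) auto
      finally show ?thesis .
    qed
    finally show ?thesis using False by simp
  qed
qed

text \<open>Half of the Bregman term \<open>(p - 1) \<zeta> V B\<close> absorbs the cost of the
  cutoff; the other half is kept on \<open>A\<close>, where both weights are at least
  \<open>1 / 2\<close>, whence the factor \<open>(p - 1) / 8\<close>. The height \<open>T 1\<close>
  is the one at which \<open>|w| = 1\<close>. On the right, \<open>C1\<close> is paid only in the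
  layer of relative thickness \<sigma>.\<close>

lemma energy_bound:
  fixes e :: "'a::euclidean_space"
  assumes pe: "p_eigenfunction p \<Omega> u Du" and e: "e \<in> Basis" and \<epsilon>: "\<epsilon> > 0" and L: "L > 0"
    and sub: "{x. norm (perp e x) \<le> L \<and> \<bar>x \<bullet> e\<bar> \<le> \<epsilon> * len} \<subseteq> \<Omega>"
    and E: "(p - 1) * \<epsilon> powr (- p) - first_eigenvalue p \<Omega> \<le> E" "E \<ge> 0"
    and \<sigma>: "0 < \<sigma>" "\<sigma> < len"
    and C1: "\<And>y. y \<ge> 0 \<Longrightarrow> 4 / L * y \<le> (p - 1) / 2 * y powr q + C1" "C1 \<ge> 0"
    and A: "compact A" "\<And>x. x \<in> A \<Longrightarrow> norm (perp e x) \<le> L / 2 \<and> \<bar>x \<bullet> e\<bar> \<le> \<epsilon> * T 1"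
  defines "C2 \<equiv> (4 / L)\<^sup>2 / (p * \<bar>w \<sigma>\<bar> powr (q - 2)) * \<epsilon> powr (2 - p)"
  shows "(p - 1) / 8 * (\<integral>x. indicator A x * norm (perp e (log_grad_field p u x)) powr q \<partial>lebesgue)
      \<le> C1 * ((2 * L) ^ (DIM('a) - 1) * (2 * (\<epsilon> * \<sigma>))) + (C2 + E) * ((2 * L) ^ (DIM('a) - 1) * (2 * (\<epsilon> * len)))"
proof -
  interpret p_eigenfunction p \<Omega> u Du by (rule pe)
  have e1: "norm e = 1" using e by simp
  let ?m = "cutoff e L" and ?K = "{x. norm (perp e x) \<le> L \<and> \<bar>x \<bullet> e\<bar> \<le> \<epsilon> * len}"
  define \<zeta> where "\<zeta> x = (?m x)\<^sup>2" for x :: 'a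
  define \<eta> where "\<eta> x = \<zeta> x * vs \<epsilon> (x \<bullet> e)" for x
  let ?W = "\<lambda>x. ws \<epsilon> (x \<bullet> e)" and ?V = "\<lambda>x. vs \<epsilon> (x \<bullet> e)"
  let ?dz = "\<lambda>x. (- (4 * ?m x / L\<^sup>2)) *\<^sub>R perp e x"
  let ?d\<eta> = "\<lambda>x. \<zeta> x *\<^sub>R ((p * ?V x * p_power q (?W x)) *\<^sub>R e) + ?V x *\<^sub>R ?dz x"
  have g\<eta>: "GDERIV \<eta> x :> ?d\<eta> x" for x
    unfolding \<eta>_def[abs_def] \<zeta>_def
    by (intro GDERIV_mult GDERIV_cutoff e1 GDERIV_DERIV_compose[OF GDERIV_inner_left DERIV_vs[OF \<epsilon>]])
  have V0: "?V x = 0" if "\<bar>x \<bullet> e\<bar> \<ge> \<epsilon> * len" for x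
  proof -
    have "\<not> \<bar>x \<bullet> e / \<epsilon>\<bar> < len" using that \<epsilon> by (simp add: field_simps)
    then show ?thesis by (simp add: vs_def V_def)
  qed
  have V_bd: "0 \<le> ?V x" "?V x \<le> 1" for x by (auto simp: vs_def V_nonneg V_le_1)
  have \<eta>0: "\<eta> x = 0" if "x \<notin> ?K" for x
    using that V0[of x] cutoff_eq_0[OF L, of e x] by (auto simp: \<eta>_def \<zeta>_def)
  have c\<eta>: "C1_compact \<Omega> \<eta>"
  proof (rule C1_compactI[OF compact_cylinder[OF e1] sub \<eta>0 g\<eta>])
    show "continuous_on UNIV ?d\<eta>"
      unfolding \<zeta>_def perp_def
      by (intro continuous_intros continuous_on_vs' \<epsilon> continuous_on_cutoff) (use L in auto)
  qed
  let ?Z = "\<lambda>x. X x \<bullet> grad \<eta> x - (p - 1) * norm (X x) powr (p / (p - 1)) * \<eta> x - ev * \<eta> x"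
  let ?Y = "\<lambda>x. norm (perp e (X x)) powr q"
  have point: "?Z x + (p - 1) / 8 * (indicator A x * ?Y x) \<le> \<zeta> x * flux_div \<epsilon> (x \<bullet> e)
      + C1 * indicator (slab_box e L (\<epsilon> * \<sigma>)) x + (C2 + E) * indicator (slab_box e L (\<epsilon> * len)) x" for x
  proof (cases "norm (perp e x) < L \<and> \<bar>x \<bullet> e\<bar> < \<epsilon> * len")
    case True
    let ?s = "x \<bullet> e"
    have x: "x \<in> \<Omega>" using sub True by auto
    define B where "B = norm (X x) powr q - \<bar>?W x\<bar> powr q - q * (\<bar>?W x\<bar> powr (q - 2) * ?W x) * (X x \<bullet> e - ?W x)"
    have B: "?Y x \<le> B" unfolding B_def perp_def using q_gt_2 e1 by (intro Bregman_lower_bounds) auto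
    then have B0: "B \<ge> 0" using powr_ge_zero order_trans by blast
    let ?i = "if \<bar>?s\<bar> \<le> \<epsilon> * \<sigma> then C1 else 0"
    have z01: "0 \<le> \<zeta> x" "\<zeta> x \<le> 1" using cutoff_bounds[of e L x] by (auto simp: \<zeta>_def power_le_one)
    \<comment> \<open>The terms linear in \<open>X \<bullet> e\<close> are taken up by
      \<open>B\<close>: the derivative of \<open>v^p\<close> contributes
      \<open>p P (X \<bullet> e)\<close>, and \<open>(p - 1) q = p\<close>. What remains of
      \<open>(p - 1) |X|^q\<close> is \<open>(p - 1) B\<close> and a source depending on
      \<open>W\<close> alone.\<close>
    have Z: "?Z x = ?V x * (X x \<bullet> ?dz x) - \<zeta> x * ?V x * ((p - 1) * B) + \<zeta> x * (?V x * \<bar>?W x\<bar> powr q - ev * ?V x)"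
    proof -
      define P where "P = p_power q (?W x)"
      have PW: "P * ?W x = \<bar>?W x\<bar> powr q" using p_power_inner_self[of q "?W x"] by (simp add: P_def)
      have Beq: "B = norm (X x) powr q - \<bar>?W x\<bar> powr q - q * P * (X x \<bullet> e - ?W x)"
        by (simp add: B_def P_def p_power_def)
      have "(p - 1) * B = (p - 1) * norm (X x) powr q - (p - 1) * \<bar>?W x\<bar> powr q
          - ((p - 1) * q) * (P * (X x \<bullet> e)) + ((p - 1) * q) * (P * ?W x)"
        by (subst Beq) (simp add: algebra_simps)
      then have B': "(p - 1) * B = (p - 1) * norm (X x) powr q - p * (P * (X x \<bullet> e)) + \<bar>?W x\<bar> powr q"
        unfolding pq(1) PW by (simp add: algebra_simps)
      show ?thesis unfolding B' P_def
        unfolding GDERIV_grad_eq[OF g\<eta>] \<eta>_def q_def[symmetric]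
        by (simp add: inner_add_right algebra_simps)
    qed
    have source: "\<zeta> x * (?V x * \<bar>?W x\<bar> powr q - ev * ?V x) \<le> \<zeta> x * flux_div \<epsilon> ?s + E"
    proof -
      have "?V x * \<bar>?W x\<bar> powr q = flux_div \<epsilon> ?s + (p - 1) * \<epsilon> powr (- p) * ?V x"
        using True by (intro vs_mult_ws \<epsilon>) simp
      moreover have "((p - 1) * \<epsilon> powr (- p) - ev) * ?V x \<le> E * ?V x" using E V_bd by (intro mult_right_mono) auto
      moreover have "E * ?V x \<le> E" using E V_bd by (simp add: mult_left_le)
      ultimately have "?V x * \<bar>?W x\<bar> powr q - ev * ?V x \<le> flux_div \<epsilon> ?s + E" by (simp add: algebra_simps)
      from mult_left_mono[OF this z01(1)] have "\<zeta> x * (?V x * \<bar>?W x\<bar> powr q - ev * ?V x) \<le> \<zeta> x * flux_div \<epsilon> ?s + \<zeta> x * E"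
        by (simp only: distrib_left)
      moreover have "\<zeta> x * E \<le> E" using E z01 by (simp add: mult_left_le_one_le)
      ultimately show ?thesis by linarith
    qed
    have "X x \<bullet> ?dz x \<le> 4 / L * (?m x * norm (perp e (X x)))"
    proof -
      have "X x \<bullet> ?dz x = - (4 * ?m x / L\<^sup>2) * (perp e (X x) \<bullet> perp e x)" 
        using perp_inner(2)[OF e1, of "X x" x] by simp
      also have "\<dots> \<le> (4 * ?m x / L\<^sup>2) * (norm (perp e (X x)) * L)"
      proof -
        have "- (perp e (X x) \<bullet> perp e x) \<le> norm (perp e (X x)) * norm (perp e x)"
          using Cauchy_Schwarz_ineq2[of "perp e (X x)" "perp e x"] by linarith
        also have "\<dots> \<le> norm (perp e (X x)) * L" using True by (intro mult_left_mono) auto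
        finally have "(4 * ?m x / L\<^sup>2) * - (perp e (X x) \<bullet> perp e x) \<le> (4 * ?m x / L\<^sup>2) * (norm (perp e (X x)) * L)"
          using cutoff_bounds[of e L x] by (intro mult_left_mono) auto
        then show ?thesis by simp
      qed
      also have "\<dots> = 4 / L * (?m x * norm (perp e (X x)))" using L by (simp add: power2_eq_square)
      finally show ?thesis .
    qed
    also have "\<dots> \<le> (p - 1) / 2 * (\<zeta> x * B) + ?i + C2"
      unfolding C2_def \<zeta>_def B_def
      by (rule cutoff_cost[OF e1 \<epsilon> \<sigma>]) (use True L C1 cutoff_bounds[of e L x] in auto)
    finally have "?V x * (X x \<bullet> ?dz x) \<le> ?V x * ((p - 1) / 2 * (\<zeta> x * B) + ?i + C2)"
      using V_bd(1) by (rule mult_left_mono)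
    moreover have "?V x * (?i + C2) \<le> 1 * (?i + C2)"
      using V_bd C1(2) p by (intro mult_right_mono) (auto simp: C2_def)
    moreover have "V * a - z * V * ((p - 1) * B) + r \<le> - ((p - 1) / 2 * (z * V * B)) + i + c + s"
      if "V * a \<le> V * ((p - 1) / 2 * (z * B) + i + c)" "V * (i + c) \<le> 1 * (i + c)" "r \<le> s"
      for V a z B i c r s :: real
      using that by (simp add: field_simps)
    ultimately have 1: "?Z x \<le> - ((p - 1) / 2 * (\<zeta> x * ?V x * B)) + ?i + C2 + (\<zeta> x * flux_div \<epsilon> ?s + E)"
      unfolding Z using source by blast
    have 2: "(p - 1) / 8 * (indicator A x * ?Y x) \<le> (p - 1) / 2 * (\<zeta> x * ?V x * B)"
    proof (cases "x \<in> A")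
      case True
      have T1: "T 1 > 0" using T_less_iff[of 0 1] T_spec(1) by simp
      have a: "norm (perp e x) \<le> L / 2" "\<bar>?s\<bar> \<le> \<epsilon> * T 1" using A(2)[OF True] by auto
      have "(norm (perp e x))\<^sup>2 \<le> (L / 2)\<^sup>2" using a by (intro power_mono) auto
      then have "(norm (perp e x))\<^sup>2 / L\<^sup>2 \<le> 1 / 4" using L by (simp add: field_simps power2_eq_square)
      then have "3 / 4 \<le> 1 - (norm (perp e x))\<^sup>2 / L\<^sup>2" by linarith
      then have "?m x \<ge> 3 / 4" unfolding cutoff_def by (rule order_trans) (rule max.cobounded2)
      then have "\<zeta> x \<ge> (3 / 4)\<^sup>2" unfolding \<zeta>_def by (intro power_mono) auto
      then have z: "\<zeta> x \<ge> 1 / 2" by (simp add: power2_eq_square)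
      have s: "\<bar>?s / \<epsilon>\<bar> \<le> \<bar>T 1\<bar>" "\<bar>T 1\<bar> < len" using a T1 T_less_len[of 1] \<epsilon> by (auto simp: field_simps)
      have "\<bar>w (?s / \<epsilon>)\<bar> \<le> \<bar>w (T 1)\<bar>" by (rule abs_w_mono[OF s])
      then have "\<bar>w (?s / \<epsilon>)\<bar> \<le> 1" by (simp add: w_T)
      then have "\<bar>w (?s / \<epsilon>)\<bar> powr q \<le> 1" using q_gt_2 by (intro powr_le1) auto
      moreover have "1 + \<bar>w (?s / \<epsilon>)\<bar> powr q > 0" by (auto intro: add_pos_nonneg)
      ultimately have v: "?V x \<ge> 1 / 2" using s unfolding vs_def V_def by (simp add: field_simps)
      have "1 / 2 * (1 / 2) * ?Y x \<le> \<zeta> x * ?V x * B" using z v B by (intro mult_mono) auto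
      then have "(p - 1) / 2 * (1 / 2 * (1 / 2) * ?Y x) \<le> (p - 1) / 2 * (\<zeta> x * ?V x * B)"
        using p by (intro mult_left_mono) auto
      then show ?thesis using True by simp
    qed (use p V_bd B0 in \<open>simp add: \<zeta>_def\<close>)
    have b1: "x \<in> slab_box e L (\<epsilon> * len)" using True by (intro cylinder_subset_box e) auto
    have "\<bar>?s\<bar> \<le> \<epsilon> * \<sigma> \<Longrightarrow> x \<in> slab_box e L (\<epsilon> * \<sigma>)" using True by (intro cylinder_subset_box e) auto
    then have b2: "(if \<bar>?s\<bar> \<le> \<epsilon> * \<sigma> then C1 else 0) \<le> C1 * indicator (slab_box e L (\<epsilon> * \<sigma>)) x"
      using C1(2) by auto
    show ?thesis using 1 2 b1 b2 by simp
  next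
    case False
    have "\<zeta> x = 0 \<and> ?dz x = 0 \<or> ?V x = 0"
      using False V0[of x] cutoff_eq_0[OF L, of e x] by (auto simp: \<zeta>_def not_less)
    then have \<eta>x: "\<eta> x = 0" "grad \<eta> x = 0" unfolding GDERIV_grad_eq[OF g\<eta>] by (auto simp: \<eta>_def)
    have xA: "x \<notin> A"
    proof
      assume "x \<in> A"
      from A(2)[OF this] have "norm (perp e x) < L" "\<bar>x \<bullet> e\<bar> < \<epsilon> * len"
        using L \<epsilon> T_less_len[of 1] by (auto intro: le_less_trans[OF _ mult_strict_left_mono])
      then show False using False by simp
    qed
    have zf: "\<zeta> x * flux_div \<epsilon> (x \<bullet> e) = 0"
      using False cutoff_eq_0[OF L, of e x] by (auto simp: \<zeta>_def flux_div_def not_less)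
    have "0 \<le> C2" using p by (simp add: C2_def)
    then show ?thesis using C1(2) E(2) unfolding \<eta>x zf using xA by simp
  qed
  have A\<Omega>: "A \<subseteq> \<Omega>"
  proof
    fix x assume "x \<in> A"
    from A(2)[OF this] have "norm (perp e x) \<le> L" "\<bar>x \<bullet> e\<bar> \<le> \<epsilon> * len"
      using L \<epsilon> T_less_len[of 1] by (auto intro: order_trans[OF _ mult_left_mono] simp: less_imp_le)
    then show "x \<in> \<Omega>" using sub by auto
  qed
  have iY: "integrable lebesgue (\<lambda>x. indicator A x * ?Y x)"
  proof -
    have "continuous_on A (\<lambda>x. perp e (X x))" unfolding perp_def
      by (intro continuous_intros continuous_on_subset[OF continuous_X A\<Omega>])
    then have "continuous_on A ?Y" using q_gt_2 by (intro continuous_on_powr' continuous_on_norm continuous_on_const) auto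
    from borel_integrable_compact[OF A(1) this] show ?thesis
      by (subst integrable_completion) auto
  qed
  note I = integrable_slab_box integral_flux_div_eq_0(2)[OF e1 \<epsilon> L, folded \<zeta>_def] log_integrand_integrable[OF c\<eta>]
  have iL: "integrable lebesgue (\<lambda>x. ?Z x + (p - 1) / 8 * (indicator A x * ?Y x))"
    by (intro Bochner_Integration.integrable_add I integrable_mult_right iY)
  have iF: "integrable lebesgue (\<lambda>x. \<zeta> x * flux_div \<epsilon> (x \<bullet> e) + C1 * indicator (slab_box e L (\<epsilon> * \<sigma>)) x)"
    by (intro Bochner_Integration.integrable_add I)
  have "(\<integral>x. ?Z x + (p - 1) / 8 * (indicator A x * ?Y x) \<partial>lebesgue) \<le>
      (\<integral>x. \<zeta> x * flux_div \<epsilon> (x \<bullet> e) + C1 * indicator (slab_box e L (\<epsilon> * \<sigma>)) x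
        + (C2 + E) * indicator (slab_box e L (\<epsilon> * len)) x \<partial>lebesgue)"
    by (rule integral_mono[OF iL Bochner_Integration.integrable_add[OF iF I(1)] point])
  also have "(\<integral>x. ?Z x + (p - 1) / 8 * (indicator A x * ?Y x) \<partial>lebesgue)
      = (p - 1) / 8 * (\<integral>x. indicator A x * ?Y x \<partial>lebesgue)"
    unfolding Bochner_Integration.integral_add[OF I(3) integrable_mult_right[OF iY]] log_equation[OF c\<eta>] by simp
  also have "(\<integral>x. \<zeta> x * flux_div \<epsilon> (x \<bullet> e) + C1 * indicator (slab_box e L (\<epsilon> * \<sigma>)) x
        + (C2 + E) * indicator (slab_box e L (\<epsilon> * len)) x \<partial>lebesgue)
      = C1 * ((2 * L) ^ (DIM('a) - 1) * (2 * (\<epsilon> * \<sigma>))) + (C2 + E) * ((2 * L) ^ (DIM('a) - 1) * (2 * (\<epsilon> * len)))"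
    unfolding Bochner_Integration.integral_add[OF iF I(1)] Bochner_Integration.integral_add[OF I(2) I(1)]
      integral_flux_div_eq_0(1)[OF e1 \<epsilon> L, folded \<zeta>_def]
    by (subst (1 2) integral_slab_box) (use e L \<epsilon> \<sigma> len_pos in auto)
  finally show ?thesis .
qed

end

lemma (in p_eigenfunction) integrable_X_perp:
  assumes "compact A" "A \<subseteq> \<Omega>" "s > 0"
  shows "integrable lborel (\<lambda>x. indicator A x * norm (perp e (X x)) powr s)"
proof -
  have "continuous_on A (\<lambda>x. perp e (X x))" unfolding perp_def
    by (intro continuous_intros continuous_on_subset[OF continuous_X assms(2)])
  then have "continuous_on A (\<lambda>x. norm (perp e (X x)) powr s)"
    using assms(3) by (intro continuous_on_powr' continuous_on_norm continuous_on_const) auto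
  from borel_integrable_compact[OF assms(1) this] show ?thesis by simp
qed

section \<open>Two good points at a prescribed distance\<close>

context comparison_ode
begin

text \<open>If for every \<open>x\<close> in a box one of the points \<open>x\<close> and
  \<open>x + t *\<^sub>R e1\<close> were bad, the integrals of \<open>|X'|^q\<close> over the box
  and over its translate would together be at least \<open>\<tau>^q\<close> times the volume of the
  box, against \<open>energy_bound\<close>. The constants are chosen in the order \<sigma>,
  \<open>c2\<close>, \<delta>, none of them depending on the domain or on the eigenfunction.\<close>

lemma small_tangential_field_pair:
  fixes e e1 :: "'a::euclidean_space"
  assumes e: "e \<in> Basis" "e1 \<in> Basis" "e1 \<noteq> e" and L: "L > 0" and t: "0 \<le> t" "t \<le> L / 4" and \<tau>: "\<tau> > 0"
  obtains \<delta> where "\<delta> > 0"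
    "\<And>\<Omega> u Du \<epsilon> E. p_eigenfunction p \<Omega> u Du \<Longrightarrow> 0 < \<epsilon> \<Longrightarrow> \<epsilon> < \<delta> \<Longrightarrow> 0 \<le> E \<Longrightarrow> E < \<delta> \<Longrightarrow>
      (p - 1) * \<epsilon> powr (- p) - first_eigenvalue p \<Omega> \<le> E \<Longrightarrow>
      {x. norm (perp e x) \<le> L \<and> \<bar>x \<bullet> e\<bar> \<le> \<epsilon> * len} \<subseteq> \<Omega> \<Longrightarrow>
      \<exists>x. x \<in> \<Omega> \<and> x + t *\<^sub>R e1 \<in> \<Omega> \<and> \<bar>log_grad_field p u x \<bullet> e1\<bar> \<le> \<tau> \<and>
        \<bar>log_grad_field p u (x + t *\<^sub>R e1) \<bullet> e1\<bar> \<le> \<tau>"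
proof -
  let ?N = "DIM('a)"
  \<comment> \<open>The norm is at most the sum of the moduli of the \<open>?N\<close> coordinates,
    so the box lies within transverse radius \<open>L / 4\<close>, and its translate by at most
    \<open>L / 4\<close> within \<open>L / 2\<close>.\<close>
  define c where "c = L / (4 * real ?N)"
  have c: "c > 0" "real ?N * c = L / 4" using L by (auto simp: c_def)
  have T1: "T 1 > 0" "T 1 < len" using T_less_iff[of 0 1] T_spec(1) T_less_len by simp_all
  obtain C1 where C1: "C1 \<ge> 0" "\<And>y. y \<ge> 0 \<Longrightarrow> 4 / L * y \<le> (p - 1) / 2 * y powr q + C1"
    using absorb_constant[of "4 / L"] L by auto
  \<comment> \<open>The threshold obtained on dividing the contradictory estimate by its common
    factor \<open>4 \<epsilon> (2 L)^(N-1)\<close>. Three errors are each made at most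
    \<open>\<kappa> / 4\<close>: that of the mid-plane layer by \<sigma>, the cutoff cost and the
    eigenvalue gap by \<delta>.\<close>
  define \<kappa> where "\<kappa> = (p - 1) / 8 * \<tau> powr q * ((2 * c) ^ (?N - 1) * T 1) / (2 * (2 * L) ^ (?N - 1))"
  have \<kappa>: "\<kappa> > 0" using p \<tau> c T1 L by (simp add: \<kappa>_def)
  define \<sigma> where "\<sigma> = min (len / 2) (\<kappa> / (4 * (C1 + 1)))"
  have \<sigma>: "0 < \<sigma>" "\<sigma> < len" using len_pos \<kappa> C1 by (auto simp: \<sigma>_def)
  have "\<sigma> \<le> \<kappa> / (4 * (C1 + 1))" by (simp add: \<sigma>_def)
  then have "(C1 + 1) * \<sigma> \<le> \<kappa> / 4" using C1 by (simp add: field_simps)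
  then have C1\<sigma>: "C1 * \<sigma> \<le> \<kappa> / 4" using \<sigma> by (simp add: algebra_simps)
  define c2 where "c2 = (4 / L)\<^sup>2 / (p * \<bar>w \<sigma>\<bar> powr (q - 2))"
  have c2: "c2 \<ge> 0" using p by (simp add: c2_def)
  define z where "z = \<kappa> / (4 * (c2 + 1) * len)"
  have z: "z > 0" using \<kappa> c2 len_pos by (simp add: z_def)
  define \<delta> where "\<delta> = min (\<kappa> / (4 * len)) (z powr (1 / (2 - p)))"
  show ?thesis
  proof (rule that[of \<delta>])
    show "\<delta> > 0" using \<kappa> len_pos z by (simp add: \<delta>_def)
    fix \<Omega> u Du and \<epsilon> E :: real
    assume pe: "p_eigenfunction p \<Omega> u Du" and \<epsilon>: "0 < \<epsilon>" "\<epsilon> < \<delta>" and E: "0 \<le> E" "E < \<delta>"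
      "(p - 1) * \<epsilon> powr (- p) - first_eigenvalue p \<Omega> \<le> E"
      and sub: "{x. norm (perp e x) \<le> L \<and> \<bar>x \<bullet> e\<bar> \<le> \<epsilon> * len} \<subseteq> \<Omega>"
    interpret p_eigenfunction p \<Omega> u Du by (rule pe)
    have Elen: "E * len \<le> \<kappa> / 4"
    proof -
      have "E < \<kappa> / (4 * len)" using E by (simp add: \<delta>_def)
      then show ?thesis using len_pos by (simp add: field_simps)
    qed
    have C2len: "c2 * \<epsilon> powr (2 - p) * len \<le> \<kappa> / 4"
    proof -
      have "\<epsilon> powr (2 - p) \<le> (z powr (1 / (2 - p))) powr (2 - p)"
        using \<epsilon> p by (intro powr_mono2) (auto simp: \<delta>_def)
      also have "\<dots> = z" using p z by (simp add: powr_powr)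
      finally have "(c2 + 1) * len * \<epsilon> powr (2 - p) \<le> (c2 + 1) * len * z" using c2 len_pos by (intro mult_left_mono) auto
      also have "\<dots> = \<kappa> / 4" 
      proof -
        have "(c2 + 1) * len \<noteq> 0" using c2 len_pos by auto
        then show ?thesis unfolding z_def by (metis mult.assoc nonzero_mult_div_cancel_left mult.commute mult_divide_mult_cancel_left times_divide_eq_right)
      qed
      finally have "c2 * \<epsilon> powr (2 - p) * len + len * \<epsilon> powr (2 - p) \<le> \<kappa> / 4" by (simp add: algebra_simps)
      moreover have "len * \<epsilon> powr (2 - p) \<ge> 0" using len_pos by simp
      ultimately show ?thesis by linarith
    qed
    let ?A = "slab_box e c (\<epsilon> * T 1)" and ?tr = "\<lambda>x. x + t *\<^sub>R e1"
    have e1e: "e1 \<bullet> e = 0" using e by (simp add: inner_not_same_Basis)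
    have A: "norm (perp e x) \<le> L / 4" "\<bar>x \<bullet> e\<bar> \<le> \<epsilon> * T 1" if x: "x \<in> ?A" for x
    proof -
      have "\<bar>perp e x \<bullet> b\<bar> \<le> c" if "b \<in> Basis" for b
      proof (cases "b = e")
        case True
        then show ?thesis using perp_inner(1)[of e x] e(1) c by simp
      next
        case False
        then show ?thesis using x that perp_inner_Basis[OF e(1) that False, of x] by (auto simp: slab_box_def)
      qed
      then have "(\<Sum>b\<in>Basis. \<bar>perp e x \<bullet> b\<bar>) \<le> real ?N * c" using sum_bounded_above by metis
      then show "norm (perp e x) \<le> L / 4" using norm_le_l1[of "perp e x"] c(2) by linarith
      show "\<bar>x \<bullet> e\<bar> \<le> \<epsilon> * T 1" using x e(1) by (auto simp: slab_box_def)
    qed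
    have A1: "norm (perp e x) \<le> L / 2 \<and> \<bar>x \<bullet> e\<bar> \<le> \<epsilon> * T 1" if "x \<in> ?A" for x
      using A[OF that] L by auto
    have A2: "norm (perp e x) \<le> L / 2 \<and> \<bar>x \<bullet> e\<bar> \<le> \<epsilon> * T 1" if xA: "x \<in> ?tr ` ?A" for x
    proof -
      obtain y where y: "y \<in> ?A" "x = ?tr y" using xA by blast
      have "perp e x = perp e y + t *\<^sub>R e1" using e1e by (simp add: perp_def y(2) inner_add_left)
      then have "norm (perp e x) \<le> norm (perp e y) + t"
        using norm_triangle_ineq[of "perp e y" "t *\<^sub>R e1"] e(2) t by simp
      then show ?thesis using A[OF y(1)] t e1e by (simp add: y(2) inner_add_left)
    qed
    have in\<Omega>: "x \<in> \<Omega>" if "norm (perp e x) \<le> L / 2 \<and> \<bar>x \<bullet> e\<bar> \<le> \<epsilon> * T 1" for x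
    proof -
      have "\<epsilon> * T 1 \<le> \<epsilon> * len" using \<epsilon> T1 by simp
      then show ?thesis using sub that L by auto
    qed
    have cA: "compact ?A" by (rule compact_slab_box)
    have "continuous_on ?A ?tr" by (intro continuous_intros)
    then have cA': "compact (?tr ` ?A)" using cA by (rule compact_continuous_image)
    let ?f = "\<lambda>x. norm (perp e (X x)) powr q"
    have A12: "\<forall>x\<in>?A. norm (perp e x) \<le> L / 2 \<and> \<bar>x \<bullet> e\<bar> \<le> \<epsilon> * T 1"
      "\<forall>x\<in>?tr ` ?A. norm (perp e x) \<le> L / 2 \<and> \<bar>x \<bullet> e\<bar> \<le> \<epsilon> * T 1"
      using A1 A2 by blast+
    define R where "R = C1 * ((2 * L) ^ (?N - 1) * (2 * (\<epsilon> * \<sigma>)))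
        + (c2 * \<epsilon> powr (2 - p) + E) * ((2 * L) ^ (?N - 1) * (2 * (\<epsilon> * len)))"
    have bound: "(p - 1) / 8 * (\<integral>x. indicator A x * ?f x \<partial>lebesgue) \<le> R"
      if "compact A" "\<forall>x\<in>A. norm (perp e x) \<le> L / 2 \<and> \<bar>x \<bullet> e\<bar> \<le> \<epsilon> * T 1" for A
      unfolding R_def c2_def
      by (rule energy_bound[OF pe e(1) \<epsilon>(1) L sub E(3,1) \<sigma>]) (use C1 that in blast)+
    show "\<exists>x. x \<in> \<Omega> \<and> ?tr x \<in> \<Omega> \<and> \<bar>X x \<bullet> e1\<bar> \<le> \<tau> \<and> \<bar>X (?tr x) \<bullet> e1\<bar> \<le> \<tau>"
    proof (rule ccontr)
      assume no: "\<not> ?thesis"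
      have le: "\<bar>X x \<bullet> e1\<bar> powr q \<le> ?f x" for x
      proof -
        have "\<bar>X x \<bullet> e1\<bar> \<le> norm (perp e (X x))"
          using Basis_le_norm[OF e(2), of "perp e (X x)"] perp_inner_Basis[OF e(1,2,3)] by simp
        then show ?thesis using q_gt_2 by (intro powr_mono2) auto
      qed
      define f1 where "f1 x = indicator ?A x * ?f x" for x
      define f2 where "f2 x = indicator (?tr ` ?A) x * ?f x" for x
      have i: "integrable lborel f1" "integrable lborel f2"
        unfolding f1_def f2_def using A1 A2 in\<Omega> q_gt_2 by (intro integrable_X_perp cA cA'; force)+
      then have m: "f1 \<in> borel_measurable borel" "f2 \<in> borel_measurable borel" by auto
      have j: "integrable lebesgue f1" using i(1) by (subst integrable_completion) auto
      have j2: "integrable lebesgue (\<lambda>x. f2 (?tr x))"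
      proof -
        have "integrable (distr lborel borel ((+) (t *\<^sub>R e1))) f2" using i(2) by (simp add: lborel_distr_plus)
        then have "integrable lborel (\<lambda>x. f2 (t *\<^sub>R e1 + x))" by (rule integrable_distr[rotated]) simp
        then show ?thesis using m(2) by (subst integrable_completion) (auto simp: add.commute)
      qed
      have "(\<integral>x. \<tau> powr q * indicator ?A x \<partial>lebesgue) \<le> (\<integral>x. f1 x + f2 (?tr x) \<partial>lebesgue)"
      proof (rule integral_mono[OF integrable_slab_box Bochner_Integration.integrable_add[OF j j2]])
        fix x
        show "\<tau> powr q * indicator ?A x \<le> f1 x + f2 (?tr x)"
        proof (cases "x \<in> ?A")
          case True
          then have "\<tau> < \<bar>X x \<bullet> e1\<bar> \<or> \<tau> < \<bar>X (?tr x) \<bullet> e1\<bar>"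
            using no in\<Omega>[OF A1[OF True]] in\<Omega>[OF A2[of "?tr x"]] by force
          then have "\<tau> powr q \<le> ?f x \<or> \<tau> powr q \<le> ?f (?tr x)"
            using le[of x] le[of "?tr x"] powr_mono2[of q \<tau> "\<bar>X x \<bullet> e1\<bar>"] powr_mono2[of q \<tau> "\<bar>X (?tr x) \<bullet> e1\<bar>"] q_gt_2 \<tau>
            by (meson less_imp_le order_trans zero_less_numeral)
          then show ?thesis using True by (auto simp: f1_def f2_def add_increasing add_increasing2)
        qed (simp add: f1_def f2_def)
      qed
      also have "\<dots> = integral\<^sup>L lebesgue f1 + integral\<^sup>L lebesgue f2"
        using j j2 integral_lebesgue_translate[OF m(2), of "t *\<^sub>R e1"] by simp
      finally have "\<tau> powr q * ((2 * c) ^ (?N - 1) * (2 * (\<epsilon> * T 1))) \<le> integral\<^sup>L lebesgue f1 + integral\<^sup>L lebesgue f2"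
        using c \<epsilon> T1 by (subst (asm) integral_slab_box) (auto simp: e)
      then have "(p - 1) / 8 * (\<tau> powr q * ((2 * c) ^ (?N - 1) * (2 * (\<epsilon> * T 1)))) \<le>
          (p - 1) / 8 * integral\<^sup>L lebesgue f1 + (p - 1) / 8 * integral\<^sup>L lebesgue f2"
        unfolding distrib_left[symmetric] using p by (intro mult_left_mono) auto
      also have "\<dots> \<le> 2 * R"
        using bound[OF cA A12(1)] bound[OF cA' A12(2)] unfolding f1_def[abs_def] f2_def[abs_def] by linarith
      also have "\<dots> = (2 * L) ^ (?N - 1) * 2 * (2 * \<epsilon>) * (C1 * \<sigma> + c2 * \<epsilon> powr (2 - p) * len + E * len)"
        by (simp add: R_def algebra_simps)
      also have "\<dots> < (2 * L) ^ (?N - 1) * 2 * (2 * \<epsilon>) * \<kappa>"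
        using C1\<sigma> C2len Elen \<kappa> L \<epsilon> by (intro mult_strict_left_mono) auto
      also have "\<dots> = (p - 1) / 8 * (\<tau> powr q * ((2 * c) ^ (?N - 1) * (2 * (\<epsilon> * T 1))))"
        using L by (simp add: \<kappa>_def field_simps)
      finally show False by simp
    qed
  qed
qed

end

section \<open>Thin uniformly convex domains\<close>

locale thin_domain =
  fixes e e1 :: "'a::euclidean_space" and a H :: real and m :: nat
  assumes e: "e \<in> Basis" "e1 \<in> Basis" "e1 \<noteq> e" and a: "a > 0" and H: "0 < H" "H\<^sup>2 < 1" and m: "m \<ge> 1"
begin

text \<open>The summand \<open>H\<^sup>2 |x|\<^sup>2 / a\<^sup>2\<close> makes \<open>\<rho>\<close> uniformly convex; the high power \<open>m\<close> makes the domain nearly flat over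
  the ball of radius \<open>a / 2\<close>; and \<open>\<rho> = 0\<close> on the sphere of radius \<open>a\<close> inside the mid-plane
  \<open>x \<bullet> e = 0\<close>.\<close>

definition \<rho> :: "'a \<Rightarrow> real" where
  "\<rho> x = (x \<bullet> e)\<^sup>2 / H\<^sup>2 + H\<^sup>2 * (x \<bullet> x / a\<^sup>2) + (1 - H\<^sup>2) * (x \<bullet> x / a\<^sup>2) ^ m - 1"

text \<open>Twice the derivative of the radial part of \<rho> with respect to
  \<open>x \<bullet> x\<close>, that is, its contribution to the coefficient of \<open>x\<close> in
  the gradient.\<close>

definition \<beta> :: "'a \<Rightarrow> real" where
  "\<beta> x = 2 * H\<^sup>2 / a\<^sup>2 + (1 - H\<^sup>2) * (2 * real m / a\<^sup>2) * (x \<bullet> x / a\<^sup>2) ^ (m - 1)"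

definition d\<rho> :: "'a \<Rightarrow> 'a" where
  "d\<rho> x = (2 * (x \<bullet> e) / H\<^sup>2) *\<^sub>R e + \<beta> x *\<^sub>R x"

definition dom :: "'a set" where "dom = {x. \<rho> x < 0}"

lemma DERIV_scaled_power:
  "DERIV (\<lambda>y. (y / a\<^sup>2) ^ n) y :> real n * (1 / a\<^sup>2 * (y / a\<^sup>2) ^ (n - 1))"
  using DERIV_power[OF DERIV_cdivide[OF DERIV_ident]] by simp

lemma GDERIV_\<rho>: "GDERIV \<rho> x :> d\<rho> x"
proof -
  have 1: "DERIV (\<lambda>y. y\<^sup>2 / H\<^sup>2) (x \<bullet> e) :> 2 * (x \<bullet> e) / H\<^sup>2"
    using DERIV_cdivide[OF DERIV_pow[of 2]] by simp
  have 2: "DERIV (\<lambda>y. H\<^sup>2 * (y / a\<^sup>2) + (1 - H\<^sup>2) * (y / a\<^sup>2) ^ m - 1) (x \<bullet> x) :>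
      H\<^sup>2 * (1 / a\<^sup>2) + (1 - H\<^sup>2) * (real m * (1 / a\<^sup>2 * (x \<bullet> x / a\<^sup>2) ^ (m - 1)))"
    using DERIV_diff[OF DERIV_add[OF DERIV_cmult[OF DERIV_cdivide[OF DERIV_ident]] DERIV_cmult[OF DERIV_scaled_power]] DERIV_const]
    by simp
  have E1: "GDERIV (\<lambda>x. (x \<bullet> e)\<^sup>2 / H\<^sup>2 + (H\<^sup>2 * (x \<bullet> x / a\<^sup>2) + (1 - H\<^sup>2) * (x \<bullet> x / a\<^sup>2) ^ m - 1)) x :>
      (2 * (x \<bullet> e) / H\<^sup>2) *\<^sub>R e + (H\<^sup>2 * (1 / a\<^sup>2) + (1 - H\<^sup>2) * (real m * (1 / a\<^sup>2 * (x \<bullet> x / a\<^sup>2) ^ (m - 1)))) *\<^sub>R (2 *\<^sub>R x)"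
    by (rule GDERIV_add[OF GDERIV_DERIV_compose[OF GDERIV_inner_left 1] GDERIV_DERIV_compose[OF GDERIV_inner_self 2]])
  have E2: "(\<lambda>x. (x \<bullet> e)\<^sup>2 / H\<^sup>2 + (H\<^sup>2 * (x \<bullet> x / a\<^sup>2) + (1 - H\<^sup>2) * (x \<bullet> x / a\<^sup>2) ^ m - 1)) = \<rho>"
    by (auto simp: \<rho>_def)
  have E3: "(H\<^sup>2 * (1 / a\<^sup>2) + (1 - H\<^sup>2) * (real m * (1 / a\<^sup>2 * (x \<bullet> x / a\<^sup>2) ^ (m - 1)))) *\<^sub>R (2 *\<^sub>R x) = \<beta> x *\<^sub>R x"
    unfolding scaleR_scaleR by (rule arg_cong[where f="\<lambda>c. c *\<^sub>R x"]) (simp add: \<beta>_def algebra_simps)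
  show ?thesis using E1 unfolding E2 E3 d\<rho>_def .
qed

lemma grad_\<rho>: "grad \<rho> = d\<rho>"
  using GDERIV_grad_eq[OF GDERIV_\<rho>] by (rule ext)

lemma continuous_\<rho>: "continuous_on UNIV \<rho>"
  unfolding \<rho>_def using a H by (intro continuous_intros) auto

lemma \<beta>_ge: "\<beta> x \<ge> 2 * H\<^sup>2 / a\<^sup>2" "\<beta> x > 0"
proof -
  show 1: "\<beta> x \<ge> 2 * H\<^sup>2 / a\<^sup>2" unfolding \<beta>_def using H by simp
  have "2 * H\<^sup>2 / a\<^sup>2 > 0" using a H by simp
  then show "\<beta> x > 0" using 1 by linarith
qed

lemma d\<rho>_nonzero: "x \<noteq> 0 \<Longrightarrow> d\<rho> x \<noteq> 0"
proof
  assume "x \<noteq> 0" "d\<rho> x = 0"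
  then have "0 = d\<rho> x \<bullet> x" by simp
  also have "\<dots> = 2 * (x \<bullet> e)\<^sup>2 / H\<^sup>2 + \<beta> x * (x \<bullet> x)"
    by (simp add: d\<rho>_def inner_add_left inner_commute[of e] power2_eq_square)
  also have "\<dots> > 0" using \<open>x \<noteq> 0\<close> \<beta>_ge(2)[of x] by (intro add_nonneg_pos mult_pos_pos) auto
  finally show False by simp
qed

lemma smooth_\<rho>: "smooth_on S \<rho>"
proof -
  have "Ck_on k UNIV (\<lambda>x. inverse (H\<^sup>2) * (x \<bullet> e)\<^sup>2 + H\<^sup>2 * (inverse (a\<^sup>2) * (x \<bullet> x)) +
      (1 - H\<^sup>2) * (inverse (a\<^sup>2) * (x \<bullet> x)) ^ m - 1)" for k
    by (intro Ck_on_diff Ck_on_add Ck_on_cmult Ck_on_power Ck_on_inner_self Ck_on_const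
        Ck_on_bounded_linear bounded_linear_inner_left open_UNIV)
  then have "Ck_on k UNIV \<rho>" for k unfolding \<rho>_def[abs_def] by (simp add: field_simps)
  then show ?thesis unfolding smooth_on_def using Ck_on_subset by blast
qed

text \<open>The weights \<open>H^2\<close> and \<open>1 - H^2\<close> of the radial terms add up to
  1, so these terms alone reach 1 once \<open>|x| \<ge> a\<close>.\<close>

lemma dom_subset_ball: "dom \<subseteq> ball 0 a"
proof
  fix x assume "x \<in> dom"
  then have r: "\<rho> x < 0" by (simp add: dom_def)
  have "x \<bullet> x < a\<^sup>2"
  proof (rule ccontr)
    assume "\<not> x \<bullet> x < a\<^sup>2"
    then have 1: "x \<bullet> x / a\<^sup>2 \<ge> 1" using a by simp
    then have "(x \<bullet> x / a\<^sup>2) ^ m \<ge> 1" by (rule one_le_power)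
    then have "H\<^sup>2 * 1 + (1 - H\<^sup>2) * 1 \<le> H\<^sup>2 * (x \<bullet> x / a\<^sup>2) + (1 - H\<^sup>2) * (x \<bullet> x / a\<^sup>2) ^ m"
      using 1 H by (intro add_mono mult_left_mono) auto
    moreover have "(x \<bullet> e)\<^sup>2 / H\<^sup>2 \<ge> 0" by simp
    moreover have False if "H\<^sup>2 * 1 + (1 - H\<^sup>2) * 1 \<le> P + Q" "R \<ge> 0" "R + P + Q - 1 < 0" for P Q R :: real
      using that by simp
    ultimately show False using r unfolding \<rho>_def by blast
  qed
  then show "x \<in> ball 0 a" using a unfolding power2_norm_eq_inner[symmetric]
    by (auto intro: power_less_imp_less_base)
qed

lemma dom_slab: "x \<in> dom \<Longrightarrow> \<bar>x \<bullet> e\<bar> < H"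
proof -
  assume "x \<in> dom"
  moreover have "H\<^sup>2 * (x \<bullet> x / a\<^sup>2) \<ge> 0" "(1 - H\<^sup>2) * (x \<bullet> x / a\<^sup>2) ^ m \<ge> 0" using H by auto
  ultimately have "(x \<bullet> e)\<^sup>2 / H\<^sup>2 < 1" unfolding dom_def \<rho>_def mem_Collect_eq by linarith
  then have "\<bar>x \<bullet> e\<bar>\<^sup>2 < H\<^sup>2" using H by simp
  then show ?thesis by (rule power_less_imp_less_base) (use H in simp)
qed

lemma convex_dom: "convex dom"
proof (rule convexI)
  fix x y and s t :: real
  assume xy: "x \<in> dom" "y \<in> dom" and st: "0 \<le> s" "0 \<le> t" "s + t = 1"
  have lin: "norm (s *\<^sub>R x + t *\<^sub>R y) \<le> s * norm x + t * norm y"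
    using norm_triangle_ineq[of "s *\<^sub>R x" "t *\<^sub>R y"] st by simp
  have c2: "(s * c + t * d) ^ (2 * n) \<le> s * c ^ (2 * n) + t * d ^ (2 * n)" for c d :: real and n
  proof -
    have s: "s = 1 - t" using st by simp
    show ?thesis unfolding s using convex_onD[OF convex_power_even[of "2 * n"], of t c d] st by simp
  qed
  have pw: "((s *\<^sub>R x + t *\<^sub>R y) \<bullet> (s *\<^sub>R x + t *\<^sub>R y)) ^ n \<le> s * (x \<bullet> x) ^ n + t * (y \<bullet> y) ^ n" for n
  proof -
    have "norm (s *\<^sub>R x + t *\<^sub>R y) ^ (2 * n) \<le> (s * norm x + t * norm y) ^ (2 * n)"
      using lin by (rule power_mono) simp
    also have "\<dots> \<le> s * norm x ^ (2 * n) + t * norm y ^ (2 * n)" by (rule c2)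
    finally show ?thesis by (simp add: power_mult power2_norm_eq_inner)
  qed
  let ?z = "s *\<^sub>R x + t *\<^sub>R y"
  have "\<rho> ?z \<le> s * \<rho> x + t * \<rho> y"
  proof -
    have "(?z \<bullet> e)\<^sup>2 \<le> s * (x \<bullet> e)\<^sup>2 + t * (y \<bullet> e)\<^sup>2"
      using c2[of "x \<bullet> e" "y \<bullet> e" 1] by (simp add: inner_add_left)
    then have 1: "(?z \<bullet> e)\<^sup>2 / H\<^sup>2 \<le> (s * (x \<bullet> e)\<^sup>2 + t * (y \<bullet> e)\<^sup>2) / H\<^sup>2" by (intro divide_right_mono) auto
    have 2: "H\<^sup>2 * (?z \<bullet> ?z / a\<^sup>2) \<le> H\<^sup>2 * ((s * (x \<bullet> x) + t * (y \<bullet> y)) / a\<^sup>2)"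
      using pw[of 1] by (intro mult_left_mono divide_right_mono) auto
    have 3: "(1 - H\<^sup>2) * (?z \<bullet> ?z / a\<^sup>2) ^ m \<le> (1 - H\<^sup>2) * ((s * (x \<bullet> x) ^ m + t * (y \<bullet> y) ^ m) / (a\<^sup>2) ^ m)"
      unfolding power_divide using pw[of m] H by (intro mult_left_mono divide_right_mono) auto
    have "\<rho> ?z \<le> (s * (x \<bullet> e)\<^sup>2 + t * (y \<bullet> e)\<^sup>2) / H\<^sup>2 + H\<^sup>2 * ((s * (x \<bullet> x) + t * (y \<bullet> y)) / a\<^sup>2)
        + (1 - H\<^sup>2) * ((s * (x \<bullet> x) ^ m + t * (y \<bullet> y) ^ m) / (a\<^sup>2) ^ m) - (s + t)"
      unfolding \<rho>_def st(3) by (intro diff_mono add_mono 1 2 3 order_refl)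
    also have "\<dots> = s * \<rho> x + t * \<rho> y"
      by (simp add: \<rho>_def power_divide add_divide_distrib algebra_simps)
    finally show ?thesis .
  qed
  also have "s * \<rho> x + t * \<rho> y < 0"
  proof (cases "s = 0")
    case False
    then have "s * \<rho> x < 0" "t * \<rho> y \<le> 0" using st xy by (auto simp: dom_def mult_less_0_iff mult_le_0_iff)
    then show ?thesis by linarith
  qed (use st xy in \<open>simp add: dom_def\<close>)
  finally show "?z \<in> dom" by (simp add: dom_def)
qed

lemma open_dom: "open dom"
  unfolding dom_def by (intro open_Collect_less continuous_\<rho> continuous_on_const)

lemma zero_in_dom: "0 \<in> dom"
  using m by (simp add: dom_def \<rho>_def power_0_left)

lemma bounded_dom: "bounded dom"
  using dom_subset_ball bounded_ball bounded_subset by blast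

lemma bounded_domain_dom: "bounded_domain dom"
  unfolding bounded_domain_def
  using zero_in_dom open_dom bounded_dom convex_connected[OF convex_dom] by blast

text \<open>One global function serves at all boundary points: its only critical point is 0, which
  is interior.\<close>

lemma local_defining_function_\<rho>:
  assumes "x \<in> frontier dom"
  shows "local_defining_function dom x (- {0}) \<rho>"
proof -
  have "x \<noteq> 0" using assms zero_in_dom open_dom by (auto simp: frontier_def interior_open)
  then show ?thesis unfolding local_defining_function_def
    using smooth_\<rho> d\<rho>_nonzero by (auto simp: grad_\<rho> dom_def)
qed

lemma smooth_boundary_dom: "smooth_boundary dom"
  unfolding smooth_boundary_def using local_defining_function_\<rho> by blast

text \<open>The Hessian is \<open>\<beta> x\<close> times the identity plus nonnegative multiples of
  squares of linear forms; the lower bound comes from the constant summand of \<beta>.\<close>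

lemma has_derivative_d\<rho>:
  obtains D where "(d\<rho> has_derivative D) (at x)" "\<And>\<tau>. D \<tau> \<bullet> \<tau> \<ge> 2 * H\<^sup>2 / a\<^sup>2 * (norm \<tau>)\<^sup>2"
proof
  let ?c = "(1 - H\<^sup>2) * (2 * real m / a\<^sup>2)"
  \<comment> \<open>For \<open>m = 1\<close> the truncated exponent is harmless, because the factor
    \<open>real (m - 1)\<close> is 0.\<close>
  let ?D\<beta> = "?c * (real (m - 1) * (1 / a\<^sup>2 * (x \<bullet> x / a\<^sup>2) ^ (m - 1 - 1)))"
  let ?D = "\<lambda>h. (2 * (h \<bullet> e) / H\<^sup>2) *\<^sub>R e + (\<beta> x *\<^sub>R h + (?D\<beta> * (h \<bullet> (2 *\<^sub>R x))) *\<^sub>R x)"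
  have "DERIV (\<lambda>y. 2 * H\<^sup>2 / a\<^sup>2 + ?c * (y / a\<^sup>2) ^ (m - 1)) (x \<bullet> x) :> ?D\<beta>"
    by (rule DERIV_cong[OF DERIV_add[OF DERIV_const DERIV_cmult[OF DERIV_scaled_power]]]) simp
  from GDERIV_DERIV_compose[OF GDERIV_inner_self this]
  have \<beta>: "(\<beta> has_derivative (\<lambda>h. ?D\<beta> * (h \<bullet> (2 *\<^sub>R x)))) (at x)"
    by (simp add: gderiv_def \<beta>_def[abs_def] mult_ac)
  have "((\<lambda>x. 2 / H\<^sup>2 * (x \<bullet> e)) has_derivative (\<lambda>h. 2 / H\<^sup>2 * (h \<bullet> e))) (at x)"
    by (intro has_derivative_mult_right has_derivative_inner_left has_derivative_ident)
  then have "((\<lambda>x. 2 * (x \<bullet> e) / H\<^sup>2) has_derivative (\<lambda>h. 2 * (h \<bullet> e) / H\<^sup>2)) (at x)" by simp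
  from has_derivative_add[OF has_derivative_scaleR_left[OF this] has_derivative_scaleR[OF \<beta> has_derivative_ident]]
  show "(d\<rho> has_derivative ?D) (at x)" unfolding d\<rho>_def[abs_def] .
  fix \<tau>
  have D\<beta>: "?D\<beta> \<ge> 0" using H by simp
  have "((2 * (\<tau> \<bullet> e) / H\<^sup>2) *\<^sub>R e + (b *\<^sub>R \<tau> + (d * (\<tau> \<bullet> (2 *\<^sub>R x))) *\<^sub>R x)) \<bullet> \<tau>
      = 2 * (\<tau> \<bullet> e)\<^sup>2 / H\<^sup>2 + b * (\<tau> \<bullet> \<tau>) + 2 * (d * (\<tau> \<bullet> x)\<^sup>2)" for b d
    by (simp add: inner_add_left inner_commute[of e \<tau>] inner_commute[of x \<tau>] power2_eq_square)
  then have "?D \<tau> \<bullet> \<tau> = 2 * (\<tau> \<bullet> e)\<^sup>2 / H\<^sup>2 + \<beta> x * (\<tau> \<bullet> \<tau>) + 2 * (?D\<beta> * (\<tau> \<bullet> x)\<^sup>2)" .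
  moreover have "0 \<le> 2 * (\<tau> \<bullet> e)\<^sup>2 / H\<^sup>2" by simp
  moreover have "0 \<le> 2 * (?D\<beta> * (\<tau> \<bullet> x)\<^sup>2)" by (intro mult_nonneg_nonneg[OF _ mult_nonneg_nonneg[OF D\<beta>]]) auto
  moreover have "2 * H\<^sup>2 / a\<^sup>2 * (norm \<tau>)\<^sup>2 \<le> \<beta> x * (\<tau> \<bullet> \<tau>)"
    unfolding power2_norm_eq_inner using \<beta>_ge(1) by (rule mult_right_mono) simp
  ultimately show "?D \<tau> \<bullet> \<tau> \<ge> 2 * H\<^sup>2 / a\<^sup>2 * (norm \<tau>)\<^sup>2" by linarith
qed

text \<open>Differentiating the factor \<open>1 / norm (d\<rho> x)\<close> only contributes a
  multiple of \<open>d\<rho> x\<close>, which is orthogonal to the tangent vector; its derivative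
  \<open>N\<close> is therefore never computed.\<close>

lemma second_fundamental_form_ge:
  assumes x: "x \<noteq> 0" and \<tau>: "\<tau> \<bullet> d\<rho> x = 0"
  shows "second_fundamental_form \<rho> x \<tau> \<tau> \<ge> 2 * H\<^sup>2 / a\<^sup>2 / norm (d\<rho> x) * (norm \<tau>)\<^sup>2"
proof -
  obtain D where D: "(d\<rho> has_derivative D) (at x)" "\<And>\<tau>. D \<tau> \<bullet> \<tau> \<ge> 2 * H\<^sup>2 / a\<^sup>2 * (norm \<tau>)\<^sup>2"
    using has_derivative_d\<rho> by blast
  have n0: "norm (d\<rho> x) \<noteq> 0" using d\<rho>_nonzero[OF x] by simp
  have "(\<lambda>y. inverse (norm (d\<rho> y))) differentiable at x"
    using differentiable_chain_at[of d\<rho> x norm] differentiable_norm_at[OF d\<rho>_nonzero[OF x]] D(1) n0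
    by (intro differentiable_inverse) (auto simp: differentiable_def o_def)
  then obtain N where N: "((\<lambda>y. inverse (norm (d\<rho> y))) has_derivative N) (at x)"
    unfolding differentiable_def by blast
  have "(unit_normal \<rho> has_derivative (\<lambda>h. inverse (norm (d\<rho> x)) *\<^sub>R D h + N h *\<^sub>R d\<rho> x)) (at x)"
    unfolding unit_normal_def[abs_def] grad_\<rho> by (rule has_derivative_scaleR[OF N D(1)])
  note fd = frechet_derivative_at[OF this, symmetric]
  have "second_fundamental_form \<rho> x \<tau> \<tau> = inverse (norm (d\<rho> x)) * (D \<tau> \<bullet> \<tau>)"
    unfolding second_fundamental_form_def fd using \<tau>
    by (simp add: inner_add_left inner_commute[of "d\<rho> x" \<tau>])
  also have "\<dots> \<ge> inverse (norm (d\<rho> x)) * (2 * H\<^sup>2 / a\<^sup>2 * (norm \<tau>)\<^sup>2)"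
    using D(2) by (intro mult_left_mono) auto
  finally show ?thesis by (simp add: field_simps)
qed

lemma uniformly_convex_dom: "uniformly_convex dom"
proof -
  have c: "continuous_on (frontier dom) d\<rho>"
    unfolding d\<rho>_def \<beta>_def using a H by (intro continuous_intros) auto
  have "compact (frontier dom)" using bounded_dom by (rule compact_frontier_bounded)
  then have "compact (d\<rho> ` frontier dom)" using c by (rule compact_continuous_image[rotated])
  from compact_imp_bounded[OF this]
  obtain M where M: "M > 0" "\<And>x. x \<in> frontier dom \<Longrightarrow> norm (d\<rho> x) \<le> M"
    unfolding bounded_pos by auto
  let ?c = "2 * H\<^sup>2 / a\<^sup>2 / M"
  have "?c > 0" using H a M by simp
  moreover have "local_defining_function dom x (- {0}) \<rho> \<and>
      (\<forall>\<tau>. \<tau> \<bullet> grad \<rho> x = 0 \<longrightarrow> second_fundamental_form \<rho> x \<tau> \<tau> \<ge> ?c * (norm \<tau>)\<^sup>2)" if x: "x \<in> frontier dom" for x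
  proof (intro conjI allI impI local_defining_function_\<rho>[OF x])
    have x0: "x \<noteq> 0" using local_defining_function_\<rho>[OF x] by (auto simp: local_defining_function_def)
    fix \<tau> assume "\<tau> \<bullet> grad \<rho> x = 0"
    then have "second_fundamental_form \<rho> x \<tau> \<tau> \<ge> 2 * H\<^sup>2 / a\<^sup>2 / norm (d\<rho> x) * (norm \<tau>)\<^sup>2"
      unfolding grad_\<rho> by (rule second_fundamental_form_ge[OF x0])
    moreover have "?c * (norm \<tau>)\<^sup>2 \<le> 2 * H\<^sup>2 / a\<^sup>2 / norm (d\<rho> x) * (norm \<tau>)\<^sup>2"
      using M(2)[OF x] d\<rho>_nonzero[OF x0] by (intro mult_right_mono divide_left_mono) (auto intro: mult_pos_pos M)
    ultimately show "second_fundamental_form \<rho> x \<tau> \<tau> \<ge> ?c * (norm \<tau>)\<^sup>2" by linarith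
  qed
  ultimately show ?thesis unfolding uniformly_convex_def
    by (intro conjI exI[of _ ?c] ballI convex_dom exI[of _ "- {0}"] exI[of _ \<rho>]) auto
qed

section \<open>Diameter and inscribed cylinder\<close>

lemma axis_in_dom:
  assumes "\<bar>s\<bar> < 1"
  shows "(s * a) *\<^sub>R e1 \<in> dom"
proof -
  have e1e: "e1 \<bullet> e = 0" using e by (simp add: inner_not_same_Basis)
  have s: "s\<^sup>2 < 1" using assms by (simp add: abs_square_less_1)
  have "(s\<^sup>2) ^ m \<le> 1" by (rule power_le_one) (use s in auto)
  then have "H\<^sup>2 * s\<^sup>2 + (1 - H\<^sup>2) * (s\<^sup>2) ^ m < H\<^sup>2 * 1 + (1 - H\<^sup>2) * 1"
    using s H by (intro add_less_le_mono mult_strict_left_mono mult_left_mono) auto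
  moreover have E: "(s * a) *\<^sub>R e1 \<bullet> (s * a) *\<^sub>R e1 / a\<^sup>2 = s\<^sup>2"
    using a e(2) by (simp add: power2_eq_square)
  ultimately show ?thesis using e1e unfolding dom_def mem_Collect_eq \<rho>_def E by simp
qed

lemma diameter_dom: "diameter dom = 2 * a"
proof (rule antisym)
  show "diameter dom \<le> 2 * a"
  proof (rule diameter_le)
    fix x y assume "x \<in> dom" "y \<in> dom"
    then have "norm x < a" "norm y < a" using dom_subset_ball by auto
    then show "norm (x - y) \<le> 2 * a" using norm_triangle_ineq4[of x y] by linarith
  qed (use zero_in_dom in blast)
  show "2 * a \<le> diameter dom"
  \<comment> \<open>The domain is open and the diameter is not attained, so it is approached by the
    axis points \<open>z * a\<close> and \<open>- z * a\<close> with \<open>z < 1\<close>.\<close>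
  proof (rule field_le_mult_one_interval)
    fix z :: real assume z: "0 < z" "z < 1"
    have "dist ((z * a) *\<^sub>R e1) (((- z) * a) *\<^sub>R e1) \<le> diameter dom"
      using z by (intro diameter_bounded_bound bounded_dom axis_in_dom) auto
    moreover have "dist ((z * a) *\<^sub>R e1) (((- z) * a) *\<^sub>R e1) = z * (2 * a)"
    proof -
      have "(z * a) *\<^sub>R e1 - ((- z) * a) *\<^sub>R e1 = (z * (2 * a)) *\<^sub>R e1"
        unfolding scaleR_diff_left[symmetric] by (rule arg_cong[where f="\<lambda>c. c *\<^sub>R e1"]) simp
      then show ?thesis using z a e(2) by (simp add: dist_norm)
    qed
    ultimately show "z * (2 * a) \<le> diameter dom" by simp
  qed
qed

text \<open>Budget for \<open>\<rho> x < 0\<close>: the radial terms cost at most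
  \<open>H^2 / 2\<close> and \<open>H^2\<close>, since \<open>x \<bullet> x\<close> is at most half
  of \<open>a^2\<close>; giving up \<open>3 * H^2\<close> in the axial term more than pays for
  both.\<close>

lemma cylinder_in_dom:
  assumes "H\<^sup>2 \<le> a\<^sup>2 / 4" "(1 / 2) ^ m \<le> H\<^sup>2"
    and x: "norm (perp e x) \<le> a / 2" "(x \<bullet> e)\<^sup>2 \<le> H\<^sup>2 * (1 - 3 * H\<^sup>2)"
  shows "x \<in> dom"
proof -
  have e1: "norm e = 1" using e by simp
  have "(norm (perp e x))\<^sup>2 \<le> (a / 2)\<^sup>2" using x(1) by (intro power_mono) auto
  moreover have "H\<^sup>2 * (1 - 3 * H\<^sup>2) \<le> H\<^sup>2" using H by (intro mult_left_le) auto
  ultimately have "x \<bullet> x \<le> a\<^sup>2 / 2"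
    using perp_inner(3)[OF e1, of x] x(2) assms(1) by (simp add: power2_eq_square)
  then have half: "x \<bullet> x / a\<^sup>2 \<le> 1 / 2" using a by (simp add: field_simps)
  have "(x \<bullet> x / a\<^sup>2) ^ m \<le> (1 / 2) ^ m" using half by (intro power_mono) auto
  then have 1: "(1 - H\<^sup>2) * (x \<bullet> x / a\<^sup>2) ^ m \<le> 1 * H\<^sup>2"
    using assms(2) H by (intro mult_mono) auto
  have 2: "H\<^sup>2 * (x \<bullet> x / a\<^sup>2) \<le> H\<^sup>2 * (1 / 2)" using half by (intro mult_left_mono) auto
  have "(x \<bullet> e)\<^sup>2 / H\<^sup>2 \<le> 1 - 3 * H\<^sup>2" using x(2) H by (simp add: pos_divide_le_eq mult.commute)
  then have "\<rho> x \<le> (1 - 3 * H\<^sup>2) + H\<^sup>2 * (1 / 2) + 1 * H\<^sup>2 - 1" unfolding \<rho>_def using 1 2 by linarith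
  also have "\<dots> < 0" using H by simp
  finally show ?thesis by (simp add: dom_def)
qed

end

section \<open>Choice of the points\<close>

lemma first_eigenfunctionD:
  assumes "first_eigenfunction p \<Omega> u" "1 < p" "p < 2" "open \<Omega>" "\<Omega> \<noteq> {}"
  obtains Du where "p_eigenfunction p \<Omega> u Du"
proof -
  from assms(1) obtain Du where "W01p p \<Omega> u Du" "Lp_pow p \<Omega> Du / Lp_pow p \<Omega> u = first_eigenvalue p \<Omega>"
    unfolding first_eigenfunction_def by blast
  then have "p_eigenfunction p \<Omega> u Du"
    using assms unfolding first_eigenfunction_def by unfold_locales auto
  then show ?thesis by (rule that)
qed

text \<open>The point may not depend on \<open>u\<close>: by uniqueness it suffices to optimise for one eigenfunction.\<close>

lemma almost_optimal_point:
  fixes S \<Omega> :: "'a::euclidean_space set"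
  assumes p: "1 < p" "p < 2" and \<Omega>: "open \<Omega>" and S: "S \<subseteq> \<Omega>" "(+) v ` S \<subseteq> \<Omega>" "S \<noteq> {}" and "\<eta> > 0"
  shows "\<exists>x\<in>S. \<forall>u. first_eigenfunction p \<Omega> u \<longrightarrow> (\<forall>z\<in>S.
    \<bar>log_grad_field p u x \<bullet> d\<bar> + \<bar>log_grad_field p u (v + x) \<bullet> d\<bar> \<le>
    \<bar>log_grad_field p u z \<bullet> d\<bar> + \<bar>log_grad_field p u (v + z) \<bullet> d\<bar> + \<eta>)"
proof (cases "\<exists>u0. first_eigenfunction p \<Omega> u0")
  case True
  then obtain u0 where u0: "first_eigenfunction p \<Omega> u0" by blast
  have ne: "\<Omega> \<noteq> {}" using S by auto
  define g where "g u z = \<bar>log_grad_field p u z \<bullet> d\<bar> + \<bar>log_grad_field p u (v + z) \<bullet> d\<bar>" for u z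
  have g_eq: "g u z = g u0 z" if "first_eigenfunction p \<Omega> u" "z \<in> S" for u z
    using first_eigenfunctionD[OF that(1) p \<Omega> ne] first_eigenfunctionD[OF u0 p \<Omega> ne]
      log_grad_field_unique[of p \<Omega> u _ u0] S that(2)
    unfolding g_def by (metis image_subset_iff subsetD)
  have bdd: "bdd_below (g u0 ` S)" by (rule bdd_belowI2[where m=0]) (simp add: g_def)
  \<comment> \<open>The infimum need not be attained, hence the slack \<eta>.\<close>
  obtain x where x: "x \<in> S" "g u0 x < Inf (g u0 ` S) + \<eta>"
    using cInf_lessD[of "g u0 ` S" "Inf (g u0 ` S) + \<eta>"] S(3) \<open>\<eta> > 0\<close> by auto
  show ?thesis
  proof (intro bexI[OF _ x(1)] allI impI ballI)
    fix u z assume u: "first_eigenfunction p \<Omega> u" and z: "z \<in> S"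
    have "Inf (g u0 ` S) \<le> g u0 z" using z bdd by (intro cInf_lower) auto
    then have "g u x \<le> g u z + \<eta>" using x g_eq[OF u] z by simp
    then show "\<bar>log_grad_field p u x \<bullet> d\<bar> + \<bar>log_grad_field p u (v + x) \<bullet> d\<bar> \<le>
        \<bar>log_grad_field p u z \<bullet> d\<bar> + \<bar>log_grad_field p u (v + z) \<bullet> d\<bar> + \<eta>"
      by (simp add: g_def)
  qed
\<comment> \<open>Without any eigenfunction the claim is vacuous and every point of \<open>S\<close>
  will do.\<close>
qed (use S in auto)

text \<open>The domain lies in the slab of half-height \<open>H\<close>, and the inscribed cylinder
  has half-height \<open>H * sqrt (1 - 3 * H^2)\<close>. By scaling, the two slab values differ by a
  multiple of \<open>H^(-p)\<close> times \<open>(1 - 3 * H^2)^(-p/2) - 1\<close>, and the latter is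
  at most \<open>6 * H^2\<close> because \<open>p < 2\<close> and
  \<open>6 * H^2 \<le> 1\<close>.\<close>

lemma eigenvalue_gap:
  assumes thin: "thin_domain e e1 a H m" and H6: "6 * H\<^sup>2 \<le> 1"
    and u: "p_eigenfunction p (thin_domain.dom e a H m) u Du"
  defines l: "l \<equiv> comparison_ode.len p (p / (p - 1))"
  shows "(p - 1) * (H * sqrt (1 - 3 * H\<^sup>2) / l) powr (- p) - first_eigenvalue p (thin_domain.dom e a H m)
    \<le> 6 * (p - 1) * l powr p * H powr (2 - p)"
proof -
  interpret u: p_eigenfunction p "thin_domain.dom e a H m" u Du by (rule u)
  interpret comparison_ode p "p / (p - 1)" using u.p by unfold_locales auto
  interpret thin_domain e e1 a H m by (rule thin)
  have l0: "l > 0" using len_pos unfolding l .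
  define s where "s = 1 - 3 * H\<^sup>2"
  have s: "1 / 2 \<le> s" "s < 1" using H6 H by (auto simp: s_def)
  have "(p - 1) * (H / l) powr (- p) \<le> u.ev"
    using e(1) l0 H dom_slab by (intro u.ev_ge_slab[of e]) (auto simp: l)
  moreover have "(H * sqrt s / l) powr (- p) = (H / l) powr (- p) * s powr (- p / 2)"
    using s H l0 by (simp add: powr_mult powr_divide powr_half_sqrt[symmetric] powr_powr)
  moreover have "s powr (- p / 2) \<le> 1 + 6 * H\<^sup>2"
  proof -
    have "s powr (- p / 2) \<le> s powr (- 1)"
      using s u.p by (intro powr_mono') auto
    also have "\<dots> = 1 / s" using s by (simp add: powr_minus_divide)
    also have "\<dots> \<le> 1 + 6 * H\<^sup>2"
    proof -
      have "0 \<le> 3 * H\<^sup>2 * (1 - 6 * H\<^sup>2)" using H6 by (intro mult_nonneg_nonneg) auto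
      then have "1 \<le> (1 + 6 * H\<^sup>2) * s" by (simp add: s_def algebra_simps)
      then show ?thesis using s by (simp add: pos_divide_le_eq)
    qed
    finally show ?thesis .
  qed
  then have "(p - 1) * (H / l) powr (- p) * s powr (- p / 2) \<le> (p - 1) * (H / l) powr (- p) * (1 + 6 * H\<^sup>2)"
    using u.p by (intro mult_left_mono) auto
  ultimately have "(p - 1) * (H * sqrt s / l) powr (- p) - u.ev \<le> 6 * (p - 1) * ((H / l) powr (- p) * H\<^sup>2)"
    by (simp add: algebra_simps)
  also have "(H / l) powr (- p) = l powr p * H powr (- p)"
    using H l0 by (simp add: powr_divide powr_minus field_simps)
  also have "l powr p * H powr (- p) * H\<^sup>2 = l powr p * H powr (2 - p)"
    using H by (simp add: powr_diff powr_minus field_simps)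
  finally show ?thesis by (simp add: s_def mult.assoc)
qed


lemma exists_degenerating_domains:
  fixes e e1 :: "'a::euclidean_space" and p D r :: real
  assumes e: "e \<in> Basis" "e1 \<in> Basis" "e1 \<noteq> e" and p: "1 < p" "p < 2" and r: "0 < r" "r < D / 32"
  shows "\<exists>(\<Omega> :: nat \<Rightarrow> 'a set) x y.
    (\<forall>k. bounded_domain (\<Omega> k) \<and> smooth_boundary (\<Omega> k) \<and> uniformly_convex (\<Omega> k) \<and>
         x k \<in> \<Omega> k \<and> y k \<in> \<Omega> k \<and> x k \<noteq> y k \<and>
         diameter (\<Omega> k) = D \<and> norm (x k - y k) = 2 * r) \<and>
    (\<forall>u. (\<forall>k. first_eigenfunction p (\<Omega> k) (u k)) \<longrightarrow>
       (\<lambda>k. (log_grad_field p (u k) (y k) - log_grad_field p (u k) (x k)) \<bullet>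
             ((y k - x k) /\<^sub>R norm (y k - x k))) \<longlonglongrightarrow> 0)"
proof -
  interpret comparison_ode p "p / (p - 1)" using p by unfold_locales auto
  define a where "a = D / 2"
  \<comment> \<open>The cylinder has radius \<open>a / 2\<close>, and the pair lemma permits shifts
    up to a quarter of it, that is, \<open>2 * r \<le> D / 16\<close>. This is the origin of
    \<open>D / 32\<close>.\<close>
  have a: "a > 0" "r < a" "2 * r \<le> a / 2 / 4" using r by (auto simp: a_def)
  define v where "v = (2 * r) *\<^sub>R e1"
  have e1: "norm e1 = 1" using e by simp
  have nv: "norm v = 2 * r" "v \<noteq> 0" using r e1 by (auto simp: v_def)
  have "(\<lambda>n. ((1 / 2) ^ n)\<^sup>2 :: real) \<longlonglongrightarrow> 0\<^sup>2" by (intro tendsto_intros LIMSEQ_power_zero) auto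
  moreover have "0\<^sup>2 < min (a\<^sup>2 / 4) (1 / 6)" using a by simp
  ultimately have "eventually (\<lambda>n. ((1 / 2) ^ n)\<^sup>2 < min (a\<^sup>2 / 4) (1 / 6)) sequentially"
    by (rule order_tendstoD)
  then obtain k0 where k0: "\<And>n. n \<ge> k0 \<Longrightarrow> ((1 / 2) ^ n)\<^sup>2 < min (a\<^sup>2 / 4) (1 / 6)"
    unfolding eventually_sequentially by blast
  \<comment> \<open>The shift makes the smallness conditions hold for every \<open>k\<close> and
    keeps \<open>n k\<close> positive; then \<open>m = 2 * n\<close> gives
    \<open>(1 / 2)^m = H^2\<close>.\<close>
  define n where "n k = k + Suc k0" for k
  define H where "H k = (1 / 2 :: real) ^ n k" for k
  define m where "m k = 2 * n k" for k
  have H: "H k > 0" "(H k)\<^sup>2 \<le> a\<^sup>2 / 4" "6 * (H k)\<^sup>2 \<le> 1" "(H k)\<^sup>2 < 1" for k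
    using k0[of "n k"] by (auto simp: H_def n_def)
  have Hm: "(1 / 2) ^ m k \<le> (H k)\<^sup>2" for k
    by (simp only: H_def m_def power_mult mult.commute[of 2] order_refl)
  have H0: "H \<longlonglongrightarrow> 0"
    unfolding H_def n_def power_add by (intro tendsto_mult_left_zero LIMSEQ_power_zero) auto
  have thin: "thin_domain e e1 a (H k) (m k)" for k
    using e a H[of k] by unfold_locales (auto simp: m_def n_def)
  define \<Omega> where "\<Omega> k = thin_domain.dom e a (H k) (m k)" for k
  note dom = thin_domain.bounded_domain_dom[OF thin, folded \<Omega>_def]
    thin_domain.smooth_boundary_dom[OF thin, folded \<Omega>_def]
    thin_domain.uniformly_convex_dom[OF thin, folded \<Omega>_def]
    thin_domain.diameter_dom[OF thin, folded \<Omega>_def]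
    thin_domain.open_dom[OF thin, folded \<Omega>_def]
    thin_domain.axis_in_dom[OF thin, folded \<Omega>_def]
    thin_domain.cylinder_in_dom[OF thin, folded \<Omega>_def]
    thin_domain.zero_in_dom[OF thin, folded \<Omega>_def]
  define S where "S k = {x \<in> \<Omega> k. v + x \<in> \<Omega> k}" for k
  have S: "S k \<noteq> {}" "S k \<subseteq> \<Omega> k" "(+) v ` S k \<subseteq> \<Omega> k" for k
  proof -
    \<comment> \<open>The axis points at distance \<open>r\<close> on both sides of the centre form
      an admissible pair, since \<open>r < a\<close>.\<close>
    have "(- r / a * a) *\<^sub>R e1 \<in> \<Omega> k" "(r / a * a) *\<^sub>R e1 \<in> \<Omega> k" using a(1,2) r(1) by (intro dom(6); simp)+
    moreover have "v + (- r / a * a) *\<^sub>R e1 = (r / a * a) *\<^sub>R e1"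
      unfolding v_def scaleR_add_left[symmetric] using a by (intro arg_cong[where f="\<lambda>c. c *\<^sub>R e1"]) simp
    ultimately show "S k \<noteq> {}" unfolding S_def by (metis (mono_tags, lifting) empty_iff mem_Collect_eq)
  qed (auto simp: S_def)
  define g where "g u z = \<bar>log_grad_field p u z \<bullet> e1\<bar> + \<bar>log_grad_field p u (v + z) \<bullet> e1\<bar>" for u z
  \<comment> \<open>The points are fixed here, before any \<open>u\<close>; the slack
    \<open>1 / Suc k\<close> disappears in the limit.\<close>
  have "\<exists>x\<in>S k. \<forall>u. first_eigenfunction p (\<Omega> k) u \<longrightarrow> (\<forall>z\<in>S k. g u x \<le> g u z + 1 / Suc k)" for k
    unfolding g_def using S dom(5) by (intro almost_optimal_point p) auto
  then obtain x where x: "\<And>k. x k \<in> S k"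
    "\<And>k u z. first_eigenfunction p (\<Omega> k) u \<Longrightarrow> z \<in> S k \<Longrightarrow> g u (x k) \<le> g u z + 1 / Suc k"
    by metis
  define y where "y k = v + x k" for k
  show ?thesis
  proof (rule exI[of _ \<Omega>], rule exI[of _ x], rule exI[of _ y], intro conjI allI impI)
    fix k
    show "x k \<in> \<Omega> k" "y k \<in> \<Omega> k" using x(1)[of k] by (auto simp: S_def y_def)
    show "x k \<noteq> y k" "norm (x k - y k) = 2 * r" using nv by (auto simp: y_def norm_minus_commute)
    show "diameter (\<Omega> k) = D" using dom(4) by (simp add: a_def)
  next
    fix u assume u: "\<forall>k. first_eigenfunction p (\<Omega> k) (u k)"
    have dir: "(y k - x k) /\<^sub>R norm (y k - x k) = e1" for k using nv r by (simp add: y_def v_def)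
    define \<epsilon> where "\<epsilon> k = H k * sqrt (1 - 3 * (H k)\<^sup>2) / len" for k
    define E where "E k = 6 * (p - 1) * len powr p * H k powr (2 - p)" for k
    have "\<epsilon> \<longlonglongrightarrow> 0 * sqrt (1 - 3 * 0\<^sup>2) / len"
      unfolding \<epsilon>_def using len_pos by (intro tendsto_intros H0) auto
    then have \<epsilon>0: "\<epsilon> \<longlonglongrightarrow> 0" by simp
    have "(\<lambda>k. H k powr (2 - p)) \<longlonglongrightarrow> 0"
      using p H(1) by (intro tendsto_zero_powrI[OF H0 tendsto_const]) (auto intro: less_imp_le always_eventually)
    then have E0: "E \<longlonglongrightarrow> 0" unfolding E_def by (rule tendsto_mult_right_zero)
    have pos: "\<epsilon> k > 0" "E k \<ge> 0" for k
      using H(1,3)[of k] len_pos p by (auto simp: \<epsilon>_def E_def)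
    have cyl: "{x. norm (perp e x) \<le> a / 2 \<and> \<bar>x \<bullet> e\<bar> \<le> \<epsilon> k * len} \<subseteq> \<Omega> k" for k
    proof safe
      fix x assume x: "norm (perp e x) \<le> a / 2" "\<bar>x \<bullet> e\<bar> \<le> \<epsilon> k * len"
      have "(x \<bullet> e)\<^sup>2 \<le> (\<epsilon> k * len)\<^sup>2" using x(2) pos[of k] len_pos by (intro abs_le_square_iff[THEN iffD1]) auto
      also have "\<dots> = (H k)\<^sup>2 * (1 - 3 * (H k)\<^sup>2)"
        using len_pos H(3)[of k] by (simp add: \<epsilon>_def power_mult_distrib)
      finally show "x \<in> \<Omega> k" using x(1) H Hm by (intro dom(7))
    qed
    have lim: "(\<lambda>k. g (u k) (x k)) \<longlonglongrightarrow> 0"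
    proof (rule tendstoI)
      fix \<eta> :: real assume "\<eta> > 0"
      then have "\<eta> / 4 > 0" by simp
      from small_tangential_field_pair[OF e _ _ a(3) this] obtain \<delta> where \<delta>: "\<delta> > 0"
        "\<And>\<Omega> u Du \<epsilon> E. p_eigenfunction p \<Omega> u Du \<Longrightarrow> 0 < \<epsilon> \<Longrightarrow> \<epsilon> < \<delta> \<Longrightarrow> 0 \<le> E \<Longrightarrow> E < \<delta> \<Longrightarrow>
          (p - 1) * \<epsilon> powr (- p) - first_eigenvalue p \<Omega> \<le> E \<Longrightarrow>
          {x. norm (perp e x) \<le> a / 2 \<and> \<bar>x \<bullet> e\<bar> \<le> \<epsilon> * len} \<subseteq> \<Omega> \<Longrightarrow>
          \<exists>x. x \<in> \<Omega> \<and> x + (2 * r) *\<^sub>R e1 \<in> \<Omega> \<and> \<bar>log_grad_field p u x \<bullet> e1\<bar> \<le> \<eta> / 4 \<and>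
            \<bar>log_grad_field p u (x + (2 * r) *\<^sub>R e1) \<bullet> e1\<bar> \<le> \<eta> / 4"
        using a(1) r(1) by auto
      have "eventually (\<lambda>k. 1 / Suc k < \<eta> / 2) sequentially"
        using \<open>\<eta> > 0\<close> LIMSEQ_Suc[OF lim_1_over_n] by (intro order_tendstoD(2)) auto
      moreover have "eventually (\<lambda>k. \<epsilon> k < \<delta>) sequentially" using \<epsilon>0 \<delta>(1) by (rule order_tendstoD)
      moreover have "eventually (\<lambda>k. E k < \<delta>) sequentially" using E0 \<delta>(1) by (rule order_tendstoD)
      ultimately show "eventually (\<lambda>k. dist (g (u k) (x k)) 0 < \<eta>) sequentially"
      proof eventually_elim
        case (elim k)
        obtain Du where Du: "p_eigenfunction p (\<Omega> k) (u k) Du"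
          using first_eigenfunctionD u p dom(5,8) by (metis empty_iff)
        have gap: "(p - 1) * \<epsilon> k powr (- p) - first_eigenvalue p (\<Omega> k) \<le> E k"
          using eigenvalue_gap[OF thin H(3) Du[unfolded \<Omega>_def]] unfolding \<epsilon>_def E_def \<Omega>_def .
        obtain z where "z \<in> \<Omega> k" "z + v \<in> \<Omega> k" and
          z: "\<bar>log_grad_field p (u k) z \<bullet> e1\<bar> \<le> \<eta> / 4" "\<bar>log_grad_field p (u k) (z + v) \<bullet> e1\<bar> \<le> \<eta> / 4"
          using \<delta>(2)[OF Du pos(1) elim(2) pos(2) elim(3) gap cyl] unfolding v_def by blast
        then have "z \<in> S k" by (simp add: S_def add.commute)
        then have "g (u k) (x k) \<le> g (u k) z + 1 / Suc k" using x(2) u by blast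
        also have "\<dots> < \<eta>" using z elim(1) by (simp add: g_def add.commute)
        finally show ?case by (simp add: g_def)
      qed
    qed
    show "(\<lambda>k. (log_grad_field p (u k) (y k) - log_grad_field p (u k) (x k)) \<bullet>
        ((y k - x k) /\<^sub>R norm (y k - x k))) \<longlonglongrightarrow> 0"
      unfolding dir
      by (rule Lim_null_comparison[OF always_eventually lim]) (auto simp: g_def y_def inner_diff_left)
  qed (use dom in auto)
qed

theorem theorem1p4:
  fixes p D :: real
  assumes "CARD('n::finite) \<ge> 2" and "1 < p" and "p < 2" and "D > 0"
  shows "\<exists>rs>0. \<forall>r. 0 < r \<and> r < rs \<longrightarrow>
    (\<exists>(\<Omega> :: nat \<Rightarrow> (real ^ 'n) set) (x :: nat \<Rightarrow> real ^ 'n) (y :: nat \<Rightarrow> real ^ 'n).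
       (\<forall>k. bounded_domain (\<Omega> k) \<and> smooth_boundary (\<Omega> k) \<and> uniformly_convex (\<Omega> k) \<and>
            x k \<in> \<Omega> k \<and> y k \<in> \<Omega> k \<and> x k \<noteq> y k \<and>
            diameter (\<Omega> k) = D \<and> norm (x k - y k) = 2 * r) \<and>
       (\<forall>u :: nat \<Rightarrow> real ^ 'n \<Rightarrow> real. (\<forall>k. first_eigenfunction p (\<Omega> k) (u k)) \<longrightarrow>
          (\<lambda>k. (log_grad_field p (u k) (y k) - log_grad_field p (u k) (x k)) \<bullet>
                ((y k - x k) /\<^sub>R norm (y k - x k))) \<longlonglongrightarrow> 0))"
proof -
  \<comment> \<open>Dimension at least 2 supplies a direction orthogonal to the thin one.\<close>
  have "card (Basis :: (real ^ 'n) set) \<noteq> 1" using assms(1) by simp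
  then obtain e e1 :: "real ^ 'n" where "e \<in> Basis" "e1 \<in> Basis" "e1 \<noteq> e"
    by (metis is_singletonI' is_singleton_altdef nonempty_Basis)
  then show ?thesis
    using assms by (intro exI[of _ "D / 32"] conjI allI impI exists_degenerating_domains) auto
qed

end
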